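(* For each of the following parameter families, and for every positive integer $m$ satisfying $m\ge k-1$ together with the congruence condition given (if any), there exists a non-simple $2$-$(v,k,\lambda)_q$ design, where the parameters are listed as $(v,k,\lambda)_q$ with $q\in\{2,3,4,5\}$: (i) $(7m,\,3,\,126)_2$; (ii) $(10m,\,5,\,155(2^{10m-6}-2^{14})(2^{10m}-2^{30}))_2$ with $m\equiv 2,3\pmod 4$; (iii) $(10m+1,\,5,\,155(2^{10m-3}-2^{17})(2^{10m}-2^{30}))_2$ with $m\equiv 2,3,11,30\pmod{36}$; (iv) $(11m,\,5,\,155(2^{11m-6}-2^{16})(2^{11m}-2^{33}))_2$ with $m\equiv 2,3,11,66\pmod{72}$; (v) $(11m+1,\,5,\,155(2^{11m-3}-2^{19})(2^{11m}-2^{33}))_2$ with $m\equiv 2,3,83,282\pmod{360}$; (vi) $(12m,\,5,\,155(2^{12m-6}-2^{18})(2^{12m}-2^{36})/7)_2$ with $m\equiv 2,3,8,12\pmod{15}$; (vii) $(12m,\,6,\,93(2^{12m-11}-2^{13})(2^{12m}-2^{36})(2^{12m}-2^{48})/7)_2$ with $m\equiv 2,3,4\pmod 5$; (viii) $(8m,\,4,\,520(3^{8m-2}-3^{14}))_3$ with $m\equiv 2\pmod 3$; (ix) $(8m,\,4,\,7140(4^{8m-3}-4^{13}))_4$ with $m\equiv 2\pmod 3$; (x) $(8m,\,4,\,4836(5^{8m-2}-5^{14}))_5$ with $m\equiv 2\pmod 3$.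
   Context: A $2$-$(v,k,\lambda)_q$ design (subspace $2$-design) is a pair $(V,\mathcal B)$ where $V$ is a $v$-dimensional vector space over $\mathrm{GF}(q)$ and $\mathcal B$ is a collection, possibly with repetition, of $k$-dimensional subspaces of $V$ (blocks) such that each $2$-dimensional subspace of $V$ is contained in exactly $\lambda$ blocks (counted with multiplicity). It is simple if there are no repeated blocks, and non-simple otherwise. *)

theory Defs
  imports Complex_Main "HOL-Library.Multiset" "HOL-Library.Cardinality" "HOL-Library.Function_Algebras"
begin

text \<open>
  The pair \<open>(V, B)\<close> is a \<open>2\<close>-\<open>(v, k, l)\<^sub>q\<close> design, where \<open>q\<close> is the cardinality of the field of
  scalars \<open>'a\<close>.  The underlying vector space is an arbitrary subspace \<open>V\<close> of the type \<open>'b\<close>, so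
  that its dimension \<open>v\<close> can be a variable.  Blocks form a multiset; the condition on \<open>2\<close>-dimensional
  subspaces counts them with multiplicity.  Finiteness of \<open>V\<close> is included because the library's
  \<open>dim\<close> is \<open>0\<close> on infinite-dimensional spaces (over a finite field, a space is
  finite-dimensional iff it is finite).
\<close>

definition (in vector_space) subspace_2_design ::
    "nat \<Rightarrow> nat \<Rightarrow> nat \<Rightarrow> 'b set \<Rightarrow> 'b set multiset \<Rightarrow> bool" where
  "subspace_2_design v k l V B \<longleftrightarrow>
     subspace V \<and> finite V \<and> dim V = v \<and>
     (\<forall>U \<in># B. subspace U \<and> U \<subseteq> V \<and> dim U = k) \<and>
     (\<forall>T. subspace T \<and> T \<subseteq> V \<and> dim T = 2 \<longrightarrow> size {#U \<in># B. T \<subseteq> U#} = l)"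

definition simple_blocks :: "'b set multiset \<Rightarrow> bool" where
  "simple_blocks B \<longleftrightarrow> (\<forall>U \<in># B. count B U = 1)"

text \<open>
  The ambient space \<open>nat \<Rightarrow> 'a\<close> is infinite-dimensional and hence contains a copy of every
  finite-dimensional vector space over \<open>'a\<close>, so existence of a design loses no generality
  when \<open>V\<close> ranges over its subspaces.
\<close>

definition seq_scale :: "'a::field \<Rightarrow> (nat \<Rightarrow> 'a) \<Rightarrow> nat \<Rightarrow> 'a" where
  "seq_scale c x = (\<lambda>i. c * x i)"

global_interpretation seq: vector_space "seq_scale :: 'a::field \<Rightarrow> (nat \<Rightarrow> 'a) \<Rightarrow> nat \<Rightarrow> 'a"
  by standard (auto simp: seq_scale_def fun_eq_iff algebra_simps)

definition ex_nonsimple_2_design :: "'a::field itself \<Rightarrow> nat \<Rightarrow> nat \<Rightarrow> nat \<Rightarrow> bool" where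
  "ex_nonsimple_2_design _ v k l \<longleftrightarrow>
     (\<exists>(V :: (nat \<Rightarrow> 'a) set) B. seq.subspace_2_design v k l V B \<and> \<not> simple_blocks B)"

end

theory Submission
  imports Defs "HOL-Algebra.Algebraic_Closure_Type" "HOL-Library.Numeral_Type"
    "HOL-Library.Product_Plus"
begin

text \<open>
  Let \<open>Q = q\<^sup>l\<close> and regard \<open>V = GF(Q)\<^sup>m\<close> as a space of dimension \<open>l m\<close> over \<open>GF(q)\<close>. A \<open>GF(q)\<close>-subspace
  is scattered if it meets each one-dimensional \<open>GF(Q)\<close>-subspace in dimension at most \<open>1\<close>. The blocks
  of a family of scattered subspaces that is invariant under \<open>GL(m, Q)\<close> contain no two-dimensional
  subspace of a \<open>GF(Q)\<close>-point, and all other two-dimensional subspaces equally often. So filling the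
  \<open>GF(Q)\<close>-points with a design on \<open>GF(q)\<^sup>l\<close> with the right \<open>\<lambda>\<close> yields a design on \<open>V\<close>. The blocks used are
  spanned by \<open>n\<close> vectors \<open>y\<^sub>1, \<dots>, y\<^sub>n\<close> and the vectors \<open>x u + x\<^sup>q v\<close>, where \<open>x\<close> ranges over a \<open>d\<close>-dimensional
  subspace of \<open>GF(Q)\<close> and \<open>u, v, y\<^sub>1, \<dots>, y\<^sub>n\<close> are independent over \<open>GF(Q)\<close>. For dimension \<open>l m + 1\<close>, blocks
  are replaced by the graphs of their linear functionals, which lie in \<open>V \<times> GF(q)\<close>.

  The designs on \<open>GF(q)\<^sup>l\<close> needed for the filling arise in the same way from \<open>m = 2\<close>, a smaller \<open>l\<close> and
  \<open>n = 0\<close>, where the points, or the cylinders over them, carry complete designs. Their \<open>\<lambda>\<close> always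
  divides the required one, properly, which makes the filling non-simple. Only the \<open>2\<close>-\<open>(7, 3, 126)\<^sub>2\<close>
  design needs a mixture of several orbits.
\<close>

section \<open>Subspaces over a finite field\<close>

text \<open>Why the twist: if c maps a nonzero vector \<open>x u + x^q v\<close> of a block to
  another vector \<open>y u + y^q v\<close>, then c x = y and c x^q = y^q, so c^q = c and c lies in
  GF(q). All choices of u, v and the vectors y cover lines too often, but the multiplicities of the
  blocks have a common divisor and are divided by it: the number of ordered completions to a block,
  times the order of a group C of field elements that preserves the range D of x. In general C
  consists of the nonzero elements of GF(q). If D = GF(8), it has order 7, hence the denominator 7
  in (vi) and (vii). Double counting then gives \<open>lambda |C| prod_{i<n} (q^(d+n) - q^(d+i)) =
  mu (q^(d+n) - 1) (q^(d+n) - q) prod_{i<n} (Q^m - Q^(2+i))\<close>, where mu is a repetition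
  factor. All families have d = 3 and n = k - 3, with mu = 1 except for mu = 3 in (i); graphs
  multiply lambda by q^(k-2). What remains is to see that the lambda of the small design divides the
  required one, which is a matter of powers of q modulo small numbers.\<close>

locale finite_field_space = vector_space scale
  for scale :: "'a::{field,finite} \<Rightarrow> 'b::ab_group_add \<Rightarrow> 'b"
begin


lemma card_scalars_ge_2: "2 \<le> CARD('a)"
proof -
  have "card {0, 1::'a} \<le> CARD('a)" by (rule card_mono) auto
  then show ?thesis by simp
qed

lemma span_insert_eq: "span (insert y W) = (\<lambda>(c, w). scale c y + w) ` (UNIV \<times> span W)"
proof -
  have "x \<in> (\<lambda>(c, w). scale c y + w) ` (UNIV \<times> span W)" if "x - scale k y \<in> span W" for x k
    using that by (intro image_eqI[of _ _ "(k, x - scale k y)"]) auto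
  moreover have "\<exists>k. (scale c y + w) - scale k y \<in> span W" if "w \<in> span W" for c w
    using that by (intro exI[of _ c]) simp
  ultimately show ?thesis by (auto simp: span_insert)
qed

lemma finite_span_insert: "finite (span W) \<Longrightarrow> finite (span (insert y W))"
  by (simp add: span_insert_eq)

lemma card_span_insert:
  assumes "y \<notin> span W"
  shows "card (span (insert y W)) = CARD('a) * card (span W)"
proof -
  have "inj_on (\<lambda>(c, w). scale c y + w) (UNIV \<times> span W)"
  proof (rule inj_onI, clarify)
    fix c w c' w' assume *: "w \<in> span W" "w' \<in> span W" "scale c y + w = scale c' y + w'"
    then have "scale (c - c') y = w' - w" by (simp add: algebra_simps)
    then have "scale (c - c') y \<in> span W" using * span_diff by metis
    then have "c = c'" using assms
      by (metis eq_iff_diff_eq_0 linear_imp_scale span_scale scale_one scale_scale field_class.field_inverse)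
    then show "c = c' \<and> w = w'" using * by simp
  qed
  then show ?thesis by (simp add: span_insert_eq card_image card_cartesian_product)
qed

lemma card_span_independent:
  assumes "finite B" "independent B"
  shows "finite (span B) \<and> card (span B) = CARD('a) ^ card B"
  using assms
proof (induction B)
  case (insert y B)
  then have "y \<notin> span B" "independent B" by (auto simp: independent_insert split: if_splits)
  then show ?case using insert by (simp add: card_span_insert finite_span_insert)
qed auto

lemma card_subspace:
  assumes "subspace V" "finite V"
  shows "card V = CARD('a) ^ dim V"
proof -
  obtain B where B: "B \<subseteq> V" "independent B" "V \<subseteq> span B" "card B = dim V"
    using basis_exists by blast
  then have "span B = V" using assms span_subspace by blast
  then show ?thesis using card_span_independent[of B] B assms finite_subset by metis
qed

text \<open>Dimensions are compared through cardinalities from here on, which turns most dimension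
  arguments into counting.\<close>

lemma dim_eq_iff_card:
  assumes "subspace V" "finite V"
  shows "dim V = k \<longleftrightarrow> card V = CARD('a) ^ k"
  using card_subspace[OF assms] card_scalars_ge_2 by auto

text \<open>Independence in the quotient by \<open>span W\<close>. The head is tested against the
  tail, so lists grow at the front.\<close>

primrec rel_indep :: "'b set \<Rightarrow> 'b list \<Rightarrow> bool" where
  "rel_indep W [] = True"
| "rel_indep W (y # ys) = (rel_indep W ys \<and> y \<notin> span (W \<union> set ys))"

lemma finite_span_list: "finite (span W) \<Longrightarrow> finite (span (W \<union> set ys))"
  by (induction ys) (auto simp: finite_span_insert)

lemma card_span_list_le:
  "card (span (W \<union> set ys)) \<le> card (span W) * CARD('a) ^ length ys"
proof (induction ys)
  case (Cons y ys)
  have "card (span (insert y (W \<union> set ys))) \<le> CARD('a) * card (span (W \<union> set ys))"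
  proof (cases "y \<in> span (W \<union> set ys)")
    case True
    then show ?thesis using card_scalars_ge_2 by (simp add: span_redundant)
  qed (simp add: card_span_insert)
  then show ?case using Cons by (simp add: mult.left_commute order_trans)
qed simp

text \<open>Reduces independence to the size of a span, so that it can be moved between lists with
  the same span and along injective linear maps.\<close>

lemma rel_indep_iff_card:
  assumes "finite (span W)"
  shows "rel_indep W ys \<longleftrightarrow> card (span (W \<union> set ys)) = card (span W) * CARD('a) ^ length ys"
proof (induction ys)
  case (Cons y ys)
  have pos: "card (span (W \<union> set ys)) > 0" 
    using finite_span_list[OF assms] span_zero by (metis card_gt_0_iff empty_iff)
  show ?case
  proof (cases "y \<in> span (W \<union> set ys)")
    case True
    have "card (span (W \<union> set ys)) < CARD('a) * card (span (W \<union> set ys))"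
      using pos card_scalars_ge_2 by simp
    also have "\<dots> \<le> card (span W) * CARD('a) ^ length (y # ys)"
      using card_span_list_le[of W ys] by (simp add: mult.left_commute)
    finally show ?thesis using True by (simp add: span_redundant)
  next
    case False
    then show ?thesis using Cons card_scalars_ge_2 by (simp add: card_span_insert mult.left_commute)
  qed
qed simp

text \<open>After i choices the forbidden span has \<open>card W * CARD('a) ^ i\<close> elements. If
  n exceeds the codimension of W in N, some factor is 0, as it should be.\<close>

lemma card_rel_indep:
  assumes "subspace W" "subspace N" "finite N" "W \<subseteq> N"
  shows "finite {ys. length ys = n \<and> set ys \<subseteq> N \<and> rel_indep W ys} \<and>
    card {ys. length ys = n \<and> set ys \<subseteq> N \<and> rel_indep W ys} = (\<Prod>i<n. card N - card W * CARD('a) ^ i)"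
proof (induction n)
  case 0
  have "{ys. length ys = 0 \<and> set ys \<subseteq> N \<and> rel_indep W ys} = {[]}" by auto
  then show ?case by simp
next
  case (Suc n)
  let ?L = "\<lambda>n. {ys. length ys = n \<and> set ys \<subseteq> N \<and> rel_indep W ys}"
  have fin: "finite (span W)" using assms by (metis span_eq_iff finite_subset)
  have eq: "?L (Suc n) = (\<lambda>(ys, y). y # ys) ` (SIGMA ys:?L n. N - span (W \<union> set ys))"
    by (auto simp: length_Suc_conv image_iff)
  have sub: "span (W \<union> set ys) \<subseteq> N" if "ys \<in> ?L n" for ys
    using that assms by (intro span_minimal) auto
  have c: "card (N - span (W \<union> set ys)) = card N - card W * CARD('a) ^ n" if "ys \<in> ?L n" for ys
  proof -
    have "card (span (W \<union> set ys)) = card W * CARD('a) ^ n"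
      using that rel_indep_iff_card[OF fin, of ys] span_eq_iff[THEN iffD2, OF assms(1)] by simp
    then show ?thesis using sub[OF that] assms(3)
      by (simp add: card_Diff_subset finite_subset)
  qed
  have "inj_on (\<lambda>(ys, y). y # ys) (SIGMA ys:?L n. N - span (W \<union> set ys))"
    by (auto simp: inj_on_def)
  then have "card (?L (Suc n)) = card (SIGMA ys:?L n. N - span (W \<union> set ys))"
    unfolding eq by (rule card_image)
  also have "\<dots> = (\<Sum>ys\<in>?L n. card (N - span (W \<union> set ys)))"
    using Suc assms by (subst card_SigmaI) auto
  also have "\<dots> = (\<Prod>i<Suc n. card N - card W * CARD('a) ^ i)"
    using Suc c by simp
  finally show ?case using Suc assms eq by simp
qed

end

section \<open>Coverage of lines\<close>

definition coverage :: "'b set multiset \<Rightarrow> 'b set \<Rightarrow> nat" where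
  "coverage B T = size {#U \<in># B. T \<subseteq> U#}"

lemma coverage_empty [simp]: "coverage {#} T = 0"
  and coverage_union [simp]: "coverage (A + B) T = coverage A T + coverage B T"
  by (simp_all add: coverage_def)

lemma coverage_repeat [simp]: "coverage (repeat_mset c B) T = c * coverage B T"
  by (induction c) simp_all

lemma coverage_sum: "coverage (\<Sum>i\<in>I. f i) T = (\<Sum>i\<in>I. coverage (f i) T)"
  by (induction I rule: infinite_finite_induct) auto

lemma coverage_eq_0: "(\<And>U. U \<in># B \<Longrightarrow> \<not> T \<subseteq> U) \<Longrightarrow> coverage B T = 0"
  by (auto simp: coverage_def filter_mset_eq_conv)

lemma coverage_mset_set:
  "finite S \<Longrightarrow> coverage (mset_set S) T = card {U \<in> S. T \<subseteq> U}"
  by (simp add: coverage_def)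

text \<open>Double counting of incidences, with blocks counted by multiplicity.\<close>

lemma sum_size_filter_mset:
  assumes "finite P"
  shows "(\<Sum>p\<in>P. size {#U \<in># B. R p U#}) = (\<Sum>U\<in>#B. card {p\<in>P. R p U})"
proof (induction B)
  case (add U B)
  have "(\<Sum>p\<in>P. size {#U \<in># add_mset U B. R p U#})
      = (\<Sum>p\<in>P. (if R p U then 1 else 0) + size {#U \<in># B. R p U#})"
    by (intro sum.cong) auto
  also have "\<dots> = card {p\<in>P. R p U} + (\<Sum>U\<in>#B. card {p\<in>P. R p U})"
    using assms add by (simp add: sum.distrib flip: sum.inter_filter)
  finally show ?case by simp
qed simp

context finite_field_space
begin

definition lines :: "'b set \<Rightarrow> 'b set set" where
  "lines V = {T. subspace T \<and> T \<subseteq> V \<and> dim T = 2}"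

definition indep_pairs :: "'b set \<Rightarrow> ('b \<times> 'b) set" where
  "indep_pairs U = (SIGMA s:U - {0}. U - span {s})"

definition blocks_in :: "nat \<Rightarrow> 'b set \<Rightarrow> 'b set multiset \<Rightarrow> bool" where
  "blocks_in k V B \<longleftrightarrow> (\<forall>U \<in># B. subspace U \<and> U \<subseteq> V \<and> dim U = k)"

lemma subspace_2_design_iff:
  "subspace_2_design v k l V B \<longleftrightarrow>
    subspace V \<and> finite V \<and> dim V = v \<and> blocks_in k V B \<and> (\<forall>T\<in>lines V. coverage B T = l)"
  by (auto simp: subspace_2_design_def blocks_in_def lines_def coverage_def)

lemma card_span_singleton: "s \<noteq> 0 \<Longrightarrow> card (span {s}) = CARD('a)"
  using card_span_insert[of s "{}"] by simp

lemma card_span_pair: "s \<noteq> 0 \<Longrightarrow> t \<notin> span {s} \<Longrightarrow> card (span {s, t}) = CARD('a)\<^sup>2"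
  using card_span_insert[of t "{s}"] card_span_singleton[of s]
  by (simp add: insert_commute power2_eq_square)

lemma finite_span [simp]: "finite A \<Longrightarrow> finite (span A)"
  by (induction A rule: finite_induct) (simp_all add: finite_span_insert)

lemma line_eq_span_pair:
  assumes "subspace T" "T \<subseteq> V" "dim T = 2" "finite V"
  obtains s t where "(s, t) \<in> indep_pairs T" "T = span {s, t}"
proof -
  have fin: "finite T" and cT: "card T = CARD('a)\<^sup>2"
    using assms finite_subset dim_eq_iff_card by blast+
  have "1 < card T" using cT card_scalars_ge_2 one_less_power[of "CARD('a)" 2] by simp
  then have "\<not> T \<subseteq> {0}" using card_mono[of "{0}" T] by auto
  then obtain s where s: "s \<in> T" "s \<noteq> 0" by auto
  have "card (span {s}) < card T"
    using cT s card_span_singleton card_scalars_ge_2 by (simp add: power2_eq_square)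
  then have "\<not> T \<subseteq> span {s}" using card_mono[of "span {s}" T] by auto
  then obtain t where t: "t \<in> T" "t \<notin> span {s}" by auto
  have "span {s, t} \<subseteq> T" using s t assms by (intro span_minimal) auto
  then have eq: "span {s, t} = T"
    using card_span_pair[OF s(2) t(2)] cT fin by (intro card_subset_eq) auto
  have "(s, t) \<in> indep_pairs T" using s t by (simp add: indep_pairs_def)
  then show ?thesis using eq[symmetric] by (rule that)
qed

lemma card_indep_pairs:
  assumes "subspace U" "finite U"
  shows "card (indep_pairs U) = (card U - 1) * (card U - CARD('a))"
proof -
  have "card (U - span {s}) = card U - CARD('a)" if "s \<in> U - {0}" for s
  proof -
    have "span {s} \<subseteq> U" using that assms by (intro span_minimal) auto
    then show ?thesis using that assms by (simp add: card_Diff_subset card_span_singleton)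
  qed
  moreover have "card (U - {0}) = card U - 1" using assms subspace_0 by simp
  ultimately show ?thesis unfolding indep_pairs_def
    using assms(2) by (subst card_SigmaI) auto
qed

lemma finite_indep_pairs: "finite U \<Longrightarrow> finite (indep_pairs U)"
  by (simp add: indep_pairs_def)

text \<open>Both pairs extend to bases of V, and a bijection of the bases that matches the pairs
  extends linearly.\<close>

lemma linear_transitive_indep_pairs:
  assumes V: "subspace V" "finite V" and p: "(s, t) \<in> indep_pairs V" "(s', t') \<in> indep_pairs V"
  obtains g where "Vector_Spaces.linear scale scale g" "g ` V = V" "inj_on g V" "g s = s'" "g t = t'"
proof -
  interpret p: vector_space_pair scale scale ..
  have basis: "\<exists>B. {s, t} \<subseteq> B \<and> B \<subseteq> V \<and> independent B \<and> V \<subseteq> span B \<and> s \<noteq> t"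
    if p: "(s, t) \<in> indep_pairs V" for s t
  proof -
    have "s \<noteq> t" using p by (auto simp: indep_pairs_def span_base)
    moreover have "independent {t, s}"
      using p by (intro independent_insertI independent_empty) (auto simp: indep_pairs_def)
    then obtain B where "{t, s} \<subseteq> B" "B \<subseteq> V" "independent B" "V \<subseteq> span B"
      using maximal_independent_subset_extend[of "{t, s}" V] p by (auto simp: indep_pairs_def)
    ultimately show ?thesis by (auto intro!: exI[of _ B])
  qed
  obtain B where B: "{s, t} \<subseteq> B" "B \<subseteq> V" "independent B" "V \<subseteq> span B" "s \<noteq> t"
    using basis[OF p(1)] by blast
  obtain C where C: "{s', t'} \<subseteq> C" "C \<subseteq> V" "independent C" "V \<subseteq> span C" "s' \<noteq> t'"
    using basis[OF p(2)] by blast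
  have fin: "finite B" "finite C" using B C V finite_subset by auto
  have cards: "card B = card C"
    using basis_card_eq_dim[of B V] basis_card_eq_dim[of C V] B C by auto
  have "card (B - {s, t}) = card (C - {s', t'})"
    using B(1,5) C(1,5) fin cards by (simp add: card_Diff_subset)
  then obtain h where h: "bij_betw h (B - {s, t}) (C - {s', t'})"
    using finite_same_card_bij[of "B - {s, t}" "C - {s', t'}"] fin by auto
  let ?f = "h(s := s', t := t')"
  have imf: "?f ` B = C"
  proof -
    have "?f ` B = ?f ` (B - {s, t}) \<union> ?f ` {s, t}" using B(1) by auto
    also have "?f ` (B - {s, t}) = C - {s', t'}"
      using bij_betw_imp_surj_on[OF h] by (auto simp: image_def)
    also have "?f ` {s, t} = {s', t'}" using B(5) by auto
    finally show ?thesis using C(1) by auto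
  qed
  obtain g where g: "Vector_Spaces.linear scale scale g" "\<forall>x\<in>B. g x = ?f x"
    using p.linear_independent_extend[OF B(3)] by blast
  have gB: "g ` B = C" using imf g(2) by (metis image_cong)
  have "inj_on g B" using gB cards fin by (metis eq_card_imp_inj_on)
  moreover have sB: "span B = V" "span C = V"
    using span_subspace[OF B(2,4) V(1)] span_subspace[OF C(2,4) V(1)] .
  ultimately have "inj_on g V"
    using p.linear_inj_on_span_iff_independent_image[OF g(1), of B] gB C(3) by simp
  moreover have "g ` V = V"
    using p.linear_span_image[OF g(1), of B] sB gB by simp
  moreover have "g s = s'" "g t = t'" using g(2) B(1,5) by auto
  ultimately show ?thesis using that g(1) by blast
qed

text \<open>Count the ordered lists that extend T independently inside V. They are partitioned by
  the subspace U they generate with T, and each U receives as many lists as extend T inside U. The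
  Gaussian binomial coefficient thus appears without division.\<close>

lemma card_subspaces_containing:
  assumes "subspace V" "finite V" "subspace T" "T \<subseteq> V" "dim T = t"
  shows "card {U. subspace U \<and> U \<subseteq> V \<and> dim U = t + n \<and> T \<subseteq> U} *
    (\<Prod>i<n. CARD('a) ^ (t + n) - CARD('a) ^ (t + i)) = (\<Prod>i<n. card V - CARD('a) ^ (t + i))"
proof -
  let ?S = "{U. subspace U \<and> U \<subseteq> V \<and> dim U = t + n \<and> T \<subseteq> U}"
  let ?L = "\<lambda>N. {ys. length ys = n \<and> set ys \<subseteq> N \<and> rel_indep T ys}"
  have finT: "finite T" using assms finite_subset by blast
  have spT: "span T = T" using assms(3) by (rule span_eq_iff[THEN iffD2])
  have cT: "card T = CARD('a) ^ t" using assms finT dim_eq_iff_card by blast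
  have cU: "card U = CARD('a) ^ (t + n) \<and> finite U" if "U \<in> ?S" for U
    using that assms dim_eq_iff_card finite_subset by blast
  have span_U: "span (T \<union> set ys) = U" if "U \<in> ?S" "ys \<in> ?L U" for U ys
  proof (rule card_subset_eq)
    show "span (T \<union> set ys) \<subseteq> U" using that by (intro span_minimal) auto
    show "card (span (T \<union> set ys)) = card U"
      using that cU[OF that(1)] rel_indep_iff_card[of T ys] spT finT cT by (simp add: power_add)
  qed (use cU that in auto)
  have "?L V = (\<Union>U\<in>?S. ?L U)"
  proof (intro equalityI subsetI)
    fix ys assume ys: "ys \<in> ?L V"
    let ?U = "span (T \<union> set ys)"
    have "?U \<subseteq> V" using ys assms by (intro span_minimal) auto
    moreover have "dim ?U = t + n"
      using ys rel_indep_iff_card[of T ys] spT finT cT calculation assms(2) finite_subset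
      by (subst dim_eq_iff_card) (auto simp: power_add)
    ultimately have "?U \<in> ?S" using span_superset[of "T \<union> set ys"] by auto
    moreover have "ys \<in> ?L ?U" using ys span_superset by blast
    ultimately show "ys \<in> (\<Union>U\<in>?S. ?L U)" by blast
  qed auto
  moreover have "card (\<Union>U\<in>?S. ?L U) = (\<Sum>U\<in>?S. card (?L U))"
  proof (rule card_UN_disjoint)
    show "finite ?S" using assms(2) by (auto intro: finite_subset[of _ "Pow V"])
    show "\<forall>U\<in>?S. finite (?L U)"
      using card_rel_indep[of T] assms(3) cU by blast
    show "\<forall>U\<in>?S. \<forall>U'\<in>?S. U \<noteq> U' \<longrightarrow> ?L U \<inter> ?L U' = {}"
      using span_U by blast
  qed
  ultimately have "card (?L V) = (\<Sum>U\<in>?S. card (?L U))" by simp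
  also have "\<dots> = (\<Sum>U\<in>?S. (\<Prod>i<n. CARD('a) ^ (t + n) - CARD('a) ^ (t + i)))"
    using card_rel_indep[of T] assms(3) cU cT by (intro sum.cong) (auto simp: power_add)
  finally show ?thesis
    using card_rel_indep[of T V n] assms cT by (simp add: power_add)
qed

lemma complete_coverage:
  assumes "subspace V" "finite V" "T \<in> lines V"
  shows "coverage (mset_set {U. subspace U \<and> U \<subseteq> V \<and> dim U = 2 + n}) T *
    (\<Prod>i<n. CARD('a) ^ (2 + n) - CARD('a) ^ (2 + i)) = (\<Prod>i<n. card V - CARD('a) ^ (2 + i))"
proof -
  have "finite {U. subspace U \<and> U \<subseteq> V \<and> dim U = 2 + n}"
    using assms(2) by (auto intro: finite_subset[of _ "Pow V"])
  moreover have "{U \<in> {U. subspace U \<and> U \<subseteq> V \<and> dim U = 2 + n}. T \<subseteq> U}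
      = {U. subspace U \<and> U \<subseteq> V \<and> dim U = 2 + n \<and> T \<subseteq> U}" by auto
  ultimately show ?thesis
    using card_subspaces_containing[OF assms(1,2), of T 2 n] assms(3)
    by (simp add: coverage_mset_set lines_def)
qed

end

section \<open>Spaces over a large field seen over a subfield\<close>

locale scalar_extension = E: finite_field_space scale
  for scale :: "'e::{field,finite} \<Rightarrow> 'b::ab_group_add \<Rightarrow> 'b" +
  fixes emb :: "'a::{field,finite} \<Rightarrow> 'e"
  assumes emb_add: "emb (x + y) = emb x + emb y"
    and emb_mult: "emb (x * y) = emb x * emb y"
    and emb_1 [simp]: "emb 1 = 1"
begin

sublocale F: finite_field_space "\<lambda>c. scale (emb c)"
  by unfold_locales (simp_all add: emb_add emb_mult E.scale_right_distrib E.scale_left_distrib)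

lemma emb_0 [simp]: "emb 0 = 0"
  using emb_add[of 0 0] by (simp only: add_0_right add_cancel_right_right)

lemma emb_eq_0_iff [simp]: "emb x = 0 \<longleftrightarrow> x = 0"
proof
  assume "emb x = 0"
  then have "emb (x * inverse x) = 0" by (simp add: emb_mult)
  then show "x = 0" by (metis emb_1 right_inverse zero_neq_one)
qed simp

lemma emb_diff: "emb (x - y) = emb x - emb y"
  using emb_add[of "x - y" y] by (simp add: algebra_simps)

lemma emb_divide: "emb (x / y) = emb x / emb y"
proof (cases "y = 0")
  case False
  then have "emb (x / y) * emb y = emb x" by (simp flip: emb_mult)
  then show ?thesis using False by (simp add: field_simps)
qed simp

lemma inj_emb: "inj emb"
  by (rule injI) (metis emb_diff emb_eq_0_iff right_minus_eq diff_self)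

lemma E_subspace_imp_F_subspace: "E.subspace V \<Longrightarrow> F.subspace V"
  by (simp add: E.subspace_def F.subspace_def)

lemma F_span_subset_E_span: "F.span S \<subseteq> E.span S"
  by (intro F.span_minimal E.span_superset E_subspace_imp_F_subspace E.subspace_span)

definition scattered :: "'b set \<Rightarrow> bool" where
  "scattered U \<longleftrightarrow> F.subspace U \<and> (\<forall>x\<in>U. \<forall>c. x \<noteq> 0 \<longrightarrow> scale c x \<in> U \<longrightarrow> c \<in> range emb)"

text \<open>Inside a scattered subspace, dependence of two vectors means the same over both fields.
  Hence every block of a given size contributes the same number to the double count.\<close>

lemma scattered_indep_pairs:
  assumes "scattered U" "U \<subseteq> V"
  shows "{p \<in> E.indep_pairs V. fst p \<in> U \<and> snd p \<in> U} = F.indep_pairs U"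
proof -
  have "t \<in> F.span {s} \<longleftrightarrow> t \<in> E.span {s}" if "s \<in> U" "t \<in> U" "s \<noteq> 0" for s t
    using assms(1) that F_span_subset_E_span[of "{s}"]
    unfolding scattered_def E.span_singleton F.span_singleton by fastforce
  then show ?thesis using assms(2)
    by (auto simp: E.indep_pairs_def F.indep_pairs_def)
qed

text \<open>Two vectors that span such a line differ by a factor outside the subfield, so no
  scattered block contains both.\<close>

lemma scattered_coverage_degenerate:
  assumes "\<And>U. U \<in># B \<Longrightarrow> scattered U \<and> U \<subseteq> V" "finite V" "T \<in> F.lines V" "T \<subseteq> E.span {x}"
  shows "coverage B T = 0"
proof (rule coverage_eq_0)
  fix U assume U: "U \<in># B"
  obtain s t where st: "(s, t) \<in> F.indep_pairs T" "T = F.span {s, t}"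
    using assms(2,3) F.line_eq_span_pair[of T V] by (metis (lifting) F.lines_def mem_Collect_eq)
  then have *: "s \<noteq> 0" "s \<in> T" "t \<in> T" "t \<notin> F.span {s}" by (auto simp: F.indep_pairs_def)
  then have "s \<in> range (\<lambda>k. scale k x)" "t \<in> range (\<lambda>k. scale k x)"
    using assms(4) unfolding E.span_singleton by auto
  then obtain a b where "s = scale a x" "t = scale b x" by (elim rangeE)
  note ab = this *
  then have t: "t = scale (b / a) s" by auto
  have "b / a \<notin> range emb"
  proof
    assume "b / a \<in> range emb"
    then have "t \<in> F.span {s}" unfolding F.span_singleton t by auto
    then show False using *(4) by simp
  qed
  then show "\<not> T \<subseteq> U" using assms(1)[OF U] *(1-3) t
    unfolding scattered_def by blast
qed

text \<open>
  The linear group over \<open>'e\<close> is transitive on \<open>'e\<close>-independent pairs, so an invariant family covers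
  all of them equally often; double counting gives the number.
\<close>

lemma invariant_coverage:
  assumes V: "E.subspace V" "finite V"
    and B: "\<And>U. U \<in># B \<Longrightarrow> scattered U \<and> U \<subseteq> V \<and> card U = K"
    and inv: "\<And>g. Vector_Spaces.linear scale scale g \<Longrightarrow> g ` V = V \<Longrightarrow> inj_on g V \<Longrightarrow> image_mset ((`) g) B = B"
    and T: "T \<in> F.lines V" "\<And>x. x \<in> V \<Longrightarrow> \<not> T \<subseteq> E.span {x}"
  shows "coverage B T * ((card V - 1) * (card V - CARD('e))) = size B * ((K - 1) * (K - CARD('a)))"
proof -
  define N where "N p = size {#U \<in># B. fst p \<in> U \<and> snd p \<in> U#}" for p
  obtain s t where st: "(s, t) \<in> F.indep_pairs T" "T = F.span {s, t}"
    using T V F.line_eq_span_pair[of T V] by (auto simp: F.lines_def)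
  have "t \<notin> E.span {s}"
  proof
    assume "t \<in> E.span {s}"
    then have "T \<subseteq> E.span {s}" unfolding st(2)
      by (intro F.span_minimal E_subspace_imp_F_subspace) (auto simp: E.span_base)
    then show False using T st(1) by (auto simp: F.indep_pairs_def F.lines_def)
  qed
  then have stV: "(s, t) \<in> E.indep_pairs V"
    using st(1) T by (auto simp: F.indep_pairs_def E.indep_pairs_def F.lines_def)
  have Nst: "N (s, t) = coverage B T"
  proof -
    have "s \<in> U \<and> t \<in> U \<longleftrightarrow> T \<subseteq> U" if "U \<in># B" for U
      using B[OF that] st F.span_minimal[of "{s, t}" U] F.span_base[of _ "{s, t}"]
      by (auto simp: scattered_def)
    then show ?thesis unfolding N_def coverage_def
      by (intro arg_cong[of _ _ size] filter_mset_cong) auto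
  qed
  have const: "N p = N (s, t)" if p: "p \<in> E.indep_pairs V" for p
  proof -
    obtain g where g: "Vector_Spaces.linear scale scale g" "g ` V = V" "inj_on g V" "g s = fst p" "g t = snd p"
      using E.linear_transitive_indep_pairs[OF V stV, of "fst p" "snd p"] p by auto
    \<comment> \<open>By invariance B may be replaced by its image under g, and membership is pulled
      back along g. Injectivity on V suffices because all blocks lie in V.\<close>
    have "N p = size {#U \<in># image_mset ((`) g) B. fst p \<in> U \<and> snd p \<in> U#}"
      using inv[OF g(1-3)] by (simp add: N_def)
    also have "\<dots> = size {#U \<in># B. fst p \<in> g ` U \<and> snd p \<in> g ` U#}"
      by (simp add: filter_mset_image_mset)
    also have "{#U \<in># B. fst p \<in> g ` U \<and> snd p \<in> g ` U#} = {#U \<in># B. s \<in> U \<and> t \<in> U#}"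
    proof (rule filter_mset_cong[OF refl])
      fix U assume "U \<in># B"
      then have "U \<subseteq> V" using B by blast
      moreover have "s \<in> V" "t \<in> V" using stV by (auto simp: E.indep_pairs_def)
      ultimately show "(fst p \<in> g ` U \<and> snd p \<in> g ` U) = (s \<in> U \<and> t \<in> U)"
        using g inj_on_image_mem_iff by metis
    qed
    finally show ?thesis by (simp add: N_def)
  qed
  have "coverage B T * ((card V - 1) * (card V - CARD('e))) = (\<Sum>p\<in>E.indep_pairs V. N p)"
    using const Nst E.card_indep_pairs[OF V] by simp
  also have "\<dots> = (\<Sum>U\<in>#B. card {p \<in> E.indep_pairs V. fst p \<in> U \<and> snd p \<in> U})"
    unfolding N_def by (rule sum_size_filter_mset) (simp add: E.finite_indep_pairs V)
  also have "\<dots> = (\<Sum>U\<in>#B. (K - 1) * (K - CARD('a)))"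
  proof (intro arg_cong[of _ _ sum_mset] image_mset_cong)
    fix U assume "U \<in># B"
    then have "scattered U" "U \<subseteq> V" "card U = K" using B by auto
    then show "card {p \<in> E.indep_pairs V. fst p \<in> U \<and> snd p \<in> U} = (K - 1) * (K - CARD('a))"
      using scattered_indep_pairs[of U V] F.card_indep_pairs[of U] V finite_subset[of U V]
      by (simp add: scattered_def)
  qed
  finally show ?thesis by simp
qed

end

section \<open>Scattered subspaces\<close>

text \<open>The orbits partition S, and freeness gives each of them \<open>card C\<close>
  elements.\<close>

lemma card_dvd_if_free_action:
  fixes act :: "'e::field \<Rightarrow> 's \<Rightarrow> 's"
  assumes "finite S" "finite C" "1 \<in> C"
    and C: "\<And>c d. c \<in> C \<Longrightarrow> d \<in> C \<Longrightarrow> c * d \<in> C" "\<And>c. c \<in> C \<Longrightarrow> c \<noteq> 0 \<and> inverse c \<in> C"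
    and act: "\<And>s. act 1 s = s" "\<And>c d s. act (c * d) s = act c (act d s)"
    and closed: "\<And>c s. c \<in> C \<Longrightarrow> s \<in> S \<Longrightarrow> act c s \<in> S"
    and free: "\<And>c d s. c \<in> C \<Longrightarrow> d \<in> C \<Longrightarrow> s \<in> S \<Longrightarrow> act c s = act d s \<Longrightarrow> c = d"
  shows "card C dvd card S"
proof -
  let ?orb = "\<lambda>s. (\<lambda>c. act c s) ` C"
  have self: "s \<in> ?orb s" for s using act(1) assms(3) by (metis image_eqI)
  have sub: "?orb s \<subseteq> ?orb t" if "s \<in> ?orb t" for s t
  proof -
    obtain c where c: "c \<in> C" "s = act c t" using \<open>s \<in> ?orb t\<close> by blast
    show ?thesis
    proof (rule image_subsetI)
      fix d assume "d \<in> C"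
      then have "d * c \<in> C" using c(1) C(1) by blast
      moreover have "act d s = act (d * c) t" by (simp only: c(2) act(2))
      ultimately show "act d s \<in> ?orb t" by blast
    qed
  qed
  have sym: "t \<in> ?orb s" if s: "s \<in> ?orb t" for s t
  proof -
    obtain c where c: "c \<in> C" "s = act c t" using s by blast
    have "act (inverse c) s = act (inverse c * c) t" by (simp only: c(2) act(2))
    then have "t = act (inverse c) s" using C(2)[OF c(1)] act(1) by simp
    then show ?thesis using C(2)[OF c(1)] by blast
  qed
  have "S = \<Union> (?orb ` S)" using self closed by blast
  moreover have "card C dvd card (\<Union> (?orb ` S))"
  proof (rule dvd_partition)
    show "finite (\<Union> (?orb ` S))" using assms(1,2) by auto
    show "\<forall>c\<in>?orb ` S. card C dvd card c"
      using free by (auto simp: card_image inj_on_def)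
    show "\<forall>c1\<in>?orb ` S. \<forall>c2\<in>?orb ` S. c1 \<noteq> c2 \<longrightarrow> c1 \<inter> c2 = {}"
    proof (clarsimp)
      fix s t assume "?orb s \<noteq> ?orb t"
      show "?orb s \<inter> ?orb t = {}"
      proof (rule ccontr)
        assume "?orb s \<inter> ?orb t \<noteq> {}"
        then obtain x where x: "x \<in> ?orb s" "x \<in> ?orb t" by blast
        have "?orb x = ?orb s" using sub[OF x(1)] sub[OF sym[OF x(1)]] by (rule equalityI)
        moreover have "?orb x = ?orb t" using sub[OF x(2)] sub[OF sym[OF x(2)]] by (rule equalityI)
        ultimately show False using \<open>?orb s \<noteq> ?orb t\<close> by simp
      qed
    qed
  qed
  ultimately show ?thesis by simp
qed

text \<open>This is the division that removes the surplus from the family of all blocks.\<close>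

lemma dvd_count_imp_repeat_mset:
  assumes "\<And>x. s dvd count M x"
  obtains B where "M = repeat_mset s B"
proof
  show "M = repeat_mset s (\<Sum>x\<in>set_mset M. replicate_mset (count M x div s) x)"
  proof (rule multiset_eqI)
    fix x
    have "(\<Sum>y\<in>set_mset M. if x = y then count M y div s else 0) = count M x div s"
      by (cases "x \<in># M") (auto simp: not_in_iff)
    then show "count M x = count (repeat_mset s (\<Sum>x\<in>set_mset M. replicate_mset (count M x div s) x)) x"
      using assms by (simp add: count_sum eq_commute cong: if_cong)
  qed
qed

lemma finite_field_power_card:
  fixes x :: "'a::{field,finite}"
  shows "x ^ CARD('a) = x"
proof (cases "x = 0")
  case True
  then show ?thesis by (simp add: power_0_left)
next
  case False
  have "(\<Prod>y\<in>UNIV-{0}. x * y) = \<Prod>(UNIV - {0})"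
    using False by (intro prod.reindex_bij_witness[of _ "\<lambda>y. y / x" "\<lambda>y. x * y"]) auto
  then have "x ^ card (UNIV - {0::'a}) * \<Prod>(UNIV - {0::'a}) = 1 * \<Prod>(UNIV - {0::'a})"
    by (simp add: prod.distrib)
  then have "x ^ card (UNIV - {0::'a}) = 1"
    by (subst (asm) mult_right_cancel) auto
  then have "x ^ Suc (card (UNIV - {0::'a})) = x" by (simp only: power_Suc mult_1_right)
  moreover have "Suc (card (UNIV - {0::'a})) = CARD('a)"
    by (rule card.remove[symmetric]) auto
  ultimately show ?thesis by (simp only:)
qed

lemma finite_roots_power_eq_self:
  assumes "1 < n"
  shows "finite {x::'e::idom. x ^ n = x}" "card {x::'e::idom. x ^ n = x} \<le> n"
proof -
  let ?p = "monom 1 n - monom 1 1 :: 'e poly"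
  have "coeff ?p n = 1" using assms by simp
  then have p: "?p \<noteq> 0" by (metis coeff_0 zero_neq_one)
  have deg: "degree ?p \<le> n" using assms by (intro degree_diff_le) (auto simp: degree_monom_eq)
  have eq: "{x. poly ?p x = 0} = {x. x ^ n = x}" by (auto simp: poly_monom)
  show "finite {x::'e::idom. x ^ n = x}" using poly_roots_finite[OF p] eq by simp
  show "card {x::'e::idom. x ^ n = x} \<le> n"
    using card_poly_roots_bound[OF p] deg eq by simp
qed

context finite_field_space
begin

lemma rel_indep_mono:
  assumes "span W \<subseteq> span W'" "rel_indep W' ys"
  shows "rel_indep W ys"
  using assms(2)
proof (induction ys)
  case (Cons y ys)
  have "span (W \<union> set ys) \<subseteq> span (W' \<union> set ys)"
    using assms(1) span_mono[of W' "W' \<union> set ys"] span_superset[of W] span_superset[of "W' \<union> set ys"]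
    by (intro span_minimal) auto
  then show ?case using Cons by auto
qed simp

lemma rel_indep_image:
  assumes g: "Vector_Spaces.linear scale scale g" "inj_on g V" and V: "subspace V" "finite V"
    and W: "W \<subseteq> V" "set ys \<subseteq> V" "rel_indep W ys"
  shows "rel_indep (g ` W) (map g ys)"
proof -
  interpret p: vector_space_pair scale scale ..
  have im: "card (span (g ` A)) = card (span A)" "finite (span A)" if "A \<subseteq> V" for A
  proof -
    have "span A \<subseteq> V" using that V by (intro span_minimal)
    then show "card (span (g ` A)) = card (span A)" "finite (span A)"
      using p.linear_span_image[OF g(1), of A] g(2) V(2)
      by (auto intro: card_image inj_on_subset finite_subset)
  qed
  have "finite (span (g ` W))" using V(2) W(1) by (meson finite_imageI finite_span finite_subset)
  then show ?thesis
    using W rel_indep_iff_card[of W ys] im[of W] im[of "W \<union> set ys"]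
    by (simp add: rel_indep_iff_card image_Un)
qed

end

section \<open>Blocks twisted by the Frobenius map\<close>

locale frobenius_extension = scalar_extension scale emb
  for scale :: "'e::{field,finite} \<Rightarrow> 'b::ab_group_add \<Rightarrow> 'b" and emb :: "'a::{field,finite} \<Rightarrow> 'e" +
  assumes frobenius_add: "(x + y) ^ CARD('a) = x ^ CARD('a) + (y::'e) ^ CARD('a)"
begin

lemma emb_power: "emb (x ^ n) = emb x ^ n"
  by (induction n) (simp_all add: emb_mult)

lemma emb_frobenius [simp]: "emb x ^ CARD('a) = emb x"
  by (simp add: finite_field_power_card flip: emb_power)

text \<open>The image of \<open>emb\<close> supplies \<open>CARD('a)\<close> roots of a polynomial
  of that degree, hence all of them. So subfield elements can be recognized by an equation.\<close>

lemma range_emb: "range emb = {x. x ^ CARD('a) = x}"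
proof (rule card_seteq)
  have gt: "1 < CARD('a)" using F.card_scalars_ge_2 by simp
  show "finite {x::'e. x ^ CARD('a) = x}" by simp
  show "card {x::'e. x ^ CARD('a) = x} \<le> card (range emb)"
    using finite_roots_power_eq_self(2)[OF gt, where 'e='e] by (simp add: card_image inj_emb)
qed auto

definition twisted :: "'e set \<Rightarrow> 'b \<Rightarrow> 'b \<Rightarrow> 'b set" where
  "twisted D u v = (\<lambda>x. scale x u + scale (x ^ CARD('a)) v) ` D"

text \<open>A subspace of the large field regarded as a vector space over the small one.\<close>

definition F_closed :: "'e set \<Rightarrow> bool" where
  "F_closed D \<longleftrightarrow> 0 \<in> D \<and> (\<forall>x\<in>D. \<forall>y\<in>D. x + y \<in> D) \<and> (\<forall>c. \<forall>x\<in>D. emb c * x \<in> D)"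

lemma E_indep_pair_cancel:
  assumes "(u, v) \<in> E.indep_pairs V" "scale a u + scale b v = scale a' u + scale b' v"
  shows "a = a' \<and> b = b'"
proof -
  have nu: "u \<noteq> 0" "v \<notin> E.span {u}" using assms by (auto simp: E.indep_pairs_def)
  have eq: "scale (b - b') v = scale (a' - a) u"
    using assms(2) by (simp add: algebra_simps)
  have b: "b = b'"
  proof (rule ccontr)
    assume "b \<noteq> b'"
    then have "v = scale (inverse (b - b')) (scale (b - b') v)" by simp
    then have "v = scale (inverse (b - b') * (a' - a)) u" using eq by simp
    then show False using nu(2) unfolding E.span_singleton by (metis rangeI)
  qed
  then show ?thesis using eq nu(1) by simp
qed

lemma F_subspace_twisted:
  assumes "F_closed D"
  shows "F.subspace (twisted D u v)"
proof (rule F.subspaceI)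
  show "0 \<in> twisted D u v"
    using assms by (auto simp: F_closed_def twisted_def power_0_left intro!: image_eqI[of _ _ 0])
  show "x + y \<in> twisted D u v" if xy: "x \<in> twisted D u v" "y \<in> twisted D u v" for x y
  proof -
    obtain a b where "a \<in> D" "b \<in> D" "x = scale a u + scale (a ^ CARD('a)) v"
      "y = scale b u + scale (b ^ CARD('a)) v" using xy by (auto simp: twisted_def)
    then show ?thesis unfolding twisted_def using assms
      by (intro image_eqI[of _ _ "a + b"]) (auto simp: F_closed_def frobenius_add algebra_simps)
  qed
  show "scale (emb c) x \<in> twisted D u v" if x: "x \<in> twisted D u v" for c x
  proof -
    obtain a where "a \<in> D" "x = scale a u + scale (a ^ CARD('a)) v"
      using x by (auto simp: twisted_def)
    then show ?thesis unfolding twisted_def using assms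
      by (intro image_eqI[of _ _ "emb c * a"])
        (auto simp: F_closed_def power_mult_distrib E.scale_right_distrib)
  qed
qed

lemma card_twisted: "(u, v) \<in> E.indep_pairs V \<Longrightarrow> card (twisted D u v) = card D"
  unfolding twisted_def using E_indep_pair_cancel by (intro card_image inj_onI) blast

lemma twisted_subset_span: "twisted D u v \<subseteq> E.span {u, v}"
  unfolding twisted_def
  by (intro image_subsetI E.span_add E.span_scale) (simp_all add: E.span_base)

text \<open>Comparing the coordinates at u and v gives c x = y and c x^q = y^q, so c^q = c because x
  is nonzero.\<close>

lemma scattered_twisted:
  assumes "F_closed D" "(u, v) \<in> E.indep_pairs V"
  shows "scattered (twisted D u v)"
  unfolding scattered_def
proof (intro conjI ballI allI impI)
  fix s c assume s: "s \<in> twisted D u v" "s \<noteq> 0" "scale c s \<in> twisted D u v"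
  then obtain x y where x: "s = scale x u + scale (x ^ CARD('a)) v"
    and y: "scale c s = scale y u + scale (y ^ CARD('a)) v" by (auto simp: twisted_def)
  have "scale (c * x) u + scale (c * x ^ CARD('a)) v = scale y u + scale (y ^ CARD('a)) v"
    using y by (simp add: x E.scale_right_distrib)
  then have "c * x = y" "c * x ^ CARD('a) = y ^ CARD('a)"
    using E_indep_pair_cancel[OF assms(2)] by blast+
  then have "c * x ^ CARD('a) = c ^ CARD('a) * x ^ CARD('a)"
    by (simp flip: power_mult_distrib)
  moreover have "x \<noteq> 0" using s(2) x by (auto simp: power_0_left)
  ultimately show "c \<in> range emb" by (simp add: range_emb)
qed (rule F_subspace_twisted[OF assms(1)])

text \<open>Compare the coordinates at y of s and c s, which are a and b in the subfield: c a = b.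
  Either a is nonzero and c = b / a, or both vectors already lie in S.\<close>

lemma scattered_insert:
  assumes S: "scattered S" and y: "y \<notin> E.span S"
  shows "scattered (F.span (insert y S))"
  unfolding scattered_def
proof (intro conjI ballI allI impI)
  fix s c assume s: "s \<in> F.span (insert y S)" "s \<noteq> 0" "scale c s \<in> F.span (insert y S)"
  have sp: "F.span S = S" using S by (simp add: scattered_def)
  obtain a w where w: "s - scale (emb a) y = w" "w \<in> S"
    using s(1) sp by (auto simp: F.span_insert)
  obtain b w' where w': "scale c s - scale (emb b) y = w'" "w' \<in> S"
    using s(3) sp by (auto simp: F.span_insert)
  have seq: "s = w + scale (emb a) y" using w by auto
  have "scale (c * emb a - emb b) y = w' - scale c w"
    using w'(1) by (simp add: seq algebra_simps)
  then have "scale (c * emb a - emb b) y \<in> E.span S"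
    using w w' by (simp add: E.span_base E.span_diff E.span_scale)
  then have ab: "c * emb a = emb b"
    using y E.linear_imp_scale
    by (metis E.scale_one E.scale_scale E.span_scale eq_iff_diff_eq_0 field_class.field_inverse)
  show "c \<in> range emb"
  proof (cases "a = 0")
    case True
    then have "b = 0" using ab by simp
    then have "s \<in> S" "scale c s \<in> S" using True w w' by auto
    then show ?thesis using S s(2) by (auto simp: scattered_def)
  next
    case False
    then have "c = emb (b / a)" using ab by (simp add: emb_divide field_simps)
    then show ?thesis by simp
  qed
qed simp

lemma E_span_F_span: "E.span (F.span S) = E.span S"
  using F_span_subset_E_span[of S] F.span_superset[of S] E.span_mono E.span_minimal
  by (metis E.subspace_span subset_antisym)

text \<open>Independence over the large field keeps the span scattered. Independence over the small
  field follows, since the span over it is contained in the other.\<close>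

lemma scattered_span_list:
  assumes "scattered W" "E.rel_indep W ys"
  shows "scattered (F.span (W \<union> set ys)) \<and> F.rel_indep W ys"
  using assms(2)
proof (induction ys)
  case Nil
  have "F.span W = W" using assms(1) by (simp add: scattered_def)
  then show ?case using assms(1) by (simp only: list.set Un_empty_right F.rel_indep.simps simp_thms)
next
  case (Cons y ys)
  let ?S = "F.span (W \<union> set ys)"
  have y: "y \<notin> E.span ?S" using Cons.prems by (simp add: E_span_F_span)
  have "F.span (insert y ?S) = F.span (W \<union> set (y # ys))"
  proof (rule F.span_unique[symmetric])
    show "W \<union> set (y # ys) \<subseteq> F.span (insert y ?S)"
      using F.span_superset[of "W \<union> set ys"] F.span_superset[of "insert y ?S"] by auto
  next
    fix A assume A: "W \<union> set (y # ys) \<subseteq> A" "F.subspace A"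
    then have "?S \<subseteq> A" by (intro F.span_minimal) auto
    then show "F.span (insert y ?S) \<subseteq> A" using A by (intro F.span_minimal) auto
  qed simp
  moreover have "y \<notin> ?S" using y E.span_base by blast
  ultimately show ?case using Cons scattered_insert[OF _ y] by simp
qed

text \<open>Redundant parameters for the blocks: their number is a plain product, and linear
  bijections of V permute them.\<close>

definition tuples :: "'b set \<Rightarrow> nat \<Rightarrow> (('b \<times> 'b) \<times> 'b list) set" where
  "tuples V n = (SIGMA (u, v):E.indep_pairs V.
     {ys. length ys = n \<and> set ys \<subseteq> V \<and> E.rel_indep (E.span {u, v}) ys})"

fun block :: "'e set \<Rightarrow> ('b \<times> 'b) \<times> 'b list \<Rightarrow> 'b set" where
  "block D ((u, v), ys) = F.span (twisted D u v \<union> set ys)"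

lemma span_pair_subset: "E.subspace V \<Longrightarrow> (u, v) \<in> E.indep_pairs V \<Longrightarrow> E.span {u, v} \<subseteq> V"
  by (intro E.span_minimal) (auto simp: E.indep_pairs_def)

lemma card_tuples:
  assumes "E.subspace V" "finite V"
  shows "finite (tuples V n)"
    "card (tuples V n) = (card V - 1) * (card V - CARD('e)) * (\<Prod>i<n. card V - CARD('e) ^ (2 + i))"
proof -
  let ?L = "\<lambda>(u, v). {ys. length ys = n \<and> set ys \<subseteq> V \<and> E.rel_indep (E.span {u, v}) ys}"
  have *: "finite (?L p) \<and> card (?L p) = (\<Prod>i<n. card V - CARD('e) ^ (2 + i))"
    if "p \<in> E.indep_pairs V" for p
  proof -
    obtain u v where p: "p = (u, v)" by (cases p)
    then have "card (E.span {u, v}) = CARD('e)\<^sup>2"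
      using that E.card_span_pair[of u v] by (auto simp: E.indep_pairs_def)
    then show ?thesis
      using E.card_rel_indep[OF E.subspace_span assms span_pair_subset[OF assms(1)], of u v n] that p
      unfolding power_add by simp
  qed
  then show "finite (tuples V n)"
    unfolding tuples_def using assms E.finite_indep_pairs by (intro finite_SigmaI) auto
  show "card (tuples V n) = (card V - 1) * (card V - CARD('e)) * (\<Prod>i<n. card V - CARD('e) ^ (2 + i))"
    unfolding tuples_def using assms E.finite_indep_pairs[of V] * E.card_indep_pairs[of V]
    by (subst card_SigmaI) (auto simp: case_prod_unfold)
qed

lemma block_props:
  assumes V: "E.subspace V" "finite V" and D: "F_closed D" and z: "z \<in> tuples V n"
  shows "scattered (block D z)" "block D z \<subseteq> V" "card (block D z) = card D * CARD('a) ^ n"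
proof -
  obtain u v ys where zz: "z = ((u, v), ys)" by (metis prod.collapse)
  have uv: "(u, v) \<in> E.indep_pairs V" and ys: "length ys = n" "set ys \<subseteq> V"
    "E.rel_indep (E.span {u, v}) ys"
    using z zz by (auto simp: tuples_def)
  have W: "scattered (twisted D u v)" using D uv by (rule scattered_twisted)
  \<comment> \<open>Independence modulo the whole plane of u and v is stronger than independence
    modulo its subset \<open>twisted D u v\<close>.\<close>
  have "E.rel_indep (twisted D u v) ys"
    using ys(3) twisted_subset_span[of D u v]
    by (rule_tac E.rel_indep_mono[of _ "E.span {u, v}"]) (auto simp: E.span_minimal E.span_span)
  note * = scattered_span_list[OF W this]
  then show "scattered (block D z)" by (simp add: zz)
  have WV: "twisted D u v \<subseteq> V"
    using twisted_subset_span[of D u v] span_pair_subset[OF V(1) uv] by blast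
  then show "block D z \<subseteq> V" unfolding zz block.simps using ys V
    by (intro F.span_minimal E_subspace_imp_F_subspace) auto
  have spW: "F.span (twisted D u v) = twisted D u v" using W by (simp add: scattered_def)
  have "finite (twisted D u v)" using WV V(2) finite_subset by blast
  then show "card (block D z) = card D * CARD('a) ^ n"
    using * F.rel_indep_iff_card[of "twisted D u v" ys] spW card_twisted[OF uv, of D] ys(1)
    by (simp add: zz)
qed

end

section \<open>Invariant families of blocks\<close>

lemma image_mset_repeat_mset: "image_mset f (repeat_mset c B) = repeat_mset c (image_mset f B)"
  by (induction c) simp_all

context frobenius_extension
begin

lemma linear_E_imp_linear_F:
  assumes "Vector_Spaces.linear scale scale g"
  shows "Vector_Spaces.linear (\<lambda>c. scale (emb c)) (\<lambda>c. scale (emb c)) g"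
  using assms F.vector_space_axioms by (simp add: Vector_Spaces.linear_iff)

fun map_tuple :: "('b \<Rightarrow> 'b) \<Rightarrow> ('b \<times> 'b) \<times> 'b list \<Rightarrow> ('b \<times> 'b) \<times> 'b list" where
  "map_tuple g ((u, v), ys) = ((g u, g v), map g ys)"

lemma block_map_tuple:
  assumes "Vector_Spaces.linear scale scale g"
  shows "g ` block D z = block D (map_tuple g z)"
proof -
  interpret p: vector_space_pair "\<lambda>c. scale (emb c)" "\<lambda>c. scale (emb c)" ..
  obtain u v ys where z: "z = ((u, v), ys)" by (metis prod.collapse)
  have "g (scale c x) = scale c (g x)" "g (x + y) = g x + g y" for c x y
    using assms by (simp_all add: Vector_Spaces.linear_iff)
  then have "g ` twisted D u v = twisted D (g u) (g v)"
    by (simp add: twisted_def image_image)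
  then show ?thesis
    using p.linear_span_image[OF linear_E_imp_linear_F[OF assms], of "twisted D u v \<union> set ys"]
    by (simp add: z image_Un)
qed

lemma map_tuple_tuples:
  assumes V: "E.subspace V" "finite V"
    and g: "Vector_Spaces.linear scale scale g" "g ` V = V" "inj_on g V"
  shows "bij_betw (map_tuple g) (tuples V n) (tuples V n)"
proof -
  interpret p: vector_space_pair scale scale ..
  have inj: "inj_on (map_tuple g) (tuples V n)"
  proof (rule inj_onI)
    fix z z' assume z: "z \<in> tuples V n" "z' \<in> tuples V n" "map_tuple g z = map_tuple g z'"
    obtain u v ys where zz: "z = ((u, v), ys)" by (metis prod.collapse)
    obtain u' v' ys' where zz': "z' = ((u', v'), ys')" by (metis prod.collapse)
    have "u \<in> V" "v \<in> V" "u' \<in> V" "v' \<in> V" "set ys \<subseteq> V" "set ys' \<subseteq> V"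
      using z zz zz' by (auto simp: tuples_def E.indep_pairs_def)
    moreover have "map g ys = map g ys'" "g u = g u'" "g v = g v'" using z zz zz' by simp_all
    ultimately show "z = z'"
      using inj_on_map_eq_map[of g ys ys'] inj_on_subset[OF g(3), of "set ys \<union> set ys'"]
        inj_onD[OF g(3)] by (simp add: zz zz')
  qed
  have sub: "map_tuple g ` tuples V n \<subseteq> tuples V n"
  proof (rule image_subsetI)
    fix z assume z: "z \<in> tuples V n"
    obtain u v ys where zz: "z = ((u, v), ys)" by (metis prod.collapse)
    have uv: "u \<in> V" "v \<in> V" "u \<noteq> 0" "v \<notin> E.span {u}" and ys: "length ys = n" "set ys \<subseteq> V"
      "E.rel_indep (E.span {u, v}) ys"
      using z zz by (auto simp: tuples_def E.indep_pairs_def)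
    have sp: "E.span {u} \<subseteq> V" "E.span {u, v} \<subseteq> V" using uv V by (simp_all add: E.span_minimal)
    have "g 0 = 0" using p.linear_0[OF g(1)] .
    then have "g u \<noteq> 0" using g(3) uv V(1) by (metis E.subspace_0 inj_on_contraD)
    moreover have "g v \<notin> E.span {g u}"
      using p.linear_span_image[OF g(1), of "{u}"] inj_on_image_mem_iff[OF g(3) uv(2) sp(1)] uv(4)
      by simp
    moreover have "E.rel_indep (E.span {g u, g v}) (map g ys)"
      using E.rel_indep_image[OF g(1,3) V sp(2) ys(2,3)] p.linear_span_image[OF g(1), of "{u, v}"]
      by simp
    ultimately show "map_tuple g z \<in> tuples V n"
      using uv ys g(2) unfolding zz by (auto simp: tuples_def E.indep_pairs_def)
  qed
  \<comment> \<open>An injective self-map of a finite set is onto, so no inverse of g has to be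
    constructed.\<close>
  then have "map_tuple g ` tuples V n = tuples V n"
    using inj card_tuples(1)[OF V] by (simp add: endo_inj_surj)
  then show ?thesis using inj by (simp add: bij_betw_def)
qed

definition stabilizing_group :: "'e set \<Rightarrow> 'e set \<Rightarrow> bool" where
  "stabilizing_group C D \<longleftrightarrow> 1 \<in> C \<and> (\<forall>c\<in>C. c \<noteq> 0 \<and> inverse c \<in> C) \<and>
    (\<forall>c\<in>C. \<forall>d\<in>C. c * d \<in> C) \<and> (\<forall>c\<in>C. \<forall>x\<in>D. c * x \<in> D)"

text \<open>Passing to (c u, c^q v) amounts to substituting c x for x, and multiplication by c
  permutes D.\<close>

lemma twisted_scale:
  assumes "stabilizing_group C D" "c \<in> C"
  shows "twisted D (scale c u) (scale (c ^ CARD('a)) v) = twisted D u v"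
proof -
  have "(\<lambda>x. x * c) ` D = D"
  proof (intro equalityI subsetI)
    fix x assume "x \<in> D"
    then show "x \<in> (\<lambda>x. x * c) ` D"
      using assms by (intro image_eqI[of _ _ "inverse c * x"]) (auto simp: stabilizing_group_def)
  qed (use assms in \<open>auto simp: stabilizing_group_def mult.commute\<close>)
  moreover have "twisted D (scale c u) (scale (c ^ CARD('a)) v) = twisted ((\<lambda>x. x * c) ` D) u v"
    by (simp add: twisted_def image_image power_mult_distrib)
  ultimately show ?thesis by simp
qed

lemma E_span_scale_pair:
  assumes "c \<noteq> 0" "d \<noteq> 0"
  shows "E.span {scale c u} = E.span {u}" "E.span {scale c u, scale d v} = E.span {u, v}"
proof -
  have "u \<in> E.span {scale c u, w}" if "c \<noteq> 0" for c u w
  proof -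
    have "scale (inverse c) (scale c u) \<in> E.span {scale c u, w}"
      by (intro E.span_scale E.span_base) simp
    then show ?thesis using that by simp
  qed
  note * = this
  show "E.span {scale c u} = E.span {u}"
    using *[OF assms(1), of u "scale c u"] by (auto simp: E.span_eq intro: E.span_scale E.span_base)
  show "E.span {scale c u, scale d v} = E.span {u, v}"
    using *[OF assms(1), of u "scale d v"] *[OF assms(2), of v "scale c u"]
      E.span_scale[OF E.span_base[of u "{u, v}"], of c] E.span_scale[OF E.span_base[of v "{u, v}"], of d]
    by (simp add: E.span_eq insert_commute)
qed

text \<open>
  Different tuples give the same block if \<open>(u, v)\<close> is changed by \<open>C\<close> or \<open>ys\<close> by another completion
  of \<open>twisted D u v\<close> to the block, so multiplicities in the family of all blocks have a common divisor.
\<close>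

lemma dvd_card_tuples_of_block:
  assumes V: "E.subspace V" "finite V" and D: "F_closed D" "card D = CARD('a) ^ d"
    and C: "stabilizing_group C D"
  shows "card C * (\<Prod>i<n. CARD('a) ^ (d + n) - CARD('a) ^ (d + i)) dvd
    card {z \<in> tuples V n. block D z = U}"
proof -
  \<comment> \<open>The tuples with block U are fibred over the pairs in S, with fibres
    \<open>L p\<close>. All fibres have the same size, and C acts freely on S; this yields the two
    factors of the divisor.\<close>
  define S where "S = {p \<in> E.indep_pairs V. \<exists>ys. (p, ys) \<in> tuples V n \<and> block D (p, ys) = U}"
  define L where "L p = {ys. length ys = n \<and> set ys \<subseteq> U \<and>
    F.rel_indep (twisted D (fst p) (snd p)) ys}" for p
  have S: "twisted D (fst p) (snd p) \<subseteq> U \<and> F.subspace U \<and> U \<subseteq> V \<and> finite U \<and>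
      card U = CARD('a) ^ (d + n) \<and> F.subspace (twisted D (fst p) (snd p)) \<and>
      card (twisted D (fst p) (snd p)) = CARD('a) ^ d \<and>
      (\<forall>ys. (p, ys) \<in> tuples V n \<and> block D (p, ys) = U \<longleftrightarrow> ys \<in> L p)" if pS: "p \<in> S" for p
  proof -
    obtain u v where p: "p = (u, v)" by (cases p)
    obtain ys0 where ys0: "(p, ys0) \<in> tuples V n" "block D (p, ys0) = U"
      using pS by (auto simp: S_def)
    have uv: "(u, v) \<in> E.indep_pairs V" using pS p by (simp add: S_def)
    let ?W = "twisted D u v"
    have U: "F.subspace U" "U \<subseteq> V" "finite U" "card U = CARD('a) ^ (d + n)"
      using block_props[OF V D(1) ys0(1)] ys0(2) D(2) V(2)
      by (auto simp: scattered_def power_add intro: finite_subset)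
    have W: "F.subspace ?W" "card ?W = CARD('a) ^ d" "F.span ?W = ?W"
      using F_subspace_twisted[OF D(1)] card_twisted[OF uv] D(2)
      by (simp_all add: F.span_eq_iff[THEN iffD2])
    have U_eq: "U = F.span (?W \<union> set ys0)" using ys0(2) p by simp
    have WU: "?W \<subseteq> U" unfolding U_eq using F.span_superset by blast
    have finW: "finite (F.span ?W)" using W(3) WU U(3) finite_subset by metis
    have span_uv: "E.span {u, v} \<subseteq> E.span ({u, v} \<union> set ys)" for ys
      by (rule E.span_mono) simp
    have U_sub: "U \<subseteq> E.span ({u, v} \<union> set ys)" if "U = F.span (?W \<union> set ys)" for ys
    proof -
      have "?W \<union> set ys \<subseteq> E.span ({u, v} \<union> set ys)"
        using twisted_subset_span[of D u v] span_uv[of ys] E.span_superset[of "{u, v} \<union> set ys"]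
        by blast
      then show ?thesis unfolding that
        by (intro F.span_minimal E_subspace_imp_F_subspace E.subspace_span)
    qed
    have Espan: "E.span (E.span {u, v} \<union> set ys) = E.span ({u, v} \<union> set ys)" for ys
      using span_uv[of ys] E.span_superset[of "{u, v}"] E.span_superset[of "{u, v} \<union> set ys"]
      by (intro E.span_eq[THEN iffD2] conjI) (auto intro: E.span_base)
    have L: "(p, ys) \<in> tuples V n \<and> block D (p, ys) = U \<longleftrightarrow> ys \<in> L p" for ys
    proof
      assume *: "(p, ys) \<in> tuples V n \<and> block D (p, ys) = U"
      then have eq: "U = F.span (?W \<union> set ys)" and len: "length ys = n"
        by (auto simp: p tuples_def)
      have "set ys \<subseteq> U" unfolding eq using F.span_superset by blast
      moreover have "F.rel_indep ?W ys"
        using F.rel_indep_iff_card[OF finW, of ys] U(4) W len by (simp add: power_add flip: eq)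
      ultimately show "ys \<in> L p" using len p by (simp add: L_def)
    next
      assume "ys \<in> L p"
      then have ys: "length ys = n" "set ys \<subseteq> U" "F.rel_indep ?W ys" by (auto simp: L_def p)
      have "F.span (?W \<union> set ys) = U"
      proof (rule card_subset_eq[OF U(3)])
        show "F.span (?W \<union> set ys) \<subseteq> U" using ys WU U(1) by (intro F.span_minimal) auto
        show "card (F.span (?W \<union> set ys)) = card U"
          using F.rel_indep_iff_card[OF finW, of ys] ys U(4) W by (simp add: power_add)
      qed
      then have eq: "U = F.span (?W \<union> set ys)" by simp
      \<comment> \<open>Each side contains u, v and U, hence also the other list. Equal spans and
        equal lengths transfer \<open>E.rel_indep\<close> from \<open>ys0\<close> to
        \<open>ys\<close>.\<close>
      have "E.span ({u, v} \<union> set ys) = E.span ({u, v} \<union> set ys0)"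
        using U_sub[OF eq] U_sub[OF U_eq] ys(2) F.span_superset[of "?W \<union> set ys0"]
          span_uv[of ys] span_uv[of ys0] E.span_superset[of "{u, v}"]
        unfolding U_eq[symmetric] by (intro E.span_eq[THEN iffD2]) auto
      moreover have "length ys0 = n" "E.rel_indep (E.span {u, v}) ys0"
        using ys0(1) p by (auto simp: tuples_def)
      ultimately have "E.rel_indep (E.span {u, v}) ys"
        using ys(1) E.rel_indep_iff_card[of "E.span {u, v}"] Espan by (simp add: E.span_span)
      then show "(p, ys) \<in> tuples V n \<and> block D (p, ys) = U"
        using ys U(2) uv eq by (auto simp: p tuples_def)
    qed
    show ?thesis using WU U W L p by simp
  qed
  have "{z \<in> tuples V n. block D z = U} = (SIGMA p:S. L p)"
  proof (intro equalityI subsetI)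
    fix z assume z: "z \<in> {z \<in> tuples V n. block D z = U}"
    obtain p ys where zz: "z = (p, ys)" by (cases z)
    have "p \<in> S" using z zz by (auto simp: S_def tuples_def)
    then show "z \<in> (SIGMA p:S. L p)" using S[of p] z zz by auto
  next
    fix z assume "z \<in> (SIGMA p:S. L p)"
    then show "z \<in> {z \<in> tuples V n. block D z = U}" using S by auto
  qed
  moreover have "card (SIGMA p:S. L p) = card S * (\<Prod>i<n. CARD('a) ^ (d + n) - CARD('a) ^ (d + i))"
  proof -
    have "finite (L p) \<and> card (L p) = (\<Prod>i<n. CARD('a) ^ (d + n) - CARD('a) ^ (d + i))"
      if "p \<in> S" for p
      using S[OF that] F.card_rel_indep[of "twisted D (fst p) (snd p)" U n]
      by (simp add: L_def power_add)
    moreover have "finite S" unfolding S_def using V(2) E.finite_indep_pairs by simp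
    ultimately show ?thesis by (subst card_SigmaI) auto
  qed
  moreover have "card C dvd card S"
  \<comment> \<open>The action sends (u, v) to (c u, c^q v). It keeps the twisted part and the plane
    of u and v, and it is free because u is nonzero.\<close>
  proof (rule card_dvd_if_free_action[where act = "\<lambda>c (u, v). (scale c u, scale (c ^ CARD('a)) v)"])
    show "finite S" unfolding S_def using V(2) E.finite_indep_pairs by simp
    fix c s assume c: "c \<in> C" "s \<in> S"
    obtain u v where s: "s = (u, v)" by (cases s)
    have c0: "c \<noteq> 0" using C c by (auto simp: stabilizing_group_def)
    then have sp: "E.span {scale c u} = E.span {u}"
      "E.span {scale c u, scale (c ^ CARD('a)) v} = E.span {u, v}"
      using E_span_scale_pair[of c "c ^ CARD('a)"] by auto
    have "(scale c u, scale (c ^ CARD('a)) v) \<in> E.indep_pairs V"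
    proof -
      have uv: "u \<in> V" "v \<in> V" "u \<noteq> 0" "v \<notin> E.span {u}"
        using c s by (auto simp: S_def E.indep_pairs_def)
      have "scale (c ^ CARD('a)) v \<notin> E.span {u}"
      proof
        assume "scale (c ^ CARD('a)) v \<in> E.span {u}"
        then have "scale (inverse (c ^ CARD('a))) (scale (c ^ CARD('a)) v) \<in> E.span {u}"
          by (rule E.span_scale)
        then show False using uv c0 by simp
      qed
      then show ?thesis using uv c0 V(1) by (simp add: E.indep_pairs_def sp E.subspace_scale)
    qed
    moreover obtain ys where "(s, ys) \<in> tuples V n" "block D (s, ys) = U"
      using c by (auto simp: S_def)
    ultimately have "((scale c u, scale (c ^ CARD('a)) v), ys) \<in> tuples V n"
      "block D ((scale c u, scale (c ^ CARD('a)) v), ys) = U"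
      by (simp_all add: s tuples_def sp twisted_scale[OF C c(1)])
    then show "(case s of (u, v) \<Rightarrow> (scale c u, scale (c ^ CARD('a)) v)) \<in> S"
      unfolding s S_def by (auto simp: tuples_def)
  qed (use C in \<open>auto simp: stabilizing_group_def S_def E.indep_pairs_def power_mult_distrib split: prod.splits\<close>)
  ultimately show ?thesis by (simp add: mult_dvd_mono)
qed

text \<open>The factor \<open>(card V - 1) * (card V - CARD('e))\<close> of the double count is also
  the number of choices for (u, v), so it cancels. The result stays a product equation, without
  division of naturals.\<close>

theorem ex_scattered_family:
  assumes V: "E.subspace V" "finite V" and D: "F_closed D" "card D = CARD('a) ^ d"
    and C: "stabilizing_group C D"
  shows "\<exists>B. (\<forall>U\<in>#B. scattered U \<and> U \<subseteq> V \<and> card U = CARD('a) ^ (d + n)) \<and>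
    (\<forall>T\<in>F.lines V. (\<exists>x\<in>V. T \<subseteq> E.span {x}) \<longrightarrow> coverage B T = 0) \<and>
    (\<forall>T\<in>F.lines V. (\<nexists>x. x \<in> V \<and> T \<subseteq> E.span {x}) \<longrightarrow>
      coverage B T * (card C * (\<Prod>i<n. CARD('a) ^ (d + n) - CARD('a) ^ (d + i))) =
      (CARD('a) ^ (d + n) - 1) * (CARD('a) ^ (d + n) - CARD('a)) *
      (\<Prod>i<n. card V - CARD('e) ^ (2 + i)))"
proof -
  define s where "s = card C * (\<Prod>i<n. CARD('a) ^ (d + n) - CARD('a) ^ (d + i))"
  define M where "M = image_mset (block D) (mset_set (tuples V n))"
  note fin = card_tuples(1)[OF V, of n]
  have "s dvd count M U" for U
  proof -
    have "count M U = card {z \<in> tuples V n. block D z = U}"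
      using fin by (simp add: M_def count_image_mset vimage_def Int_def conj_commute)
    then show ?thesis using dvd_card_tuples_of_block[OF V D C] by (simp add: s_def)
  qed
  then obtain B where B: "M = repeat_mset s B" by (rule dvd_count_imp_repeat_mset)
  have spos: "s > 0"
  proof -
    have "finite C" "C \<noteq> {}" using C by (auto simp: stabilizing_group_def)
    moreover have "CARD('a) ^ (d + i) < CARD('a) ^ (d + n)" if "i < n" for i
      using that F.card_scalars_ge_2 by (intro power_strict_increasing) auto
    ultimately show ?thesis by (auto simp: s_def card_gt_0_iff prod_pos)
  qed
  have blocks: "scattered U \<and> U \<subseteq> V \<and> card U = CARD('a) ^ (d + n)" if "U \<in># B" for U
  proof -
    have "count M U > 0" using that spos by (simp add: B)
    then have "U \<in># M" by simp
    then obtain z where "z \<in> tuples V n" "U = block D z" using fin by (auto simp: M_def)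
    then show ?thesis using block_props[OF V D(1)] D(2) by (simp add: power_add)
  qed
  have inv: "image_mset ((`) g) B = B"
    if g: "Vector_Spaces.linear scale scale g" "g ` V = V" "inj_on g V" for g
  proof -
    have bij: "bij_betw (map_tuple g) (tuples V n) (tuples V n)"
      using map_tuple_tuples[OF V g] .
    have "image_mset ((`) g) M = image_mset (block D) (image_mset (map_tuple g) (mset_set (tuples V n)))"
      unfolding M_def image_mset.compositionality comp_def block_map_tuple[OF g(1)] ..
    also have "\<dots> = M"
      using bij by (simp add: M_def image_mset_mset_set bij_betw_def)
    finally have "repeat_mset s (image_mset ((`) g) B) = repeat_mset s B"
      by (simp add: B image_mset_repeat_mset)
    \<comment> \<open>Repetition by a positive factor is injective, so invariance passes from M to
      B.\<close>
    then show ?thesis using spos by (metis (full_types) count_repeat_mset less_not_refl multiset_eqI nat_mult_eq_cancel_disj)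
  qed
  have "coverage B T * s = (CARD('a) ^ (d + n) - 1) * (CARD('a) ^ (d + n) - CARD('a)) *
      (\<Prod>i<n. card V - CARD('e) ^ (2 + i))"
    if T: "T \<in> F.lines V" "\<And>x. x \<in> V \<Longrightarrow> \<not> T \<subseteq> E.span {x}" for T
  proof -
    let ?P = "(card V - 1) * (card V - CARD('e))"
    have "s * size B = size M" by (simp add: B)
    also have "\<dots> = ?P * (\<Prod>i<n. card V - CARD('e) ^ (2 + i))"
      using card_tuples(2)[OF V, of n] by (simp add: M_def)
    finally have sB: "s * size B = ?P * (\<Prod>i<n. card V - CARD('e) ^ (2 + i))" .
    have "coverage B T * ?P =
        size B * ((CARD('a) ^ (d + n) - 1) * (CARD('a) ^ (d + n) - CARD('a)))"
      using invariant_coverage[OF V blocks inv T] .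
    then have "coverage B T * ?P * s =
        s * size B * ((CARD('a) ^ (d + n) - 1) * (CARD('a) ^ (d + n) - CARD('a)))"
      by (simp only: mult_ac)
    then have "coverage B T * s * ?P = ((CARD('a) ^ (d + n) - 1) * (CARD('a) ^ (d + n) - CARD('a)) *
      (\<Prod>i<n. card V - CARD('e) ^ (2 + i))) * ?P"
      unfolding sB by (simp only: mult_ac)
    \<comment> \<open>The line T itself provides an independent pair over the large field, so the
      number of such pairs is positive.\<close>
    moreover have "?P > 0"
    proof -
      obtain s t where st: "(s, t) \<in> F.indep_pairs T" "T = F.span {s, t}"
        using T V F.line_eq_span_pair[of T V] by (metis (lifting) F.lines_def mem_Collect_eq)
      have TV: "T \<subseteq> V" using T by (simp add: F.lines_def)
      have "t \<notin> E.span {s}"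
      proof
        assume "t \<in> E.span {s}"
        then have "T \<subseteq> E.span {s}" unfolding st(2)
          by (intro F.span_minimal E_subspace_imp_F_subspace) (auto simp: E.span_base)
        then show False using T TV st(1) by (auto simp: F.indep_pairs_def)
      qed
      then have "(s, t) \<in> E.indep_pairs V"
        using st(1) TV by (auto simp: F.indep_pairs_def E.indep_pairs_def)
      then show ?thesis using E.card_indep_pairs[OF V] E.finite_indep_pairs[OF V(2)]
        by (metis card_gt_0_iff empty_iff)
    qed
    ultimately show ?thesis by (metis mult_right_cancel less_not_refl)
  qed
  then have nondeg: "\<forall>T\<in>F.lines V. (\<nexists>x. x \<in> V \<and> T \<subseteq> E.span {x}) \<longrightarrow> coverage B T * s =
      (CARD('a) ^ (d + n) - 1) * (CARD('a) ^ (d + n) - CARD('a)) *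
      (\<Prod>i<n. card V - CARD('e) ^ (2 + i))" by blast
  have "coverage B T = 0" if "T \<in> F.lines V" "x \<in> V" "T \<subseteq> E.span {x}" for T x
    using scattered_coverage_degenerate[of B V T x] blocks V(2) that by blast
  then have deg: "\<forall>T\<in>F.lines V. (\<exists>x\<in>V. T \<subseteq> E.span {x}) \<longrightarrow> coverage B T = 0" by blast
  show ?thesis
    by (intro exI[of _ B] conjI ballI) (use blocks deg nondeg in \<open>simp_all add: s_def\<close>)
qed

end

section \<open>Group divisible designs\<close>

lemma simple_blocks_iff: "simple_blocks B \<longleftrightarrow> (\<forall>U. count B U \<le> 1)"
proof -
  have "(U \<in># B \<longrightarrow> count B U = 1) \<longleftrightarrow> count B U \<le> 1" for U
    using count_greater_eq_one_iff[of B U] by (auto simp: not_in_iff le_antisym)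
  then show ?thesis by (auto simp: simple_blocks_def)
qed

lemma count_le_count_image_mset: "count B x \<le> count (image_mset f B) (f x)"
  by (induction B) auto

lemma not_simple_blocks_mono: "\<not> simple_blocks A \<Longrightarrow> A \<subseteq># B \<Longrightarrow> \<not> simple_blocks B"
  unfolding simple_blocks_iff by (meson mset_subset_eq_count order_trans)

lemma not_simple_blocks_repeat: "2 \<le> c \<Longrightarrow> B \<noteq> {#} \<Longrightarrow> \<not> simple_blocks (repeat_mset c B)"
proof -
  assume "2 \<le> c" "B \<noteq> {#}"
  then obtain U where "U \<in># B" by auto
  then have "1 \<le> count B U" by simp
  then have "2 * 1 \<le> c * count B U" using \<open>2 \<le> c\<close> by (intro mult_le_mono)
  then show ?thesis unfolding simple_blocks_iff by (auto intro!: exI[of _ U] simp: not_le)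
qed

context finite_field_space
begin

lemma blocks_in_empty [simp]: "blocks_in k V {#}"
  and blocks_in_union [simp]: "blocks_in k V (A + B) \<longleftrightarrow> blocks_in k V A \<and> blocks_in k V B"
  by (auto simp: blocks_in_def)

lemma blocks_in_sum: "(\<And>i. i \<in> I \<Longrightarrow> blocks_in k V (f i)) \<Longrightarrow> blocks_in k V (\<Sum>i\<in>I. f i)"
  by (induction I rule: infinite_finite_induct) auto

lemma blocks_in_repeat: "blocks_in k V B \<Longrightarrow> blocks_in k V (repeat_mset c B)"
  by (induction c) auto

lemma blocks_in_mono: "blocks_in k V B \<Longrightarrow> V \<subseteq> V' \<Longrightarrow> blocks_in k V' B"
  by (auto simp: blocks_in_def)

lemma blocks_in_mset_set: "finite S \<Longrightarrow> blocks_in k V (mset_set S) \<longleftrightarrow> (\<forall>U\<in>S. subspace U \<and> U \<subseteq> V \<and> dim U = k)"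
  by (auto simp: blocks_in_def)

text \<open>The \<open>q\<close>-analog of a group divisible design.\<close>

definition gdd :: "'b set \<Rightarrow> 'b set set \<Rightarrow> nat \<Rightarrow> nat \<Rightarrow> 'b set multiset \<Rightarrow> bool" where
  "gdd V \<G> k l B \<longleftrightarrow> subspace V \<and> finite V \<and> (\<forall>G\<in>\<G>. subspace G \<and> G \<subseteq> V) \<and>
    (\<forall>T\<in>lines V. \<forall>G\<in>\<G>. \<forall>H\<in>\<G>. T \<subseteq> G \<longrightarrow> T \<subseteq> H \<longrightarrow> G = H) \<and> blocks_in k V B \<and>
    (\<forall>T\<in>lines V. coverage B T = (if \<exists>G\<in>\<G>. T \<subseteq> G then 0 else l))"

text \<open>More than \<open>gdd\<close> demands of its groups. Lifting needs it: a line through the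
  apex projects to a single point, which must determine a group.\<close>

definition spread :: "'b set \<Rightarrow> 'b set set \<Rightarrow> bool" where
  "spread V \<G> \<longleftrightarrow> (\<forall>G\<in>\<G>. subspace G \<and> G \<subseteq> V) \<and> (\<forall>x\<in>V. x \<noteq> 0 \<longrightarrow> (\<exists>!G. G \<in> \<G> \<and> x \<in> G))"

lemma line_nonzero_point: "T \<in> lines V \<Longrightarrow> finite V \<Longrightarrow> \<exists>x\<in>T. x \<noteq> 0"
proof -
  assume "T \<in> lines V" "finite V"
  then obtain s t where "(s, t) \<in> indep_pairs T" "T = span {s, t}"
    using line_eq_span_pair[of T V] unfolding lines_def by blast
  then show ?thesis unfolding indep_pairs_def by blast
qed

lemma spread_line_unique:
  assumes "spread V \<G>" "finite V" "T \<in> lines V" "G \<in> \<G>" "H \<in> \<G>" "T \<subseteq> G" "T \<subseteq> H"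
  shows "G = H"
proof -
  obtain x where x: "x \<in> T" "x \<noteq> 0" using line_nonzero_point[OF assms(3,2)] by blast
  then have "x \<in> V" using assms(3) by (auto simp: lines_def)
  then have "\<exists>!G. G \<in> \<G> \<and> x \<in> G" using x(2) assms(1) by (simp add: spread_def)
  then show ?thesis using assms(4-7) x(1) by blast
qed

lemma complete_design:
  assumes "subspace V" "finite V" "dim V = v"
    and "l * (\<Prod>i<n. CARD('a) ^ (2 + n) - CARD('a) ^ (2 + i)) = (\<Prod>i<n. CARD('a) ^ v - CARD('a) ^ (2 + i))"
  shows "subspace_2_design v (2 + n) l V (mset_set {U. subspace U \<and> U \<subseteq> V \<and> dim U = 2 + n})"
proof -
  have fin: "finite {U. subspace U \<and> U \<subseteq> V \<and> dim U = 2 + n}"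
    using assms(2) by (auto intro: finite_subset[of _ "Pow V"])
  let ?P = "\<Prod>i<n. CARD('a) ^ (2 + n) - CARD('a) ^ (2 + i)"
  have "?P > 0"
    using card_scalars_ge_2 by (intro prod_pos ballI) (simp add: power_strict_increasing)
  then have P: "?P \<noteq> 0" by (rule less_imp_neq[symmetric])
  have cV: "card V = CARD('a) ^ v" using assms card_subspace by simp
  have "coverage (mset_set {U. subspace U \<and> U \<subseteq> V \<and> dim U = 2 + n}) T = l"
    if "T \<in> lines V" for T
  proof -
    have "coverage (mset_set {U. subspace U \<and> U \<subseteq> V \<and> dim U = 2 + n}) T * ?P = l * ?P"
      unfolding assms(4) using complete_coverage[OF assms(1,2) that, of n] by (simp only: cV)
    then show ?thesis using mult_right_cancel[OF P] by blast
  qed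
  then show ?thesis
    using assms fin by (simp add: subspace_2_design_iff blocks_in_mset_set)
qed

lemma repeat_design:
  "subspace_2_design v k l V B \<Longrightarrow> subspace_2_design v k (c * l) V (repeat_mset c B)"
  by (simp add: subspace_2_design_iff blocks_in_repeat)

lemma finite_groups: "gdd V \<G> k l B \<Longrightarrow> finite \<G>"
  unfolding gdd_def by (rule finite_subset[of _ "Pow V"]) auto

lemma lines_nonempty:
  assumes "subspace V" "2 \<le> dim V"
  obtains T where "T \<in> lines V"
proof -
  obtain B where B: "B \<subseteq> V" "independent B" "V \<subseteq> span B" "card B = dim V"
    using basis_exists by blast
  then obtain C where C: "C \<subseteq> B" "card C = 2"
    using assms(2) obtain_subset_with_card_n[of 2 B] by metis
  have "span C \<subseteq> V" using C B assms by (intro span_minimal) auto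
  moreover have "dim (span C) = 2"
    using dim_span_eq_card_independent[OF independent_mono[OF B(2) C(1)]] C(2) by simp
  ultimately have "span C \<in> lines V" by (simp add: lines_def)
  then show ?thesis by (rule that)
qed

text \<open>B may already cover lines inside the groups, even unevenly, and the filling supplies the
  difference. The mixture in dimension 7 needs this generality.\<close>

lemma fill_groups:
  assumes V: "subspace V" "finite V" "dim V = v" and B: "blocks_in k V B"
    and groups: "\<And>G. G \<in> \<G> \<Longrightarrow> G \<subseteq> V"
    and uniq: "\<And>T G H. T \<in> lines V \<Longrightarrow> G \<in> \<G> \<Longrightarrow> H \<in> \<G> \<Longrightarrow> T \<subseteq> G \<Longrightarrow> T \<subseteq> H \<Longrightarrow> G = H"
    and out: "\<And>T. T \<in> lines V \<Longrightarrow> \<not> (\<exists>G\<in>\<G>. T \<subseteq> G) \<Longrightarrow> coverage B T = l"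
    and f: "\<And>G. G \<in> \<G> \<Longrightarrow> blocks_in k G (f G)"
      "\<And>G T. G \<in> \<G> \<Longrightarrow> T \<in> lines V \<Longrightarrow> T \<subseteq> G \<Longrightarrow> coverage B T + coverage (f G) T = l"
  shows "subspace_2_design v k l V (B + (\<Sum>G\<in>\<G>. f G))"
proof -
  have fin: "finite \<G>" using groups V(2) by (intro finite_subset[of \<G> "Pow V"]) auto
  have not_in: "coverage (f H) T = 0" if "H \<in> \<G>" "\<not> T \<subseteq> H" for H T
    using f(1)[OF that(1)] that(2) by (intro coverage_eq_0) (auto simp: blocks_in_def)
  have "coverage (B + (\<Sum>G\<in>\<G>. f G)) T = l" if T: "T \<in> lines V" for T
  proof (cases "\<exists>G\<in>\<G>. T \<subseteq> G")
    case True
    then obtain G where G: "G \<in> \<G>" "T \<subseteq> G" by blast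
    have "\<not> T \<subseteq> H" if "H \<in> \<G> - {G}" for H using uniq[OF T G(1) _ G(2)] that by blast
    then have "(\<Sum>H\<in>\<G> - {G}. coverage (f H) T) = 0" using not_in by simp
    then show ?thesis using f(2)[OF G(1) T G(2)] by (simp add: coverage_sum sum.remove[OF fin G(1)])
  next
    case False
    then show ?thesis using out[OF T] not_in by (simp add: coverage_sum)
  qed
  moreover have "blocks_in k V (B + (\<Sum>G\<in>\<G>. f G))"
    using B f(1) groups by (auto intro!: blocks_in_sum intro: blocks_in_mono)
  ultimately show ?thesis using V by (simp add: subspace_2_design_iff)
qed

lemma not_simple_fill:
  assumes "finite \<G>" "G \<in> \<G>" "\<not> simple_blocks (f G)"
  shows "\<not> simple_blocks (B + (\<Sum>G\<in>\<G>. f G))"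
proof (rule not_simple_blocks_mono[OF assms(3)])
  have "f G \<subseteq># (\<Sum>G\<in>\<G>. f G)" by (simp add: sum.remove[OF assms(1,2)])
  then show "f G \<subseteq># B + (\<Sum>G\<in>\<G>. f G)" by (simp add: subset_mset.add_increasing)
qed

text \<open>The flag \<open>ns\<close> serves both the intermediate designs, where only existence
  matters, and the final non-simple ones. One non-simple group suffices, hence the nonempty set of
  groups.\<close>

lemma fill_gdd:
  assumes gdd: "gdd V \<G> k l B" and v: "dim V = v"
    and fill: "\<And>G. G \<in> \<G> \<Longrightarrow> \<exists>B'. subspace_2_design g k l G B' \<and> (ns \<longrightarrow> \<not> simple_blocks B')"
    and ne: "\<G> \<noteq> {}"
  shows "\<exists>B'. subspace_2_design v k l V B' \<and> (ns \<longrightarrow> \<not> simple_blocks B')"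
proof -
  obtain f where f: "\<And>G. G \<in> \<G> \<Longrightarrow> subspace_2_design g k l G (f G) \<and> (ns \<longrightarrow> \<not> simple_blocks (f G))"
    using fill by metis
  have "subspace_2_design v k l V (B + (\<Sum>G\<in>\<G>. f G))"
  proof (rule fill_groups)
    fix G T assume GT: "G \<in> \<G>" "T \<in> lines V" "T \<subseteq> G"
    then have "coverage B T = 0" using gdd by (auto simp: gdd_def)
    moreover have "T \<in> lines G" using GT by (auto simp: lines_def)
    ultimately show "coverage B T + coverage (f G) T = l"
      using f[OF GT(1)] by (simp add: subspace_2_design_iff)
  next
    fix G assume "G \<in> \<G>"
    then show "blocks_in k G (f G)" using f by (simp add: subspace_2_design_iff)
  next
    fix T G H assume "T \<in> lines V" "G \<in> \<G>" "H \<in> \<G>" "T \<subseteq> G" "T \<subseteq> H"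
    then show "G = H" using gdd unfolding gdd_def by blast
  qed (use gdd v in \<open>auto simp: gdd_def\<close>)
  moreover have "\<not> simple_blocks (B + (\<Sum>G\<in>\<G>. f G))" if nonsimple: ns
    using not_simple_fill[OF finite_groups[OF gdd]] ne f nonsimple by blast
  ultimately show ?thesis by blast
qed

end

section \<open>Transport of designs between spaces of equal dimension\<close>

locale finite_field_space_pair = vs1: finite_field_space s1 + vs2: finite_field_space s2
  for s1 :: "'a::{field,finite} \<Rightarrow> 'b::ab_group_add \<Rightarrow> 'b"
  and s2 :: "'a \<Rightarrow> 'c::ab_group_add \<Rightarrow> 'c"
begin

sublocale vector_space_pair s1 s2 ..

text \<open>Matching bases gives an isomorphism. Multiplicities do not decrease in an image, so
  repeated blocks stay repeated.\<close>

lemma transport_design: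
  assumes des: "vs1.subspace_2_design v k l V B" and ns: "ns \<longrightarrow> \<not> simple_blocks B"
    and W: "vs2.subspace W" "finite W" "vs2.dim W = v"
  shows "\<exists>B'. vs2.subspace_2_design v k l W B' \<and> (ns \<longrightarrow> \<not> simple_blocks B')"
proof -
  have V: "vs1.subspace V" "finite V" "vs1.dim V = v" and blocks: "vs1.blocks_in k V B"
    and cov: "\<And>T. T \<in> vs1.lines V \<Longrightarrow> coverage B T = l"
    using des by (auto simp: vs1.subspace_2_design_iff)
  obtain B1 where B1: "B1 \<subseteq> V" "vs1.independent B1" "V \<subseteq> vs1.span B1" "card B1 = vs1.dim V"
    using vs1.basis_exists by blast
  obtain B2 where B2: "B2 \<subseteq> W" "vs2.independent B2" "W \<subseteq> vs2.span B2" "card B2 = vs2.dim W"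
    using vs2.basis_exists by blast
  have "finite B1" "finite B2" using B1(1) B2(1) V W finite_subset by auto
  then obtain h where h: "Vector_Spaces.linear s1 s2 h" "h ` V = W" "inj_on h V"
    using finite_basis_to_basis_subspace_isomorphism[OF V(1) W(1) _ _ B1 _ B2] V(3) W(3) by auto
  have img: "vs2.subspace (h ` U) \<and> h ` U \<subseteq> W \<and> vs2.dim (h ` U) = d"
    if "vs1.subspace U" "U \<subseteq> V" "vs1.dim U = d" for U d
  proof -
    have "vs2.subspace (h ` U)" using linear_subspace_image[OF h(1) that(1)] .
    moreover have "card (h ` U) = card U" using h(3) that(2) by (meson card_image inj_on_subset)
    ultimately show ?thesis
      using that V(2) W(2) h(2) vs1.dim_eq_iff_card[of U d] vs2.dim_eq_iff_card[of "h ` U" d]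
      by (auto intro: finite_subset)
  qed
  have pre: "\<exists>U. vs1.subspace U \<and> U \<subseteq> V \<and> vs1.dim U = d \<and> T = h ` U"
    if T: "vs2.subspace T" "T \<subseteq> W" "vs2.dim T = d" for T d
  proof -
    let ?U = "V \<inter> {x. h x \<in> T}"
    have U: "vs1.subspace ?U"
      using vs1.subspace_inter[OF V(1) linear_subspace_linear_preimage[OF h(1) T(1)]] .
    moreover have "T = h ` ?U" using T(2) h(2) by auto
    moreover have "vs1.dim ?U = d"
    proof -
      have "card (h ` ?U) = card ?U" using h(3) by (meson card_image inj_on_subset inf_le1)
      then have "card ?U = card T" using \<open>T = h ` ?U\<close> by simp
      then show ?thesis
        using vs1.dim_eq_iff_card[OF U, of d] vs2.dim_eq_iff_card[OF T(1), of d] T V(2) W(2)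
        by (auto intro: finite_subset)
    qed
    ultimately show ?thesis by blast
  qed
  let ?B = "image_mset ((`) h) B"
  have "vs2.blocks_in k W ?B" using blocks img by (auto simp: vs1.blocks_in_def vs2.blocks_in_def)
  moreover have "coverage ?B T = l" if "T \<in> vs2.lines W" for T
  proof -
    obtain T' where T': "T' \<in> vs1.lines V" "T = h ` T'"
      using pre[of T 2] \<open>T \<in> vs2.lines W\<close> by (auto simp: vs1.lines_def vs2.lines_def)
    have "T \<subseteq> h ` U \<longleftrightarrow> T' \<subseteq> U" if "U \<in># B" for U
    proof -
      have "U \<subseteq> V" "T' \<subseteq> V" using that blocks T' by (auto simp: vs1.blocks_in_def vs1.lines_def)
      then show ?thesis unfolding T'(2) using inj_on_image_mem_iff[OF h(3) _ \<open>U \<subseteq> V\<close>]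
        unfolding image_subset_iff by (meson subsetD subsetI)
    qed
    then have "coverage ?B T = coverage B T'"
      unfolding coverage_def by (simp add: filter_mset_image_mset cong: filter_mset_cong)
    then show ?thesis using cov[OF T'(1)] by simp
  qed
  moreover have "\<not> simple_blocks ?B" if "\<not> simple_blocks B"
    using that count_le_count_image_mset[of B _ "(`) h"] unfolding simple_blocks_iff
    by (meson order_trans)
  ultimately show ?thesis using W ns by (auto simp: vs2.subspace_2_design_iff)
qed

end

section \<open>Cylinders\<close>

definition pair_scale :: "('a::field \<Rightarrow> 'b::ab_group_add \<Rightarrow> 'b) \<Rightarrow> 'a \<Rightarrow> 'b \<times> 'a \<Rightarrow> 'b \<times> 'a" where
  "pair_scale s c p = (s c (fst p), c * snd p)"

text \<open>The product with the scalar field adds one dimension. A group G becomes the cylinder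
  \<open>G \<times> UNIV\<close>, and all cylinders share the vector (0, 1), the apex.\<close>

locale cylinder = finite_field_space
begin

sublocale P: finite_field_space "pair_scale scale"
  by unfold_locales (simp_all add: pair_scale_def algebra_simps scale_right_distrib scale_left_distrib)

lemma linear_fst_pair: "Vector_Spaces.linear (pair_scale scale) scale fst"
  using vector_space_axioms P.vector_space_axioms
  by (simp add: Vector_Spaces.linear_iff pair_scale_def)

lemma subspace_times_UNIV: "subspace V \<Longrightarrow> P.subspace (V \<times> UNIV)"
  by (auto simp: subspace_def P.subspace_def pair_scale_def zero_prod_def)

lemma subspace_fst_image: "P.subspace T \<Longrightarrow> subspace (fst ` T)"
proof -
  interpret p: vector_space_pair "pair_scale scale" scale ..
  show "P.subspace T \<Longrightarrow> subspace (fst ` T)"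
    by (rule p.linear_subspace_image[OF linear_fst_pair])
qed

lemma dim_times_UNIV:
  assumes "subspace V" "finite V"
  shows "P.dim (V \<times> UNIV) = dim V + 1"
  using assms P.dim_eq_iff_card[OF subspace_times_UNIV[OF assms(1)], of "dim V + 1"] card_subspace[OF assms]
  by (simp add: card_cartesian_product)

text \<open>The kernel of \<open>fst\<close> is spanned by (0, 1).\<close>

lemma apex_in_iff:
  assumes "P.subspace T"
  shows "(0, 1) \<in> T \<longleftrightarrow> \<not> inj_on fst T"
proof
  assume "(0, 1) \<in> T"
  moreover have "(0, 0) \<in> T" using P.subspace_0[OF assms] by (simp add: zero_prod_def)
  ultimately show "\<not> inj_on fst T" using inj_onD[of fst T "(0, 1)" "(0, 0)"] by auto
next
  assume "\<not> inj_on fst T"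
  then obtain x a b where x: "(x, a) \<in> T" "(x, b) \<in> T" "a \<noteq> b"
    unfolding inj_on_def by (metis prod.collapse)
  then have "(0, a - b) \<in> T" using P.subspace_diff[OF assms x(1,2)] by simp
  then have "pair_scale scale (inverse (a - b)) (0, a - b) \<in> T" by (rule P.subspace_scale[OF assms])
  then show "(0, 1) \<in> T" using x(3) by (simp add: pair_scale_def)
qed

lemma fst_image_line:
  assumes "T \<in> P.lines (V \<times> UNIV)" "finite V" "(0, 1) \<notin> T"
  shows "fst ` T \<in> lines V"
proof -
  have T: "P.subspace T" "T \<subseteq> V \<times> UNIV" "P.dim T = 2" using assms by (auto simp: P.lines_def)
  have fin: "finite T" using finite_subset[OF T(2)] assms(2) by simp
  have "card (fst ` T) = card T" using assms(3) apex_in_iff[OF T(1)] by (simp add: card_image)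
  then have "dim (fst ` T) = 2"
    using dim_eq_iff_card[OF subspace_fst_image[OF T(1)], of 2] P.dim_eq_iff_card[OF T(1) fin, of 2] T(3) fin
    by simp
  moreover have "fst ` T \<subseteq> V" using T(2) by auto
  ultimately show ?thesis using subspace_fst_image[OF T(1)] by (simp add: lines_def)
qed

text \<open>A subspace that projects onto \<open>U\<close> and avoids \<open>(0, 1)\<close> is the graph of a linear functional on \<open>U\<close>.\<close>

definition graphs :: "'b set \<Rightarrow> ('b \<times> 'a) set set" where
  "graphs U = {W. P.subspace W \<and> fst ` W = U \<and> (0, 1) \<notin> W}"

lemma finite_graphs: "finite U \<Longrightarrow> finite (graphs U)"
  by (rule finite_subset[of _ "Pow (U \<times> UNIV)"]) (force simp: graphs_def)+

lemma dim_graph: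
  assumes "W \<in> graphs U" "finite U"
  shows "P.dim W = dim U"
proof -
  have W: "P.subspace W" "fst ` W = U" "(0, 1) \<notin> W" using assms(1) by (auto simp: graphs_def)
  have "W \<subseteq> U \<times> UNIV" using W(2) by force
  then have fin: "finite W" by (rule finite_subset) (simp add: assms(2))
  have "card U = card W" using W apex_in_iff[OF W(1)] by (metis card_image)
  then show ?thesis
    using P.dim_eq_iff_card[OF W(1) fin, of "dim U"] card_subspace[of U] subspace_fst_image[OF W(1)] W(2) assms(2)
    by simp
qed

text \<open>T is itself the graph of a functional on a two-dimensional subspace of U. Extending it
  to U leaves the values on k - 2 further basis vectors free.\<close>

lemma card_graphs_containing:
  assumes U: "subspace U" "finite U" "dim U = k"
    and T: "P.subspace T" "P.dim T = 2" "fst ` T \<subseteq> U" "(0, 1) \<notin> T"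
  shows "card {W \<in> graphs U. T \<subseteq> W} = CARD('a) ^ (k - 2)"
proof -
  interpret f: vector_space "(*) :: 'a \<Rightarrow> 'a \<Rightarrow> 'a" by unfold_locales (simp_all add: algebra_simps)
  interpret p: vector_space_pair scale "(*) :: 'a \<Rightarrow> 'a \<Rightarrow> 'a" ..
  have "T \<in> P.lines (U \<times> UNIV)" using T by (force simp: P.lines_def)
  then obtain s t where st: "(s, t) \<in> P.indep_pairs T" "T = P.span {s, t}"
    using P.line_eq_span_pair[of T "U \<times> UNIV"] U(2) unfolding P.lines_def
    by (metis (lifting) finite_SigmaI finite_class.finite_UNIV mem_Collect_eq)
  obtain s1 a where s: "s = (s1, a)" by (cases s)
  obtain t1 b where t: "t = (t1, b)" by (cases t)
  have stT: "s \<in> T" "t \<in> T" "s \<noteq> 0" "t \<notin> P.span {s}" using st by (auto simp: P.indep_pairs_def)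
  have injT: "inj_on fst T" using T apex_in_iff by blast
  have s1: "s1 \<noteq> 0"
  proof
    assume "s1 = 0"
    then have "fst s = fst 0" using s by simp
    then show False using injT stT P.subspace_0[OF T(1)] by (metis inj_onD)
  qed
  have t1: "t1 \<notin> span {s1}"
  proof
    assume "t1 \<in> span {s1}"
    then obtain c where "t1 = scale c s1" by (auto simp: span_singleton)
    then have "fst t = fst (pair_scale scale c s)" by (simp add: s t pair_scale_def)
    moreover have "pair_scale scale c s \<in> T" using P.subspace_scale[OF T(1) stT(1)] .
    ultimately have "t = pair_scale scale c s" using injT stT(2) by (metis inj_onD)
    then show False using stT(4) unfolding P.span_singleton by blast
  qed
  have ne: "s1 \<noteq> t1" using t1 by (metis span_base insertI1)
  have st1U: "{s1, t1} \<subseteq> U" using T(3) stT(1,2) s t by force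
  have "independent {t1, s1}" using s1 t1 by (intro independent_insertI independent_empty) auto
  then obtain Bs where Bs: "{s1, t1} \<subseteq> Bs" "Bs \<subseteq> U" "independent Bs" "U \<subseteq> span Bs"
    using maximal_independent_subset_extend[OF st1U] by (metis insert_commute)
  have spB: "span Bs = U" using span_subspace[OF Bs(2,4) U(1)] .
  have finB: "finite Bs" using Bs(2) U(2) finite_subset by blast
  have cB: "card Bs = k" using basis_card_eq_dim[OF Bs(2,4,3)] U(3) by simp
  \<comment> \<open>Admissible values on the basis: prescribed by T at \<open>s1\<close> and
    \<open>t1\<close>, free elsewhere.\<close>
  let ?R = "\<lambda>x. if x = s1 then {a} else if x = t1 then {b} else (UNIV :: 'a set)"
  let ?c = "\<lambda>f. p.construct Bs f"
  let ?\<Phi> = "\<lambda>f. (\<lambda>x. (x, ?c f x)) ` U"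
  have lin: "?c f (x + y) = ?c f x + ?c f y" "?c f (scale c x) = c * ?c f x" "?c f 0 = 0" for f x y c
    using p.linear_construct[OF Bs(3), of f] p.linear_0[OF p.linear_construct[OF Bs(3), of f]]
    by (simp_all add: Vector_Spaces.linear_iff)
  have base: "?c f x = f x" if "x \<in> Bs" for f x using p.construct_basis[OF Bs(3) that] .
  have sub: "P.subspace (?\<Phi> f)" for f
  proof (rule P.subspaceI)
    show "0 \<in> ?\<Phi> f" using subspace_0[OF U(1)] lin(3)[of f] by (force simp: zero_prod_def)
    show "w + z \<in> ?\<Phi> f" if wz: "w \<in> ?\<Phi> f" "z \<in> ?\<Phi> f" for w z
    proof -
      obtain x y where "x \<in> U" "y \<in> U" "w = (x, ?c f x)" "z = (y, ?c f y)" using wz by blast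
      then show ?thesis
        using subspace_add[OF U(1)] by (intro image_eqI[of _ _ "x + y"]) (simp_all add: lin)
    qed
    show "pair_scale scale c w \<in> ?\<Phi> f" if w: "w \<in> ?\<Phi> f" for c w
    proof -
      obtain x where "x \<in> U" "w = (x, ?c f x)" using w by blast
      then show ?thesis using subspace_scale[OF U(1)]
        by (intro image_eqI[of _ _ "scale c x"]) (simp_all add: lin pair_scale_def)
    qed
  qed
  have "bij_betw ?\<Phi> (PiE Bs ?R) {W \<in> graphs U. T \<subseteq> W}"
    unfolding bij_betw_def
  proof (intro conjI)
    show "inj_on ?\<Phi> (PiE Bs ?R)"
    proof (rule inj_onI)
      fix f g assume fg: "f \<in> PiE Bs ?R" "g \<in> PiE Bs ?R" "?\<Phi> f = ?\<Phi> g"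
      have "f x = g x" if x: "x \<in> Bs" for x
      proof -
        have "(x, ?c f x) \<in> ?\<Phi> g" using fg(3) x Bs(2) by blast
        then have "?c f x = ?c g x" by auto
        then show ?thesis using base[OF x] by simp
      qed
      then show "f = g" using fg(1,2) by (intro PiE_ext) auto
    qed
    show "?\<Phi> ` PiE Bs ?R = {W \<in> graphs U. T \<subseteq> W}"
    proof (intro equalityI subsetI)
      fix W assume "W \<in> ?\<Phi> ` PiE Bs ?R"
      then obtain f where f: "f \<in> PiE Bs ?R" "W = ?\<Phi> f" by blast
      have "f s1 \<in> ?R s1" "f t1 \<in> ?R t1" using PiE_mem[OF f(1)] Bs(1) by blast+
      then have "?c f s1 = a" "?c f t1 = b" using base[of s1 f] base[of t1 f] Bs(1) ne by auto
      then have "{s, t} \<subseteq> W" using st1U unfolding f(2) s t by force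
      then have "T \<subseteq> W" unfolding st(2) using sub f(2) by (intro P.span_minimal) auto
      moreover have "W \<in> graphs U" using sub[of f] lin(3)[of f] unfolding f(2) graphs_def
        by (auto simp: image_image)
      ultimately show "W \<in> {W \<in> graphs U. T \<subseteq> W}" by simp
    next
      fix W assume "W \<in> {W \<in> graphs U. T \<subseteq> W}"
      then have W: "P.subspace W" "fst ` W = U" "inj_on fst W" "T \<subseteq> W"
        using apex_in_iff by (auto simp: graphs_def)
      have "\<exists>a. (x, a) \<in> W" if "x \<in> U" for x using W(2) that by force
      then obtain h where h: "\<And>x. x \<in> U \<Longrightarrow> (x, h x) \<in> W" by metis
      have uniq: "a' = h x" if "(x, a') \<in> W" "x \<in> U" for x a'
        using inj_onD[OF W(3) _ that(1) h[OF that(2)]] by simp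
      let ?f = "restrict h Bs"
      have "h s1 = a" "h t1 = b" using uniq[of s1 a] uniq[of t1 b] stT W(4) s t st1U by auto
      then have "?f \<in> PiE Bs ?R" by (auto simp: PiE_iff)
      moreover have "?\<Phi> ?f = W"
      proof -
        have "span Bs \<subseteq> {x. (x, ?c ?f x) \<in> W}"
        proof (rule span_minimal)
          show "Bs \<subseteq> {x. (x, ?c ?f x) \<in> W}" using base h Bs(2) by auto
          show "subspace {x. (x, ?c ?f x) \<in> W}"
          proof (rule subspaceI)
            show "0 \<in> {x. (x, ?c ?f x) \<in> W}"
              using P.subspace_0[OF W(1)] by (simp add: lin zero_prod_def)
            show "x + y \<in> {x. (x, ?c ?f x) \<in> W}"
              if "x \<in> {x. (x, ?c ?f x) \<in> W}" "y \<in> {x. (x, ?c ?f x) \<in> W}" for x y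
              using P.subspace_add[OF W(1), of "(x, ?c ?f x)" "(y, ?c ?f y)"] that by (simp add: lin)
            show "scale c x \<in> {x. (x, ?c ?f x) \<in> W}" if "x \<in> {x. (x, ?c ?f x) \<in> W}" for c x
              using P.subspace_scale[OF W(1), of "(x, ?c ?f x)" c] that by (simp add: lin pair_scale_def)
          qed
        qed
        then have in_W: "(x, ?c ?f x) \<in> W" if "x \<in> U" for x using that spB by blast
        show ?thesis
        proof (intro equalityI subsetI)
          fix w assume w: "w \<in> W"
          then have "fst w \<in> U" using W(2) by auto
          from inj_onD[OF W(3) _ w in_W[OF this]]
          have "w = (fst w, ?c ?f (fst w))" by (simp only: fst_conv)
          then show "w \<in> ?\<Phi> ?f" using \<open>fst w \<in> U\<close> by (rule image_eqI)
        next
          fix w assume "w \<in> ?\<Phi> ?f"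
          then show "w \<in> W" using in_W by blast
        qed
      qed
      ultimately show "W \<in> ?\<Phi> ` PiE Bs ?R" by blast
    qed
  qed
  then have "card {W \<in> graphs U. T \<subseteq> W} = card (PiE Bs ?R)" by (simp add: bij_betw_same_card)
  also have "\<dots> = (\<Prod>x\<in>Bs. card (?R x))" using finB by (rule card_PiE)
  also have "\<dots> = (\<Prod>x\<in>Bs - {s1, t1}. card (?R x)) * (\<Prod>x\<in>{s1, t1}. card (?R x))"
    by (rule prod.subset_diff[OF Bs(1) finB])
  also have "\<dots> = (\<Prod>x\<in>Bs - {s1, t1}. CARD('a))" using ne by simp
  also have "\<dots> = CARD('a) ^ (k - 2)"
    using ne cB Bs(1) finB by (simp add: card_Diff_subset numeral_2_eq_2)
  finally show ?thesis .
qed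

lemma coverage_sum_mset: "coverage (\<Sum>U\<in>#B. f U) T = (\<Sum>U\<in>#B. coverage (f U) T)"
  by (induction B) auto

text \<open>Every block is replaced by all graphs over it. Graphs avoid the apex, and a line that
  avoids it lies in q^(k-2) graphs over each block that contains its projection.\<close>

lemma lift_coverage:
  assumes V: "subspace V" "finite V" and B: "blocks_in k V B"
  obtains B' where "P.blocks_in k (V \<times> UNIV) B'"
    "\<And>T. T \<in> P.lines (V \<times> UNIV) \<Longrightarrow> (0, 1) \<in> T \<Longrightarrow> coverage B' T = 0"
    "\<And>T. T \<in> P.lines (V \<times> UNIV) \<Longrightarrow> (0, 1) \<notin> T \<Longrightarrow>
      coverage B' T = CARD('a) ^ (k - 2) * coverage B (fst ` T)"
proof
  let ?B = "\<Sum>U\<in>#B. mset_set (graphs U)"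
  have U: "subspace U \<and> U \<subseteq> V \<and> dim U = k \<and> finite U" if "U \<in># B" for U
    using that B V(2) by (auto simp: blocks_in_def intro: finite_subset)
  have mem: "\<exists>U. U \<in># B \<and> W \<in> graphs U" if "W \<in># ?B" for W
    using that U finite_graphs by (auto simp: in_Union_mset_iff)
  show "P.blocks_in k (V \<times> UNIV) ?B"
    unfolding P.blocks_in_def
  proof (intro ballI)
    fix W assume "W \<in># ?B"
    then obtain U where UW: "U \<in># B" "W \<in> graphs U" using mem by blast
    have "W \<subseteq> V \<times> UNIV" using UW U by (force simp: graphs_def)
    then show "P.subspace W \<and> W \<subseteq> V \<times> UNIV \<and> P.dim W = k"
      using UW U dim_graph[OF UW(2)] by (auto simp: graphs_def)
  qed
  fix T assume T: "T \<in> P.lines (V \<times> UNIV)"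
  show "coverage ?B T = 0" if "(0, 1) \<in> T"
  proof (rule coverage_eq_0)
    fix W assume "W \<in># ?B"
    then obtain U where "W \<in> graphs U" using mem by blast
    then show "\<not> T \<subseteq> W" using that by (auto simp: graphs_def)
  qed
  show "coverage ?B T = CARD('a) ^ (k - 2) * coverage B (fst ` T)" if T1: "(0, 1) \<notin> T"
  proof -
    have "coverage (mset_set (graphs U)) T = (if fst ` T \<subseteq> U then CARD('a) ^ (k - 2) else 0)"
      if "U \<in># B" for U
    proof (cases "fst ` T \<subseteq> U")
      case True
      then show ?thesis
        using card_graphs_containing[of U k T] U[OF that] T T1 finite_graphs
        by (simp add: coverage_mset_set P.lines_def)
    next
      case False
      have "\<not> T \<subseteq> W" if "W \<in> graphs U" for W using that False by (auto simp: graphs_def)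
      then have "coverage (mset_set (graphs U)) T = 0"
        using U[OF that] finite_graphs[of U] by (intro coverage_eq_0) simp
      then show ?thesis using False by simp
    qed
    then have "coverage ?B T = (\<Sum>U\<in>#B. if fst ` T \<subseteq> U then CARD('a) ^ (k - 2) else 0)"
      unfolding coverage_sum_mset by (intro arg_cong[of _ _ sum_mset] image_mset_cong)
    also have "\<dots> = CARD('a) ^ (k - 2) * coverage B (fst ` T)"
      unfolding coverage_def by (induction B) auto
    finally show ?thesis .
  qed
qed

text \<open>A line through the apex is spanned by the apex and one more vector, whose projection x
  decides in which cylinders the line lies.\<close>

lemma apex_line_point:
  assumes V: "subspace V" "finite V" and T: "T \<in> P.lines (V \<times> UNIV)" "(0, 1) \<in> T"
  obtains x where "x \<in> V" "x \<noteq> 0" "\<And>G. subspace G \<Longrightarrow> T \<subseteq> G \<times> UNIV \<longleftrightarrow> x \<in> G"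
proof -
  have Ts: "P.subspace T" "T \<subseteq> V \<times> UNIV" "P.dim T = 2" using T by (auto simp: P.lines_def)
  have finT: "finite T" using finite_subset[OF Ts(2)] V(2) by simp
  have cs: "card (P.span {(0, 1)}) = CARD('a)"
    using P.card_span_singleton[of "(0, 1)"] by (simp add: zero_prod_def)
  have cT: "card T = CARD('a) ^ 2" using P.dim_eq_iff_card[OF Ts(1) finT, of 2] Ts(3) by simp
  then have "card (P.span {(0, 1)}) < card T"
    using cs card_scalars_ge_2 by (simp add: power2_eq_square)
  then have "\<not> T \<subseteq> P.span {(0, 1)}" using card_mono[of "P.span {(0, 1)}" T] by auto
  then obtain y where y: "y \<in> T" "y \<notin> P.span {(0, 1)}" by blast
  have T_eq: "P.span {(0, 1), y} = T"
  proof (rule card_subset_eq[OF finT])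
    show "P.span {(0, 1), y} \<subseteq> T" using T y Ts by (intro P.span_minimal) auto
    show "card (P.span {(0, 1), y}) = card T"
      using P.card_span_pair[of "(0, 1)" y] y(2) cT by (simp add: zero_prod_def)
  qed
  show ?thesis
  proof (rule that[of "fst y"])
    show "fst y \<in> V" using y Ts(2) by auto
    show "fst y \<noteq> 0"
    proof
      assume "fst y = 0"
      then have "y = pair_scale scale (snd y) (0, 1)" by (simp add: pair_scale_def prod_eq_iff)
      then show False using y(2) unfolding P.span_singleton by blast
    qed
    show "T \<subseteq> G \<times> UNIV \<longleftrightarrow> fst y \<in> G" if "subspace G" for G
    proof
      assume "fst y \<in> G"
      moreover have "P.subspace (G \<times> UNIV)" "0 \<in> G"
        using that subspace_times_UNIV subspace_0 by auto
      ultimately show "T \<subseteq> G \<times> UNIV"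
        unfolding T_eq[symmetric] by (intro P.span_minimal) (auto simp: mem_Times_iff)
    qed (use y(1) in auto)
  qed
qed

lemma apex_line_in_cylinder:
  assumes "subspace V" "finite V" "spread V \<G>" "T \<in> P.lines (V \<times> UNIV)" "(0, 1) \<in> T"
  shows "\<exists>!G. G \<in> \<G> \<and> T \<subseteq> G \<times> UNIV"
proof -
  obtain x where x: "x \<in> V" "x \<noteq> 0" "\<And>G. subspace G \<Longrightarrow> T \<subseteq> G \<times> UNIV \<longleftrightarrow> x \<in> G"
    using apex_line_point[OF assms(1,2,4,5)] by metis
  have "G \<in> \<G> \<and> T \<subseteq> G \<times> UNIV \<longleftrightarrow> G \<in> \<G> \<and> x \<in> G" for G
    using assms(3) x(3)[of G] by (auto simp: spread_def)
  then show ?thesis using assms(3) x(1,2) by (simp add: spread_def)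
qed

lemma cylinder_line_unique:
  assumes V: "subspace V" "finite V" and spread: "spread V \<G>"
    and T: "T \<in> P.lines (V \<times> UNIV)" "G \<in> \<G>" "H \<in> \<G>" "T \<subseteq> G \<times> UNIV" "T \<subseteq> H \<times> UNIV"
  shows "G = H"
proof (cases "(0, 1) \<in> T")
  case True
  then show ?thesis using apex_line_in_cylinder[OF V spread T(1)] T(2-5) by blast
next
  case False
  have "fst ` T \<subseteq> G" "fst ` T \<subseteq> H" using T(4,5) by auto
  then show ?thesis
    using spread_line_unique[OF spread V(2) fst_image_line[OF T(1) V(2) False] T(2,3)] by blast
qed

text \<open>No lifted block covers a line through the apex, so each such line must lie in a group;
  the spread guarantees this.\<close>

lemma lift_gdd:
  assumes gdd: "gdd V \<G> k l B" and spread: "spread V \<G>"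
  shows "\<exists>B'. P.gdd (V \<times> UNIV) ((\<lambda>G. G \<times> UNIV) ` \<G>) k (CARD('a) ^ (k - 2) * l) B'"
proof -
  have V: "subspace V" "finite V" "blocks_in k V B" using gdd by (auto simp: gdd_def)
  obtain B' where B': "P.blocks_in k (V \<times> UNIV) B'"
    "\<And>T. T \<in> P.lines (V \<times> UNIV) \<Longrightarrow> (0, 1) \<in> T \<Longrightarrow> coverage B' T = 0"
    "\<And>T. T \<in> P.lines (V \<times> UNIV) \<Longrightarrow> (0, 1) \<notin> T \<Longrightarrow>
      coverage B' T = CARD('a) ^ (k - 2) * coverage B (fst ` T)"
    using lift_coverage[OF V] by blast
  have sub: "T \<subseteq> G \<times> UNIV \<longleftrightarrow> fst ` T \<subseteq> G" for T :: "('b \<times> 'a) set" and G by auto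
  show ?thesis
  proof (intro exI[of _ B'], unfold P.gdd_def, intro conjI)
    show "\<forall>T\<in>P.lines (V \<times> UNIV). \<forall>G\<in>(\<lambda>G. G \<times> UNIV) ` \<G>. \<forall>H\<in>(\<lambda>G. G \<times> UNIV) ` \<G>.
        T \<subseteq> G \<longrightarrow> T \<subseteq> H \<longrightarrow> G = H"
      using cylinder_line_unique[OF V(1,2) spread] by blast
    show "\<forall>T\<in>P.lines (V \<times> UNIV). coverage B' T =
        (if \<exists>G\<in>(\<lambda>G. G \<times> UNIV) ` \<G>. T \<subseteq> G then 0 else CARD('a) ^ (k - 2) * l)"
    proof
      fix T assume T: "T \<in> P.lines (V \<times> UNIV)"
      show "coverage B' T = (if \<exists>G\<in>(\<lambda>G. G \<times> UNIV) ` \<G>. T \<subseteq> G then 0 else CARD('a) ^ (k - 2) * l)"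
      proof (cases "(0, 1) \<in> T")
        case True
        then have "\<exists>G\<in>\<G>. T \<subseteq> G \<times> UNIV" using apex_line_in_cylinder[OF V(1,2) spread T] by blast
        then show ?thesis using B'(2)[OF T True] by auto
      next
        case False
        then show ?thesis
          using B'(3)[OF T False] fst_image_line[OF T V(2) False] gdd by (auto simp: gdd_def sub)
      qed
    qed
  qed (use V B'(1) gdd subspace_times_UNIV in \<open>auto simp: gdd_def\<close>)
qed

end

section \<open>Finite extensions of finite fields\<close>

text \<open>Translation by 1 permutes the field, so adding 1 to every element does not change the
  sum of all elements.\<close>

lemma of_nat_card_eq_0: "of_nat CARD('a::{field,finite}) = (0 :: 'a)"
proof -
  have "(\<Sum>x\<in>UNIV. x + 1 :: 'a) = (\<Sum>x\<in>UNIV. x)"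
    by (rule sum.reindex_bij_witness[of _ "\<lambda>x. x - 1" "\<lambda>x. x + 1"]) auto
  then show ?thesis by (simp add: sum.distrib)
qed

text \<open>
  \<open>x\<^sup>q - x\<close> is the product of the \<open>x - r\<close> over the scalars \<open>r\<close>, hence invariant under translation by
  scalars; so \<open>(x + y)\<^sup>q - x\<^sup>q - y\<^sup>q\<close>, of degree less than \<open>q\<close> in \<open>x\<close>, vanishes at all \<open>q\<close> scalars.
\<close>

lemma frobenius_add_alg_closure:
  fixes x y :: "'a::{field,finite} alg_closure"
  shows "(x + y) ^ CARD('a) = x ^ CARD('a) + y ^ CARD('a)"
proof -
  define n where "n = CARD('a)"
  define R :: "'a alg_closure set" where "R = range to_ac"
  have cR: "card R = n" by (simp add: R_def n_def card_image inj_to_ac)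
  have finR: "finite R" by (simp add: R_def)
  have Rn: "r ^ n = r" if "r \<in> R" for r
    using that by (auto simp: R_def n_def finite_field_power_card simp flip: to_ac_power)
  have n: "1 < n"
    using card_mono[of "UNIV :: 'a set" "{0, 1}"] by (simp add: n_def)
  have "(\<Prod>r\<in>R. [:-r, 1:]) = monom 1 n - monom 1 1"
  proof (rule poly_eqI_degree_lead_coeff[where A = R and n = n])
    have deg: "degree (\<Prod>r\<in>R. [:-r, 1:]) = n"
      using cR by (subst degree_prod_sum_eq) simp_all
    have "lead_coeff (\<Prod>r\<in>R. [:-r, 1:]) = 1" by (simp add: lead_coeff_prod)
    then show "coeff (\<Prod>r\<in>R. [:-r, 1:]) n = coeff (monom 1 n - monom 1 1) n"
      using deg n by simp
    show "degree (\<Prod>r\<in>R. [:-r, 1:]) \<le> n" using deg by simp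
    show "degree (monom 1 n - monom 1 1 :: 'a alg_closure poly) \<le> n"
      using n by (intro degree_diff_le) (auto simp: degree_monom_eq)
    fix z assume "z \<in> R"
    then show "poly (\<Prod>r\<in>R. [:-r, 1:]) z = poly (monom 1 n - monom 1 1) z"
      using Rn[of z] finR by (auto simp: poly_prod poly_monom prod_zero_iff)
  qed (simp add: cR)
  then have L: "(\<Prod>r\<in>R. z - r) = z ^ n - z" for z
    by (drule_tac arg_cong[of _ _ "\<lambda>p. poly p z"]) (simp add: poly_prod poly_monom)
  have shift: "(r + y) ^ n = r + y ^ n" if r: "r \<in> R" for r
  proof -
    obtain a where a: "r = to_ac a" using r by (auto simp: R_def)
    have "(\<Prod>s\<in>R. r + y - s) = (\<Prod>s\<in>R. y - s)"
    proof (rule prod.reindex_bij_witness[of _ "\<lambda>s. s + r" "\<lambda>s. s - r"])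
      fix s assume "s \<in> R"
      then obtain b where "s = to_ac b" by (auto simp: R_def)
      then show "s - r \<in> R" "s + r \<in> R" unfolding R_def a by (metis rangeI to_ac_diff, metis rangeI to_ac_add)
    qed auto
    then show ?thesis by (simp add: L algebra_simps)
  qed
  have "[:y, 1:] ^ n = monom 1 n + [:y ^ n:]"
  proof (rule poly_eqI_degree_lead_coeff[where A = R and n = n])
    have "coeff ([:y, 1:] ^ n) n = 1"
      using lead_coeff_power[of "[:y, 1:]" n] by (simp add: degree_linear_power)
    then show "coeff ([:y, 1:] ^ n) n = coeff (monom 1 n + [:y ^ n:]) n"
      using n by (cases n) simp_all
    show "degree ([:y, 1:] ^ n) \<le> n" by (simp add: degree_linear_power)
    show "degree (monom 1 n + [:y ^ n:]) \<le> n"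
      by (intro degree_add_le) (auto simp: degree_monom_eq)
    fix z assume "z \<in> R"
    then show "poly ([:y, 1:] ^ n) z = poly (monom 1 n + [:y ^ n:]) z"
      using shift[of z] Rn[of z] by (simp add: poly_power poly_monom add.commute)
  qed (simp add: cR)
  then have "poly ([:y, 1:] ^ n) x = poly (monom 1 n + [:y ^ n:]) x" by simp
  then show ?thesis by (simp add: poly_power poly_monom n_def add.commute)
qed

lemma frobenius_power_add:
  fixes x y :: "'a::{field,finite} alg_closure"
  shows "(x + y) ^ (CARD('a) ^ l) = x ^ (CARD('a) ^ l) + y ^ (CARD('a) ^ l)"
  by (induction l arbitrary: x y) (simp_all add: power_mult frobenius_add_alg_closure)

text \<open>x^N - x splits into linear factors over the closure, and its derivative is the constant
  -1, so its N roots are distinct.\<close>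

lemma card_fixed_frobenius_power:
  assumes "0 < l"
  shows "card {x :: 'a::{field,finite} alg_closure. x ^ (CARD('a) ^ l) = x} = CARD('a) ^ l"
proof -
  define N where "N = CARD('a) ^ l"
  have "1 < CARD('a)" using card_mono[of "UNIV :: 'a set" "{0, 1}"] by simp
  then have N: "1 < N" unfolding N_def using assms by (rule one_less_power)
  let ?p = "monom 1 N - monom 1 1 :: 'a alg_closure poly"
  have c1: "coeff ?p N = 1" using N by simp
  then have p: "?p \<noteq> 0" by (metis coeff_0 zero_neq_one)
  have "degree ?p \<le> N" using N by (intro degree_diff_le) (auto simp: degree_monom_eq)
  then have deg: "degree ?p = N" using c1 by (metis le_antisym le_degree zero_neq_one)
  obtain A where A: "size A = N" "?p = (\<Prod>x\<in>#A. [:-x, 1:])"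
    using alg_closed_imp_factorization[OF p] deg c1 by auto
  have "of_nat CARD('a) = (0 :: 'a alg_closure)"
    using of_nat_card_eq_0[where 'a = 'a] by (metis to_ac_0 to_ac_of_nat)
  then have "of_nat N = (0 :: 'a alg_closure)" using assms by (simp add: N_def power_0_left)
  then have pd: "poly (pderiv ?p) z = -1" for z
    by (simp add: pderiv_diff pderiv_monom poly_monom)
  have c: "count A x \<le> 1" for x
  proof (rule ccontr)
    assume "\<not> count A x \<le> 1"
    then have "{#x, x#} \<subseteq># A" by (simp add: subseteq_mset_def)
    then obtain A' where "A = {#x, x#} + A'" using subset_mset.le_iff_add by blast
    then have "?p = [:-x, 1:] * ([:-x, 1:] * (\<Prod>x\<in>#A'. [:-x, 1:]))" using A(2) by simp
    then obtain r where "?p = [:-x, 1:] * ([:-x, 1:] * r)" by blast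
    then have "poly (pderiv ?p) x = 0" by (simp only: pderiv_mult) simp
    then show False using pd by simp
  qed
  have "{x. poly ?p x = 0} = set_mset A" unfolding A(2) by (auto simp: poly_prod_mset prod_mset_zero_iff image_iff)
  then have "{x :: 'a alg_closure. x ^ N = x} = set_mset A" by (simp add: poly_monom)
  moreover have "A = mset_set (set_mset A)"
  proof (rule multiset_eqI)
    fix x
    have "x \<in># A \<Longrightarrow> count A x = 1" using c[of x] by (intro le_antisym) simp_all
    then show "count A x = count (mset_set (set_mset A)) x"
      by (cases "x \<in># A") (simp_all add: not_in_iff)
  qed
  then have "card (set_mset A) = size A" by (metis size_mset_set)
  ultimately show ?thesis using A(1) by (simp add: N_def)
qed

text \<open>The type \<open>'l\<close> only serves to encode the degree \<open>CARD('l)\<close> of the extension.\<close>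

typedef (overloaded) ('a, 'l) gf =
  "{x :: 'a::{field,finite} alg_closure. x ^ (CARD('a) ^ CARD('l::finite)) = x}"
  by (rule exI[of _ 0]) (simp add: power_0_left)

setup_lifting type_definition_gf

instantiation gf :: ("{field,finite}", finite) field
begin

lift_definition zero_gf :: "('a, 'b) gf" is 0 by (simp add: power_0_left)
lift_definition one_gf :: "('a, 'b) gf" is 1 by simp
lift_definition plus_gf :: "('a, 'b) gf \<Rightarrow> ('a, 'b) gf \<Rightarrow> ('a, 'b) gf" is "(+)"
  by (simp add: frobenius_power_add)
lift_definition times_gf :: "('a, 'b) gf \<Rightarrow> ('a, 'b) gf \<Rightarrow> ('a, 'b) gf" is "(*)"
  by (simp add: power_mult_distrib)
lift_definition uminus_gf :: "('a, 'b) gf \<Rightarrow> ('a, 'b) gf" is uminus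
  using frobenius_power_add by (metis add.left_inverse add_eq_0_iff power_0_left power_eq_0_iff zero_less_card_finite)
lift_definition minus_gf :: "('a, 'b) gf \<Rightarrow> ('a, 'b) gf \<Rightarrow> ('a, 'b) gf" is "(-)"
  by (metis add_diff_cancel_right' diff_add_cancel frobenius_power_add)
lift_definition inverse_gf :: "('a, 'b) gf \<Rightarrow> ('a, 'b) gf" is inverse
  by (simp add: power_inverse)
lift_definition divide_gf :: "('a, 'b) gf \<Rightarrow> ('a, 'b) gf \<Rightarrow> ('a, 'b) gf" is "(/)"
  by (simp add: power_divide)

instance
  by (intro_classes; transfer) (simp_all add: algebra_simps divide_inverse)

end

lemma Rep_gf_power: "Rep_gf (x ^ n) = Rep_gf x ^ n"
  by (induction n) (simp_all add: one_gf.rep_eq times_gf.rep_eq)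

lemma bij_betw_Rep_gf:
  "bij_betw (Rep_gf :: ('a::{field,finite}, 'l::finite) gf \<Rightarrow> _) UNIV {x. x ^ (CARD('a) ^ CARD('l)) = x}"
  by (simp add: bij_betw_def inj_on_def Rep_gf_inject type_definition.Rep_range[OF type_definition_gf])

instance gf :: ("{field,finite}", finite) finite
proof
  have "card {x :: 'a alg_closure. x ^ (CARD('a) ^ CARD('b)) = x} > 0"
    by (simp add: card_fixed_frobenius_power)
  then show "finite (UNIV :: ('a, 'b) gf set)"
    using bij_betw_finite[OF bij_betw_Rep_gf] card_gt_0_iff by blast
qed

lemma card_gf: "CARD(('a::{field,finite}, 'l::finite) gf) = CARD('a) ^ CARD('l)"
  using bij_betw_same_card[OF bij_betw_Rep_gf[where 'a = 'a and 'l = 'l]]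
  by (simp add: card_fixed_frobenius_power)

text \<open>An element fixed by the power q^d is fixed by all iterates of that power. As d divides
  the degree, the subfield of order q^d of the closure lies in \<open>gf\<close>.\<close>

lemma card_subfield_gf:
  assumes "0 < d" "d dvd CARD('l)"
  shows "card {x :: ('a::{field,finite}, 'l::finite) gf. x ^ (CARD('a) ^ d) = x} = CARD('a) ^ d"
proof -
  obtain e where e: "CARD('l) = d * e" using assms by (auto elim: dvdE)
  have fixed: "x ^ (CARD('a) ^ CARD('l)) = x" if "x ^ (CARD('a) ^ d) = x" for x :: "'a alg_closure"
    unfolding e power_mult by (induction e) (simp_all add: that power_mult)
  have "Rep_gf ` {x :: ('a, 'l) gf. x ^ (CARD('a) ^ d) = x} = {x. x ^ (CARD('a) ^ d) = x}"
  proof (intro equalityI subsetI)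
    fix y :: "'a alg_closure" assume y: "y \<in> {x. x ^ (CARD('a) ^ d) = x}"
    then have "Rep_gf (Abs_gf y :: ('a, 'l) gf) = y" using fixed by (simp add: Abs_gf_inverse)
    then show "y \<in> Rep_gf ` {x :: ('a, 'l) gf. x ^ (CARD('a) ^ d) = x}"
      using y by (intro image_eqI[of _ _ "Abs_gf y"]) (auto simp flip: Rep_gf_inject simp: Rep_gf_power)
  qed (auto simp flip: Rep_gf_power)
  then have "card {x :: ('a, 'l) gf. x ^ (CARD('a) ^ d) = x} = card {x :: 'a alg_closure. x ^ (CARD('a) ^ d) = x}"
    by (metis (no_types, lifting) Rep_gf_inject card_image inj_onI)
  then show ?thesis using assms by (simp add: card_fixed_frobenius_power)
qed

lift_definition gf_of :: "'a::{field,finite} \<Rightarrow> ('a, 'l::finite) gf" is to_ac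
proof -
  fix a :: 'a
  have "a ^ (CARD('a) ^ l) = a" for l
    by (induction l) (simp_all add: power_mult finite_field_power_card)
  then show "to_ac a ^ (CARD('a) ^ CARD('l)) = to_ac a" by (simp flip: to_ac_power)
qed

lemma gf_of_simps:
  "gf_of (x + y) = gf_of x + gf_of y" "gf_of (x * y) = gf_of x * gf_of y" "gf_of 1 = 1"
  by (transfer; simp)+

lemma frobenius_add_gf:
  fixes x y :: "('a::{field,finite}, 'l::finite) gf"
  shows "(x + y) ^ CARD('a) = x ^ CARD('a) + y ^ CARD('a)"
  by (simp add: Rep_gf_power plus_gf.rep_eq frobenius_add_alg_closure flip: Rep_gf_inject)

section \<open>Group divisible designs from field extensions\<close>

context frobenius_extension
begin

text \<open>The groups are the one-dimensional subspaces over the large field, a Desarguesian spread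
  over the small one. The scattered family is taken \<mu> times.\<close>

theorem ex_gdd:
  assumes V: "E.subspace V" "finite V" "V \<noteq> {0}"
    and D: "F_closed D" "card D = CARD('a) ^ d" and C: "stabilizing_group C D"
    and l: "l * (card C * (\<Prod>i<n. CARD('a) ^ (d + n) - CARD('a) ^ (d + i))) =
      \<mu> * ((CARD('a) ^ (d + n) - 1) * (CARD('a) ^ (d + n) - CARD('a)) *
      (\<Prod>i<n. card V - CARD('e) ^ (2 + i)))"
  shows "\<exists>B \<G>. F.gdd V \<G> (d + n) l B \<and> F.spread V \<G> \<and> \<G> \<noteq> {} \<and> (\<forall>G\<in>\<G>. card G = CARD('e))"
proof -
  let ?s = "card C * (\<Prod>i<n. CARD('a) ^ (d + n) - CARD('a) ^ (d + i))"
  obtain B where B: "\<And>U. U \<in># B \<Longrightarrow> scattered U \<and> U \<subseteq> V \<and> card U = CARD('a) ^ (d + n)"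
    and deg: "\<And>T x. T \<in> F.lines V \<Longrightarrow> x \<in> V \<Longrightarrow> T \<subseteq> E.span {x} \<Longrightarrow> coverage B T = 0"
    and nondeg: "\<And>T. T \<in> F.lines V \<Longrightarrow> \<not> (\<exists>x. x \<in> V \<and> T \<subseteq> E.span {x}) \<Longrightarrow>
      coverage B T * ?s = (CARD('a) ^ (d + n) - 1) * (CARD('a) ^ (d + n) - CARD('a)) *
      (\<Prod>i<n. card V - CARD('e) ^ (2 + i))"
    using ex_scattered_family[OF V(1,2) D C, of n] by metis
  have s: "?s \<noteq> 0"
  proof -
    have "finite C" "C \<noteq> {}" using C by (auto simp: stabilizing_group_def)
    then show ?thesis using F.card_scalars_ge_2 by (auto simp: power_strict_increasing not_le)
  qed
  let ?\<G> = "(\<lambda>x. E.span {x}) ` (V - {0})"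
  have span_V: "E.span {x} \<subseteq> V" if "x \<in> V" for x using that V by (intro E.span_minimal) auto
  have spread: "F.spread V ?\<G>"
    unfolding F.spread_def
  proof (intro conjI ballI impI)
    fix G assume "G \<in> ?\<G>"
    then show "F.subspace G" "G \<subseteq> V" using span_V E_subspace_imp_F_subspace by auto
  next
    fix x assume x: "x \<in> V" "x \<noteq> 0"
    show "\<exists>!G. G \<in> ?\<G> \<and> x \<in> G"
    proof (rule ex1I[of _ "E.span {x}"])
      show "E.span {x} \<in> ?\<G> \<and> x \<in> E.span {x}" using x by (auto simp: E.span_base)
      fix G assume G: "G \<in> ?\<G> \<and> x \<in> G"
      then obtain y where y: "y \<in> V" "y \<noteq> 0" "G = E.span {y}" by blast
      then obtain c where c: "x = scale c y" using G by (auto simp: E.span_singleton)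
      then have "c \<noteq> 0" using x(2) by auto
      then show "G = E.span {x}" using y(3) c E_span_scale_pair(1)[of c c y] by simp
    qed
  qed
  have cov: "coverage (repeat_mset \<mu> B) T = (if \<exists>G\<in>?\<G>. T \<subseteq> G then 0 else l)"
    if T: "T \<in> F.lines V" for T
  proof (cases "\<exists>G\<in>?\<G>. T \<subseteq> G")
    case True
    then obtain x where "x \<in> V" "T \<subseteq> E.span {x}" by blast
    then have "coverage B T = 0" by (rule deg[OF T])
    then show ?thesis using True by simp
  next
    case False
    \<comment> \<open>The span of 0 is not among the groups, but it contains no line.\<close>
    have "\<not> T \<subseteq> E.span {x}" if "x \<in> V" for x
    proof (cases "x = 0")
      case True
      obtain y where "y \<in> T" "y \<noteq> 0" using F.line_nonzero_point[OF T V(2)] by blast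
      then show ?thesis using True by auto
    qed (use False that in blast)
    then have eq: "coverage B T * ?s = (CARD('a) ^ (d + n) - 1) * (CARD('a) ^ (d + n) - CARD('a)) *
      (\<Prod>i<n. card V - CARD('e) ^ (2 + i))" using nondeg[OF T] by blast
    have "\<mu> * coverage B T * ?s = l * ?s" unfolding l mult.assoc[of \<mu>] eq ..
    then have "\<mu> * coverage B T = l" using s by (metis mult_right_cancel)
    then show ?thesis using False by simp
  qed
  have blocks: "F.blocks_in (d + n) V B"
    unfolding F.blocks_in_def
  proof (intro ballI conjI)
    fix U assume U: "U \<in># B"
    then show "U \<subseteq> V" "F.subspace U" using B by (auto simp: scattered_def)
    moreover have "finite U" using \<open>U \<subseteq> V\<close> V(2) by (rule finite_subset)
    ultimately show "F.dim U = d + n" using B[OF U] F.dim_eq_iff_card by blast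
  qed
  have "F.gdd V ?\<G> (d + n) l (repeat_mset \<mu> B)"
    unfolding F.gdd_def
    using V spread F.spread_line_unique[OF spread V(2)] cov F.blocks_in_repeat[OF blocks]
      E_subspace_imp_F_subspace by (auto simp: F.spread_def)
  moreover have "?\<G> \<noteq> {}" using V E.subspace_0 by auto
  moreover have "\<forall>G\<in>?\<G>. card G = CARD('e)" using E.card_span_singleton by auto
  ultimately show ?thesis using spread by blast
qed

end

context cylinder
begin

text \<open>
  Over each group, every plane gets weight \<open>27\<close> and those through the apex \<open>(0, 1)\<close> get \<open>15\<close> more.
  Together with the lift of the complete design plus \<open>8 B\<close>, a line is covered \<open>(27 + 15) * 3\<close> times if
  it contains the apex, otherwise \<open>2 * 15 + 27 * 3 + 15\<close> times if it lies over a group and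
  \<open>2 * (15 + 8 * 6)\<close> times if it does not; all three numbers are \<open>126\<close>.
\<close>

lemma ex_2_7_3_126_design:
  assumes two: "CARD('a) = 2" and V: "subspace V" "finite V" "dim V = 6"
    and spread: "spread V \<G>" and G: "\<And>G. G \<in> \<G> \<Longrightarrow> dim G = 3" "\<G> \<noteq> {}" and gdd: "gdd V \<G> 3 6 B"
  shows "\<exists>B'. P.subspace_2_design 7 3 126 (V \<times> UNIV) B' \<and> \<not> simple_blocks B'"
proof -
  let ?V = "V \<times> (UNIV :: 'a set)" and ?H = "\<lambda>G. G \<times> (UNIV :: 'a set)"
  let ?all = "mset_set {U. subspace U \<and> U \<subseteq> V \<and> dim U = 3}"
  have all: "subspace_2_design 6 3 15 V ?all"
    using complete_design[OF V, of 15 1] by (simp add: two)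
  have blocks: "blocks_in 3 V (?all + repeat_mset 8 B)"
    using all gdd by (simp add: subspace_2_design_iff gdd_def blocks_in_repeat)
  obtain B1 where B1: "P.blocks_in 3 ?V B1"
    "\<And>T. T \<in> P.lines ?V \<Longrightarrow> (0, 1) \<in> T \<Longrightarrow> coverage B1 T = 0"
    "\<And>T. T \<in> P.lines ?V \<Longrightarrow> (0, 1) \<notin> T \<Longrightarrow>
      coverage B1 T = CARD('a) ^ (3 - 2) * coverage (?all + repeat_mset 8 B) (fst ` T)"
    using lift_coverage[OF V(1,2) blocks] by blast
  have sub: "T \<subseteq> ?H G \<longleftrightarrow> fst ` T \<subseteq> G" for T :: "('b \<times> 'a) set" and G by auto
  have cov1: "coverage B1 T = (if (0, 1) \<in> T then 0 else if \<exists>G\<in>\<G>. T \<subseteq> ?H G then 30 else 126)"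
    if T: "T \<in> P.lines ?V" for T
  proof (cases "(0, 1) \<in> T")
    case False
    note L = fst_image_line[OF T V(2) False]
    have "coverage ?all (fst ` T) = 15" using all L by (simp add: subspace_2_design_iff)
    moreover have "coverage B (fst ` T) = (if \<exists>G\<in>\<G>. fst ` T \<subseteq> G then 0 else 6)"
      using gdd L by (simp add: gdd_def)
    ultimately show ?thesis using B1(3)[OF T False] False by (simp add: two sub)
  qed (use B1(2) T in simp)
  let ?A = "\<lambda>K. {U. P.subspace U \<and> U \<subseteq> K \<and> P.dim U = 3 \<and> (0, 1) \<in> U}"
  let ?C = "\<lambda>K. mset_set {U. P.subspace U \<and> U \<subseteq> K \<and> P.dim U = 3}"
  \<comment> \<open>With a and b for the two weights here and w for the weight of B in the lift, the
    counts are 3 (a + b) for lines through the apex, 30 + 3 a + b for other lines over a group and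
    30 + 12 w elsewhere. The first two agree only for b = 15; then a = 4 w - 5, and 126 = 30 + 12 w
    gives w = 8 and a = 27.\<close>
  let ?f = "\<lambda>K. repeat_mset 27 (?C K) + repeat_mset 15 (mset_set (?A K))"
  have K: "P.subspace K \<and> K \<subseteq> ?V \<and> finite K \<and> P.dim K = 4 \<and> (0, 1) \<in> K" if KH: "K \<in> ?H ` \<G>" for K
  proof -
    obtain G where G': "G \<in> \<G>" "K = ?H G" using KH by blast
    then have "subspace G" "G \<subseteq> V" using spread by (auto simp: spread_def)
    moreover have "finite G" using \<open>G \<subseteq> V\<close> V(2) finite_subset by blast
    ultimately show ?thesis
      using G' G(1) subspace_times_UNIV dim_times_UNIV[of G] subspace_0 by auto
  qed
  have finA: "finite (?A K)" if "K \<in> ?H ` \<G>" for K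
    using K[OF that] by (auto intro: finite_subset[of _ "Pow K"])
  have C: "P.subspace_2_design 4 3 3 K (?C K)" if "K \<in> ?H ` \<G>" for K
    using P.complete_design[of K 4 3 1] K[OF that] by (simp add: two)
  have covA: "coverage (mset_set (?A K)) T = (if (0, 1) \<in> T then 3 else 1)"
    if KT: "K \<in> ?H ` \<G>" "T \<in> P.lines K" for K T
  proof (cases "(0, 1) \<in> T")
    case True
    have "{U \<in> ?A K. T \<subseteq> U} = {U \<in> {U. P.subspace U \<and> U \<subseteq> K \<and> P.dim U = 3}. T \<subseteq> U}"
      using True by auto
    moreover have "finite {U. P.subspace U \<and> U \<subseteq> K \<and> P.dim U = 3}"
      using K[OF KT(1)] by (auto intro: finite_subset[of _ "Pow K"])
    ultimately have "coverage (mset_set (?A K)) T = coverage (?C K) T"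
      using finA[OF KT(1)] by (simp add: coverage_mset_set)
    then show ?thesis using True C[OF KT(1)] KT(2) by (simp add: P.subspace_2_design_iff)
  next
    case False
    \<comment> \<open>The span of T and the apex is the only plane that contains both.\<close>
    let ?S = "P.span (insert (0, 1) T)"
    have T: "P.subspace T" "T \<subseteq> K" "P.dim T = 2" using KT(2) by (auto simp: P.lines_def)
    have finT: "finite T" using T(2) K[OF KT(1)] finite_subset by blast
    have S: "?S \<subseteq> K" using K[OF KT(1)] T(2) by (intro P.span_minimal) auto
    have spT: "P.span T = T" using P.span_eq_iff[THEN iffD2, OF T(1)] .
    have "card ?S = CARD('a) * card T"
      using P.card_span_insert[of "(0, 1)" T] False unfolding spT by blast
    also have "card T = CARD('a) ^ 2" using P.card_subspace[OF T(1) finT] T(3) by simp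
    finally have "P.dim ?S = 3"
      using P.dim_eq_iff_card[of ?S 3] finite_subset[OF S] K[OF KT(1)]
      by (simp add: power2_eq_square power3_eq_cube)
    moreover have "{U \<in> ?A K. T \<subseteq> U} = {U. P.subspace U \<and> U \<subseteq> K \<and> P.dim U = 3 + 0 \<and> ?S \<subseteq> U}"
      using P.span_minimal[of "insert (0, 1) T"] P.span_superset[of "insert (0, 1) T"] by auto
    ultimately have "card {U \<in> ?A K. T \<subseteq> U} = 1"
      using P.card_subspaces_containing[of K ?S 3 0] K[OF KT(1)] S by simp
    then show ?thesis using False finA[OF KT(1)] by (simp add: coverage_mset_set)
  qed
  have des: "P.subspace_2_design 7 3 126 ?V (B1 + (\<Sum>K\<in>?H ` \<G>. ?f K))"
  proof (rule P.fill_groups)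
    show "P.subspace ?V" "finite ?V" "P.dim ?V = 7"
      using V subspace_times_UNIV dim_times_UNIV[of V] by auto
    show "T \<in> P.lines ?V \<Longrightarrow> \<not> (\<exists>K\<in>?H ` \<G>. T \<subseteq> K) \<Longrightarrow> coverage B1 T = 126" for T
      using cov1[of T] apex_line_in_cylinder[OF V(1,2) spread, of T] by auto
    show "K = L" if "T \<in> P.lines ?V" "K \<in> ?H ` \<G>" "L \<in> ?H ` \<G>" "T \<subseteq> K" "T \<subseteq> L" for T K L
      using cylinder_line_unique[OF V(1,2) spread that(1)] that(2-5) by blast
    show "P.blocks_in 3 K (?f K)" if "K \<in> ?H ` \<G>" for K
      using C[OF that] finA[OF that]
      by (auto simp: P.subspace_2_design_iff P.blocks_in_mset_set intro!: P.blocks_in_repeat)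
    show "coverage B1 T + coverage (?f K) T = 126"
      if T: "K \<in> ?H ` \<G>" "T \<in> P.lines ?V" "T \<subseteq> K" for K T
    proof -
      have TK: "T \<in> P.lines K" using T by (auto simp: P.lines_def)
      then have "coverage (?C K) T = 3" using C[OF T(1)] by (simp add: P.subspace_2_design_iff)
      moreover have "\<exists>G\<in>\<G>. T \<subseteq> ?H G" using T(1,3) by blast
      ultimately show ?thesis using cov1[OF T(2)] covA[OF T(1) TK] by simp
    qed
  qed (use K B1(1) in auto)
  obtain K where KG: "K \<in> ?H ` \<G>" using G(2) by blast
  have "\<not> simple_blocks (?f K)"
  proof -
    obtain T where T: "T \<in> P.lines K" using P.lines_nonempty[of K] K[OF KG] by auto
    have "mset_set (?A K) \<noteq> {#}" using covA[OF KG T] by (auto split: if_splits)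
    then have "\<not> simple_blocks (repeat_mset 15 (mset_set (?A K)))"
      by (intro not_simple_blocks_repeat) simp_all
    then show ?thesis by (rule not_simple_blocks_mono) simp
  qed
  moreover have "finite (?H ` \<G>)" using K by (intro finite_subset[of "?H ` \<G>" "Pow ?V"]) (auto simp: V(2))
  ultimately show ?thesis using des P.fill_groups P.not_simple_fill[OF _ KG, of ?f B1] by blast
qed

end

section \<open>Existence of designs\<close>

context frobenius_extension
begin

text \<open>Any subspace over the small field is preserved by the nonzero scalars, so this C is
  available for every dimension d.\<close>

lemma ex_closed_set:
  assumes "CARD('e) = CARD('a) ^ L" "d \<le> L"
  shows "\<exists>D C. F_closed D \<and> card D = CARD('a) ^ d \<and> stabilizing_group C D \<and> card C = CARD('a) - 1"
proof -
  interpret e: finite_field_space "\<lambda>c x. emb c * x"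
    by unfold_locales (simp_all add: emb_add emb_mult algebra_simps)
  have "e.dim UNIV = L" using assms(1) by (subst e.dim_eq_iff_card) simp_all
  then obtain B where "e.independent B" "card B = L"
    using e.basis_exists[of UNIV] by metis
  then obtain A where A: "A \<subseteq> B" "card A = d" "finite A" "e.independent A"
    using assms(2) e.independent_mono by (metis obtain_subset_with_card_n)
  let ?D = "e.span A" and ?C = "range emb - {0}"
  have "F_closed ?D"
    unfolding F_closed_def using e.span_zero e.span_add e.span_scale by blast
  moreover have "card ?D = CARD('a) ^ d" using e.card_span_independent A by simp
  moreover have "stabilizing_group ?C ?D"
    unfolding stabilizing_group_def
  proof (intro conjI ballI)
    show "1 \<in> ?C" by (metis Diff_iff emb_1 rangeI singletonD zero_neq_one)
    fix c assume c: "c \<in> ?C"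
    then obtain a where a: "c = emb a" by blast
    show "c \<noteq> 0" "x \<in> ?D \<Longrightarrow> c * x \<in> ?D" for x using c a by (auto intro: e.span_scale)
    have "inverse c = emb (1 / a)" by (simp add: a emb_divide inverse_eq_divide)
    then have "inverse c \<in> range emb" by simp
    then show "inverse c \<in> ?C" using c by simp
    show "c * d \<in> ?C" if "d \<in> ?C" for d using c that by (auto simp flip: emb_mult)
  qed
  moreover have "card ?C = CARD('a) - 1"
    using emb_0 by (subst card_Diff_singleton) (auto simp: card_image inj_emb intro: rangeI[of emb 0, simplified])
  ultimately show ?thesis by blast
qed

text \<open>A subfield is preserved by all its nonzero elements, so lambda can be divided by q^d - 1
  instead of q - 1.\<close>

lemma ex_closed_subfield:
  assumes "card {x::'e. x ^ (CARD('a) ^ d) = x} = CARD('a) ^ d"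
  shows "\<exists>D C. F_closed D \<and> card D = CARD('a) ^ d \<and> stabilizing_group C D \<and> card C = CARD('a) ^ d - 1"
proof -
  let ?D = "{x::'e. x ^ (CARD('a) ^ d) = x}"
  have add: "(x + y) ^ (CARD('a) ^ d) = x ^ (CARD('a) ^ d) + y ^ (CARD('a) ^ d)" for x y :: 'e
    by (induction d arbitrary: x y) (simp_all add: power_mult frobenius_add)
  have emb: "emb c ^ (CARD('a) ^ d) = emb c" for c
    by (induction d) (simp_all add: power_mult)
  have "F_closed ?D" by (auto simp: F_closed_def power_0_left add emb power_mult_distrib)
  moreover have "stabilizing_group (?D - {0}) ?D"
    by (auto simp: stabilizing_group_def power_mult_distrib power_inverse)
  moreover have "card (?D - {0}) = CARD('a) ^ d - 1"
    using assms by (subst card_Diff_singleton) (auto simp: power_0_left)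
  ultimately show ?thesis using assms by blast
qed

end

section \<open>Designs on coordinate spaces\<close>

definition seqs :: "nat \<Rightarrow> (nat \<Rightarrow> 'a::zero) set" where
  "seqs v = {x. \<forall>i\<ge>v. x i = 0}"

lemma subspace_seqs: "seq.subspace (seqs v)"
  by (auto simp: seq.subspace_def seqs_def seq_scale_def)

lemma card_seqs:
  "finite (seqs v :: (nat \<Rightarrow> 'a::{zero,finite}) set)"
  "card (seqs v :: (nat \<Rightarrow> 'a) set) = CARD('a) ^ v"
proof -
  let ?f = "\<lambda>(x :: nat \<Rightarrow> 'a) i. if i < v then x i else 0"
  have "bij_betw ?f (PiE {..<v} (\<lambda>_. UNIV)) (seqs v)"
  proof (rule bij_betwI[where g = "\<lambda>x. restrict x {..<v}"])
    show "?f (restrict x {..<v}) = x" if "x \<in> seqs v" for x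
      using that by (auto simp: seqs_def fun_eq_iff not_less)
    show "restrict (?f x) {..<v} = x" if "x \<in> PiE {..<v} (\<lambda>_. UNIV)" for x
      using that by (intro ext) (auto simp: PiE_def extensional_def)
  qed (auto simp: seqs_def)
  then show "finite (seqs v :: (nat \<Rightarrow> 'a) set)" "card (seqs v :: (nat \<Rightarrow> 'a) set) = CARD('a) ^ v"
    by (auto simp: card_PiE finite_PiE dest: bij_betw_finite bij_betw_same_card)
qed

lemma finite_field_space_seq:
  "finite_field_space (seq_scale :: 'a::{field,finite} \<Rightarrow> (nat \<Rightarrow> 'a) \<Rightarrow> nat \<Rightarrow> 'a)"
  by (simp add: finite_field_space_def seq.vector_space_axioms)

definition ex_design :: "bool \<Rightarrow> 'a::field itself \<Rightarrow> nat \<Rightarrow> nat \<Rightarrow> nat \<Rightarrow> bool" where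
  "ex_design ns _ v k l \<longleftrightarrow>
    (\<exists>(V :: (nat \<Rightarrow> 'a) set) B. seq.subspace_2_design v k l V B \<and> (ns \<longrightarrow> \<not> simple_blocks B))"

lemma ex_nonsimple_iff: "ex_nonsimple_2_design F v k l \<longleftrightarrow> ex_design True F v k l"
  by (simp add: ex_nonsimple_2_design_def ex_design_def)

context finite_field_space
begin

text \<open>Together with \<open>ex_designD\<close> this makes existence a matter of the scalar
  field and the parameters, independent of the space used in a construction.\<close>

lemma ex_designI:
  assumes "subspace_2_design v k l V B" "ns \<longrightarrow> \<not> simple_blocks B"
  shows "ex_design ns TYPE('a) v k l"
proof -
  interpret s: finite_field_space "seq_scale :: 'a \<Rightarrow> (nat \<Rightarrow> 'a) \<Rightarrow> nat \<Rightarrow> 'a"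
    by (rule finite_field_space_seq)
  interpret p: finite_field_space_pair scale "seq_scale :: 'a \<Rightarrow> (nat \<Rightarrow> 'a) \<Rightarrow> nat \<Rightarrow> 'a" ..
  have "seq.dim (seqs v :: (nat \<Rightarrow> 'a) set) = v"
    using s.dim_eq_iff_card[OF subspace_seqs card_seqs(1)] card_seqs(2) by blast
  then show ?thesis
    using p.transport_design[OF assms subspace_seqs card_seqs(1)] unfolding ex_design_def by blast
qed

lemma ex_designD:
  assumes "ex_design ns TYPE('a) v k l" "subspace V" "finite V" "dim V = v"
  shows "\<exists>B. subspace_2_design v k l V B \<and> (ns \<longrightarrow> \<not> simple_blocks B)"
proof -
  interpret s: finite_field_space "seq_scale :: 'a \<Rightarrow> (nat \<Rightarrow> 'a) \<Rightarrow> nat \<Rightarrow> 'a"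
    by (rule finite_field_space_seq)
  interpret p: finite_field_space_pair "seq_scale :: 'a \<Rightarrow> (nat \<Rightarrow> 'a) \<Rightarrow> nat \<Rightarrow> 'a" scale ..
  show ?thesis using assms p.transport_design unfolding ex_design_def by metis
qed

lemma ex_design_fill:
  assumes gdd: "gdd V \<G> k l B" and dims: "dim V = v" "\<And>G. G \<in> \<G> \<Longrightarrow> dim G = g"
    and ex: "ex_design ns TYPE('a) g k l" and ne: "\<G> \<noteq> {}"
  shows "ex_design ns TYPE('a) v k l"
proof -
  have "\<exists>B'. subspace_2_design g k l G B' \<and> (ns \<longrightarrow> \<not> simple_blocks B')" if "G \<in> \<G>" for G
    using that gdd by (intro ex_designD[OF ex]) (auto simp: gdd_def dims(2) intro: finite_subset)
  then show ?thesis using fill_gdd[OF gdd dims(1) _ ne] ex_designI by metis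
qed

end

lemma ex_design_complete:
  assumes "l * (\<Prod>i<n. CARD('a) ^ (2 + n) - CARD('a) ^ (2 + i)) =
    (\<Prod>i<n. CARD('a) ^ v - CARD('a) ^ (2 + i))"
  shows "ex_design False TYPE('a::{field,finite}) v (2 + n) l"
proof -
  interpret s: finite_field_space "seq_scale :: 'a \<Rightarrow> (nat \<Rightarrow> 'a) \<Rightarrow> nat \<Rightarrow> 'a"
    by (rule finite_field_space_seq)
  have "seq.dim (seqs v :: (nat \<Rightarrow> 'a) set) = v"
    using s.dim_eq_iff_card[OF subspace_seqs card_seqs(1)] card_seqs(2) by blast
  then show ?thesis
    using s.complete_design[OF subspace_seqs card_seqs(1) _ assms] by (auto simp: ex_design_def)
qed

lemma ex_design_dvd:
  assumes "ex_design False TYPE('a::{field,finite}) v k l'" "l' dvd l"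
  shows "ex_design False TYPE('a) v k l"
proof -
  interpret s: finite_field_space "seq_scale :: 'a \<Rightarrow> (nat \<Rightarrow> 'a) \<Rightarrow> nat \<Rightarrow> 'a"
    by (rule finite_field_space_seq)
  obtain c where "l = c * l'" using assms(2) by (metis dvd_def mult.commute)
  then show ?thesis using assms(1) s.repeat_design unfolding ex_design_def by blast
qed

text \<open>A proper divisor leaves a factor of at least 2 and is itself positive, so a nonempty
  multiset is repeated.\<close>

lemma ex_design_nonsimple:
  assumes "ex_design False TYPE('a::{field,finite}) v k l'" "l' dvd l" "l' < l" "2 \<le> v"
  shows "ex_design True TYPE('a) v k l"
proof -
  interpret s: finite_field_space "seq_scale :: 'a \<Rightarrow> (nat \<Rightarrow> 'a) \<Rightarrow> nat \<Rightarrow> 'a"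
    by (rule finite_field_space_seq)
  obtain c where c: "l = l' * c" using assms(2) by (auto elim: dvdE)
  have c2: "2 \<le> c" and l': "0 < l'" using assms(3) c by (cases c; cases "c - 1"; auto)+
  obtain V :: "(nat \<Rightarrow> 'a) set" and B where des: "seq.subspace_2_design v k l' V B"
    using assms(1) by (auto simp: ex_design_def)
  obtain T where "T \<in> s.lines V"
    using s.lines_nonempty[of V] des assms(4) by (auto simp: s.subspace_2_design_iff)
  then have "B \<noteq> {#}" using des l' by (auto simp: s.subspace_2_design_iff)
  then have "\<not> simple_blocks (repeat_mset c B)" using c2 by (rule_tac not_simple_blocks_repeat)
  moreover have "seq.subspace_2_design v k l V (repeat_mset c B)"
    using s.repeat_design[OF des, of c] by (simp add: c mult.commute)
  ultimately show ?thesis by (auto simp: ex_design_def)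
qed

abbreviation gf_scale :: "'l::finite itself \<Rightarrow> 'a::{field,finite} \<Rightarrow> (nat \<Rightarrow> ('a, 'l) gf) \<Rightarrow> nat \<Rightarrow> ('a, 'l) gf" where
  "gf_scale L \<equiv> \<lambda>c. seq_scale (gf_of c)"

lemma frobenius_extension_gf:
  "frobenius_extension (seq_scale :: ('a::{field,finite}, 'l::finite) gf \<Rightarrow> _) (gf_of :: 'a \<Rightarrow> ('a, 'l) gf)"
proof -
  interpret s: finite_field_space "seq_scale :: ('a, 'l) gf \<Rightarrow> _"
    by (rule finite_field_space_seq)
  show ?thesis by unfold_locales (simp_all add: gf_of_simps frobenius_add_gf)
qed

text \<open>
  In the disjunction, \<open>c\<close> is the order of the group of scalars that stabilize a \<open>d\<close>-dimensional
  space of scalars: an arbitrary one, or a subfield.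
\<close>

lemma ex_gdd_gf:
  fixes L :: "'l::finite itself" and S
  defines "S \<equiv> gf_scale L :: 'a::{field,finite} \<Rightarrow> _"
  assumes m: "0 < m"
    and c: "d \<le> CARD('l) \<and> c = CARD('a) - 1 \<or> 0 < d \<and> d dvd CARD('l) \<and> c = CARD('a) ^ d - 1"
    and l: "l * (c * (\<Prod>i<n. CARD('a) ^ (d + n) - CARD('a) ^ (d + i))) =
      \<mu> * ((CARD('a) ^ (d + n) - 1) * (CARD('a) ^ (d + n) - CARD('a)) *
      (\<Prod>i<n. (CARD('a) ^ CARD('l)) ^ m - (CARD('a) ^ CARD('l)) ^ (2 + i)))"
  obtains B \<G> where "finite_field_space.gdd S (seqs m) \<G> (d + n) l B"
    "finite_field_space.spread S (seqs m) \<G>" "\<G> \<noteq> {}"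
    "\<And>G. G \<in> \<G> \<Longrightarrow> vector_space.dim S G = CARD('l)" "vector_space.dim S (seqs m) = CARD('l) * m"
    "finite_field_space S"
proof -
  interpret f: frobenius_extension "seq_scale :: ('a, 'l) gf \<Rightarrow> _" "gf_of :: 'a \<Rightarrow> ('a, 'l) gf"
    by (rule frobenius_extension_gf)
  have V: "seq.subspace (seqs m :: (nat \<Rightarrow> ('a, 'l) gf) set)" "finite (seqs m :: (nat \<Rightarrow> ('a, 'l) gf) set)"
    "card (seqs m :: (nat \<Rightarrow> ('a, 'l) gf) set) = (CARD('a) ^ CARD('l)) ^ m"
    by (simp_all add: subspace_seqs card_seqs card_gf)
  have "1 < (CARD('a) ^ CARD('l)) ^ m"
    using m f.F.card_scalars_ge_2 by (intro one_less_power) auto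
  then have V0: "seqs m \<noteq> {0 :: nat \<Rightarrow> ('a, 'l) gf}" using V(3) by (metis card_1_singleton_iff less_irrefl One_nat_def)
  obtain D C where DC: "f.F_closed D" "card D = CARD('a) ^ d" "f.stabilizing_group C D" "card C = c"
    using c f.ex_closed_set[OF card_gf, of d] f.ex_closed_subfield[OF card_subfield_gf, of d] by metis
  obtain B \<G> where B: "f.F.gdd (seqs m) \<G> (d + n) l B" "f.F.spread (seqs m) \<G>" "\<G> \<noteq> {}"
    and cG: "\<And>G. G \<in> \<G> \<Longrightarrow> card G = CARD(('a, 'l) gf)"
    using f.ex_gdd[OF V(1,2) V0 DC(1-3), of l n \<mu>] l unfolding DC(4) V(3) card_gf by metis
  have "f.F.dim G = CARD('l)" if G: "G \<in> \<G>" for G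
  proof -
    have "f.F.subspace G" "finite G" using B(2) G V(2) finite_subset by (auto simp: f.F.spread_def)
    then show ?thesis using cG[OF G] f.F.dim_eq_iff_card card_gf by metis
  qed
  moreover have "f.F.dim (seqs m) = CARD('l) * m"
    using f.F.dim_eq_iff_card[OF f.E_subspace_imp_F_subspace[OF V(1)] V(2), of "CARD('l) * m"] V(3)
    by (simp add: power_mult)
  ultimately show ?thesis using that B f.F.finite_field_space_axioms unfolding S_def by blast
qed

section \<open>The parameter families\<close>

context
  fixes L :: "'l::finite itself" and F :: "'a::{field,finite} itself" and d c n l \<mu> m :: nat
  assumes m: "0 < m"
    and c: "d \<le> CARD('l) \<and> c = CARD('a) - 1 \<or> 0 < d \<and> d dvd CARD('l) \<and> c = CARD('a) ^ d - 1"
    and l: "l * (c * (\<Prod>i<n. CARD('a) ^ (d + n) - CARD('a) ^ (d + i))) =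
      \<mu> * ((CARD('a) ^ (d + n) - 1) * (CARD('a) ^ (d + n) - CARD('a)) *
      (\<Prod>i<n. (CARD('a) ^ CARD('l)) ^ m - (CARD('a) ^ CARD('l)) ^ (2 + i)))"
begin

lemma ex_design_gf_fill:
  assumes "ex_design ns TYPE('a) CARD('l) (d + n) l"
  shows "ex_design ns TYPE('a) (CARD('l) * m) (d + n) l"
proof -
  let ?S = "gf_scale L :: 'a \<Rightarrow> _"
  obtain B \<G> where B: "finite_field_space.gdd ?S (seqs m) \<G> (d + n) l B" "\<G> \<noteq> {}"
    "\<And>G. G \<in> \<G> \<Longrightarrow> vector_space.dim ?S G = CARD('l)" "vector_space.dim ?S (seqs m) = CARD('l) * m"
    "finite_field_space ?S"
    using ex_gdd_gf[OF m c l] by metis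
  interpret finite_field_space ?S by (rule B)
  show ?thesis using ex_design_fill[OF B(1,4,3) assms B(2)] .
qed

text \<open>The groups of the lift are cylinders of dimension \<open>CARD('l) + 1\<close>, so the
  filling design lives in that dimension.\<close>

lemma ex_design_gf_lift_fill:
  assumes "ex_design ns TYPE('a) (CARD('l) + 1) (d + n) (CARD('a) ^ (d + n - 2) * l)"
  shows "ex_design ns TYPE('a) (CARD('l) * m + 1) (d + n) (CARD('a) ^ (d + n - 2) * l)"
proof -
  let ?S = "gf_scale L :: 'a \<Rightarrow> _"
  obtain B \<G> where B: "finite_field_space.gdd ?S (seqs m) \<G> (d + n) l B" "\<G> \<noteq> {}"
    "\<And>G. G \<in> \<G> \<Longrightarrow> vector_space.dim ?S G = CARD('l)" "vector_space.dim ?S (seqs m) = CARD('l) * m"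
    "finite_field_space ?S" "finite_field_space.spread ?S (seqs m) \<G>"
    using ex_gdd_gf[OF m c l] by metis
  interpret cylinder ?S using B(5) by (simp add: cylinder_def)
  obtain B' where B': "P.gdd (seqs m \<times> UNIV) ((\<lambda>G. G \<times> UNIV) ` \<G>) (d + n) (CARD('a) ^ (d + n - 2) * l) B'"
    using lift_gdd[OF B(1,6)] by blast
  have V: "subspace (seqs m)" "finite (seqs m :: (nat \<Rightarrow> ('a, 'l) gf) set)" using B(1) by (auto simp: gdd_def)
  show ?thesis
  proof (rule P.ex_design_fill[OF B' _ _ assms])
    show "P.dim (seqs m \<times> UNIV) = CARD('l) * m + 1" using dim_times_UNIV[OF V] B(4) by simp
    show "(\<lambda>G. G \<times> UNIV) ` \<G> \<noteq> {}" using B(2) by blast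
    fix K assume "K \<in> (\<lambda>G. G \<times> (UNIV :: 'a set)) ` \<G>"
    then obtain G where G: "G \<in> \<G>" "K = G \<times> UNIV" by blast
    then have "subspace G" "finite G" using B(6) V(2) by (auto simp: spread_def intro: finite_subset)
    then show "P.dim K = CARD('l) + 1" using dim_times_UNIV[of G] B(3)[OF G(1)] G(2) by simp
  qed
qed

end

section \<open>Arithmetic of the parameters\<close>

lemma prod_less_small:
  fixes f :: "nat \<Rightarrow> nat"
  shows "(\<Prod>i<1. f i) = f 0" "(\<Prod>i<2. f i) = f 0 * f 1" "(\<Prod>i<3. f i) = f 0 * f 1 * f 2"
  by (simp_all add: numeral_2_eq_2 numeral_3_eq_3)

text \<open>The double count produces differences Q^m - Q^i, while the lambdas of the families have
  powers of q cancelled.\<close>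

lemma power_diff_factor:
  fixes b :: nat
  assumes "r \<le> L * m" "r \<le> L * i"
  shows "(b ^ L) ^ m - (b ^ L) ^ i = b ^ r * (b ^ (L * m - r) - b ^ (L * i - r))"
  using assms by (simp add: right_diff_distrib' flip: power_mult power_add)

lemma power_diff_ge:
  fixes b :: nat
  assumes "2 \<le> b" "e + r < f"
  shows "b ^ e \<le> b ^ (f - r) - b ^ e"
proof -
  have "2 * b ^ e \<le> b ^ Suc e" using assms(1) by simp
  also have "\<dots> \<le> b ^ (f - r)" using assms by (intro power_increasing) auto
  finally show ?thesis by simp
qed

text \<open>Applied to idempotent residues: 3 modulo 6, 4 modulo 3 and 5 modulo 20.\<close>

lemma power_mod_idem:
  fixes b :: nat
  assumes "b * b mod r = b mod r" "0 < m"
  shows "b ^ m mod r = b mod r"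
  using assms(2)
proof (induction m rule: nat_induct_non_zero)
  case (Suc m)
  have "b ^ Suc m mod r = b * (b ^ m mod r) mod r" by (simp add: mod_mult_right_eq)
  then show ?case using Suc assms(1) by (simp add: mod_mult_right_eq)
qed simp

lemma dvd_power_diff:
  fixes b :: nat
  assumes "b * b mod r = b mod r" "0 < e" "e \<le> f" "0 < b"
  shows "r dvd b ^ f - b ^ e"
proof -
  have "b ^ e \<le> b ^ f" using assms by (intro power_increasing) auto
  moreover have "b ^ f mod r = b ^ e mod r"
    using power_mod_idem[OF assms(1), of e] power_mod_idem[OF assms(1), of f] assms(2,3) by simp
  ultimately show ?thesis using mod_eq_dvd_iff_nat by blast
qed

lemma Suc_power_diff_dvd: "c dvd Suc c ^ j - 1"
proof (induction j)
  case (Suc j)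
  have "Suc c ^ Suc j - 1 = c * Suc c ^ j + (Suc c ^ j - 1)" by simp
  then show ?case using Suc by (simp only: dvd_add_right_iff dvd_triv_left)
qed simp

lemma two_power_diff_dvd:
  assumes "r \<le> e" "e \<le> f" "s dvd f - e"
  shows "2 ^ r * (2 ^ s - 1) dvd (2::nat) ^ f - 2 ^ e"
proof -
  obtain j where j: "f = e + s * j" using assms(2,3) by (metis dvd_def le_add_diff_inverse)
  have "(2::nat) ^ f - 2 ^ e = 2 ^ e * ((2 ^ s) ^ j - 1)"
    by (simp add: j power_add right_diff_distrib' flip: power_mult)
  moreover have "2 ^ s - 1 dvd (2 ^ s) ^ j - (1::nat)"
    using Suc_power_diff_dvd[of "2 ^ s - 1" j] by simp
  moreover have "(2::nat) ^ r dvd 2 ^ e" using assms(1) by (rule le_imp_power_dvd)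
  ultimately show ?thesis by (simp add: mult_dvd_mono)
qed

context
  fixes F :: "'a::{field,finite} itself"
  assumes two: "CARD('a) = 2"
begin

text \<open>On GF(32)^2 with D = GF(32) and trivial C, lambda is (2^5 - 1)(2^5 - 2) = 930. A group
  has dimension 5 = k and is filled with 930 copies of itself.\<close>

lemma ex_design_10_5: "ex_design False TYPE('a) 10 5 930"
proof -
  have "ex_design False TYPE('a) 5 5 1" using ex_design_complete[where 'a = 'a, of 1 3 5] by simp
  then have "ex_design False TYPE('a) 5 5 930" by (rule ex_design_dvd) simp
  then show ?thesis
    using ex_design_gf_fill[where 'a = 'a and 'l = 5 and m = 2 and d = 5 and n = 0 and c = 1 and \<mu> = 1 and l = 930 and ns = False]
    by (simp add: two)
qed

lemma ex_design_6_5: "ex_design False TYPE('a) 6 5 15"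
  using ex_design_complete[where 'a = 'a, of 15 3 6] by (simp add: two prod_less_small)

text \<open>The lift of the same group divisible design, with lambda 8 * 930. The cylinders have
  dimension 6, and their complete design has lambda 15, a divisor of 7440.\<close>

lemma ex_design_11_5: "ex_design False TYPE('a) 11 5 7440"
proof -
  have "ex_design False TYPE('a) 6 5 7440" using ex_design_6_5 by (rule ex_design_dvd) simp
  then show ?thesis
    using ex_design_gf_lift_fill[where 'a = 'a and 'l = 5 and m = 2 and d = 5 and n = 0 and c = 1 and \<mu> = 1 and l = 930 and ns = False]
    by (simp add: two)
qed

text \<open>Here D is a hyperplane of GF(64), and the groups of dimension 6 carry multiples of the
  complete design.\<close>

lemma ex_design_12_5: "ex_design False TYPE('a) 12 5 930"
proof -
  have "ex_design False TYPE('a) 6 5 930" using ex_design_6_5 by (rule ex_design_dvd) simp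
  then show ?thesis
    using ex_design_gf_fill[where 'a = 'a and 'l = 6 and m = 2 and d = 5 and n = 0 and c = 1 and \<mu> = 1 and l = 930 and ns = False]
    by (simp add: two)
qed

lemma ex_design_12_6: "ex_design False TYPE('a) 12 6 3906"
proof -
  have "ex_design False TYPE('a) 6 6 1" using ex_design_complete[where 'a = 'a, of 1 4 6] by simp
  then have "ex_design False TYPE('a) 6 6 3906" by (rule ex_design_dvd) simp
  then show ?thesis
    using ex_design_gf_fill[where 'a = 'a and 'l = 6 and m = 2 and d = 6 and n = 0 and c = 1 and \<mu> = 1 and l = 3906 and ns = False]
    by (simp add: two)
qed

text \<open>The mixture starts from GF(8)^2 with D = GF(8): C has order 7, so lambda is 7 * 6 / 7 =
  6.\<close>

lemma ex_design_7_3: "ex_design True TYPE('a) 7 3 126"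
proof -
  let ?S = "gf_scale TYPE(3) :: 'a \<Rightarrow> _"
  obtain B \<G> where B: "finite_field_space.gdd ?S (seqs 2) \<G> 3 6 B" "\<G> \<noteq> {}"
    "\<And>G. G \<in> \<G> \<Longrightarrow> vector_space.dim ?S G = 3" "vector_space.dim ?S (seqs 2) = 6"
    "finite_field_space ?S" "finite_field_space.spread ?S (seqs 2) \<G>"
    using ex_gdd_gf[where 'a = 'a and 'l = 3 and m = 2 and d = 3 and n = 0 and c = 7 and \<mu> = 1 and l = 6, simplified two, simplified]
    by metis
  interpret cylinder ?S using B(5) by (simp add: cylinder_def)
  have V: "subspace (seqs 2)" "finite (seqs 2 :: (nat \<Rightarrow> ('a, 3) gf) set)" using B(1) by (auto simp: gdd_def)
  show ?thesis
    using ex_2_7_3_126_design[OF two V B(4,6,3,2,1)] P.ex_designI by blast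
qed

text \<open>For d = 3, n = 2 and trivial C, lambda is (31 * 30) / (24 * 16) = 155 / 64 times the two
  differences. The 8 is the factor 2^(5-2) of the lift.\<close>

lemma ex_design_dim_5:
  fixes L :: "'l::finite itself"
  assumes L: "3 \<le> CARD('l)" and m: "2 \<le> m"
    and l: "64 * l = 155 * ((2 ^ CARD('l)) ^ m - (2 ^ CARD('l)) ^ 2) * ((2 ^ CARD('l)) ^ m - (2 ^ CARD('l)) ^ 3)"
  shows "ex_design ns TYPE('a) CARD('l) 5 l \<Longrightarrow> ex_design ns TYPE('a) (CARD('l) * m) 5 l"
    and "l' = 8 * l \<Longrightarrow> ex_design ns TYPE('a) (CARD('l) + 1) 5 l' \<Longrightarrow>
      ex_design ns TYPE('a) (CARD('l) * m + 1) 5 l'"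
proof -
  have c: "3 \<le> CARD('l) \<and> 1 = CARD('a) - 1 \<or> 0 < (3::nat) \<and> 3 dvd CARD('l) \<and> 1 = CARD('a) ^ 3 - 1"
    using L by (simp add: two)
  have eq: "l * (1 * (\<Prod>i<2. CARD('a) ^ (3 + 2) - CARD('a) ^ (3 + i))) =
      1 * ((CARD('a) ^ (3 + 2) - 1) * (CARD('a) ^ (3 + 2) - CARD('a)) *
      (\<Prod>i<2. (CARD('a) ^ CARD('l)) ^ m - (CARD('a) ^ CARD('l)) ^ (2 + i)))"
    using l by (simp add: two prod_less_small power2_eq_square power3_eq_cube mult.assoc)
  show "ex_design ns TYPE('a) CARD('l) 5 l \<Longrightarrow> ex_design ns TYPE('a) (CARD('l) * m) 5 l"
    using ex_design_gf_fill[OF _ c eq, of ns] m by simp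
  show "l' = 8 * l \<Longrightarrow> ex_design ns TYPE('a) (CARD('l) + 1) 5 l' \<Longrightarrow>
      ex_design ns TYPE('a) (CARD('l) * m + 1) 5 l'"
    using ex_design_gf_lift_fill[OF _ c eq, of ns] m by (simp add: two)
qed

end

lemma less_155_mult:
  assumes "(0::nat) < A" "2 ^ 30 \<le> B" "r < 155 * 2 ^ 30"
  shows "r < 155 * A * B"
proof -
  have "1 * 2 ^ 30 \<le> A * B" using assms by (intro mult_le_mono) auto
  then show ?thesis using assms(3) by (simp add: mult.assoc)
qed

theorem theorem5p7:
  fixes F :: "'a::{field,finite} itself"
  shows
    "(CARD('a) = 2 \<longrightarrow> (\<forall>m\<ge>2.
       ex_nonsimple_2_design F (7*m) 3 126)) \<and>
     (CARD('a) = 2 \<longrightarrow> (\<forall>m\<ge>4. m mod 4 \<in> {2, 3} \<longrightarrow>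
       ex_nonsimple_2_design F (10*m) 5 (155 * (2^(10*m-6) - 2^14) * (2^(10*m) - 2^30)))) \<and>
     (CARD('a) = 2 \<longrightarrow> (\<forall>m\<ge>4. m mod 36 \<in> {2, 3, 11, 30} \<longrightarrow>
       ex_nonsimple_2_design F (10*m+1) 5 (155 * (2^(10*m-3) - 2^17) * (2^(10*m) - 2^30)))) \<and>
     (CARD('a) = 2 \<longrightarrow> (\<forall>m\<ge>4. m mod 72 \<in> {2, 3, 11, 66} \<longrightarrow>
       ex_nonsimple_2_design F (11*m) 5 (155 * (2^(11*m-6) - 2^16) * (2^(11*m) - 2^33)))) \<and>
     (CARD('a) = 2 \<longrightarrow> (\<forall>m\<ge>4. m mod 360 \<in> {2, 3, 83, 282} \<longrightarrow>
       ex_nonsimple_2_design F (11*m+1) 5 (155 * (2^(11*m-3) - 2^19) * (2^(11*m) - 2^33)))) \<and>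
     (CARD('a) = 2 \<longrightarrow> (\<forall>m\<ge>4. m mod 15 \<in> {2, 3, 8, 12} \<longrightarrow>
       ex_nonsimple_2_design F (12*m) 5 (155 * (2^(12*m-6) - 2^18) * (2^(12*m) - 2^36) div 7))) \<and>
     (CARD('a) = 2 \<longrightarrow> (\<forall>m\<ge>5. m mod 5 \<in> {2, 3, 4} \<longrightarrow>
       ex_nonsimple_2_design F (12*m) 6
         (93 * (2^(12*m-11) - 2^13) * (2^(12*m) - 2^36) * (2^(12*m) - 2^48) div 7))) \<and>
     (CARD('a) = 3 \<longrightarrow> (\<forall>m\<ge>3. m mod 3 = 2 \<longrightarrow>
       ex_nonsimple_2_design F (8*m) 4 (520 * (3^(8*m-2) - 3^14)))) \<and>
     (CARD('a) = 4 \<longrightarrow> (\<forall>m\<ge>3. m mod 3 = 2 \<longrightarrow>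
       ex_nonsimple_2_design F (8*m) 4 (7140 * (4^(8*m-3) - 4^13)))) \<and>
     (CARD('a) = 5 \<longrightarrow> (\<forall>m\<ge>3. m mod 3 = 2 \<longrightarrow>
       ex_nonsimple_2_design F (8*m) 4 (4836 * (5^(8*m-2) - 5^14))))"
proof -
  have F: "ex_nonsimple_2_design F v k l \<longleftrightarrow> ex_design True TYPE('a) v k l" for v k l
    unfolding ex_nonsimple_iff by (simp add: ex_design_def)
  \<comment> \<open>126 = 3 * (2^3 - 1) * (2^3 - 2), hence \<mu> = 3. Non-simplicity comes from the
    filling.\<close>
  have case_i: "ex_design True TYPE('a) (7*m) 3 126" if two: "CARD('a) = 2" and m: "2 \<le> m" for m
    using ex_design_gf_fill[where 'a = 'a and 'l = 7 and m = m and d = 3 and n = 0 and c = 1 and \<mu> = 3 and l = 126 and ns = True]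
      ex_design_7_3[OF two] m by (simp add: two)
  have case_ii: "ex_design True TYPE('a) (10*m) 5 (155 * (2^(10*m-6) - 2^14) * (2^(10*m) - 2^30))"
    if two: "CARD('a) = 2" and m: "4 \<le> m" for m
  proof -
    let ?A = "2^(10*m-6) - 2^14 :: nat" and ?B = "2^(10*m) - 2^30 :: nat"
    \<comment> \<open>930 = 155 * 6, and 3 divides a difference of powers of 2 whose exponents have
      equal parity.\<close>
    have "2 ^ 1 * (2 ^ 2 - 1) dvd ?B" using m by (intro two_power_diff_dvd) auto
    then have "930 dvd 155 * ?A * ?B" using mult_dvd_mono[of "155" "155 * ?A" 6 ?B] by simp
    moreover have "930 < 155 * ?A * ?B"
      using m power_diff_ge[of 2 14 6 "10*m"] power_diff_ge[of 2 30 0 "10*m"] by (intro less_155_mult) auto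
    ultimately have "ex_design True TYPE('a) 10 5 (155 * ?A * ?B)"
      by (intro ex_design_nonsimple[OF ex_design_10_5[OF two]]) auto
    moreover have "(2 ^ 10) ^ m - (2 ^ 10) ^ 2 = 2 ^ 6 * ?A" "(2 ^ 10) ^ m - (2 ^ 10) ^ 3 = ?B"
      using m power_diff_factor[of 6 10 m 2 2] power_diff_factor[of 0 10 m 3 2] by simp_all
    ultimately show ?thesis
      using ex_design_dim_5(1)[OF two, where 'l = 10 and m = m and l = "155 * ?A * ?B" and ns = True] m by simp
  qed
  have case_iii: "ex_design True TYPE('a) (10*m+1) 5 (155 * (2^(10*m-3) - 2^17) * (2^(10*m) - 2^30))"
    if two: "CARD('a) = 2" and m: "4 \<le> m" for m
  proof -
    let ?A = "2^(10*m-6) - 2^14 :: nat" and ?A' = "2^(10*m-3) - 2^17 :: nat" and ?B = "2^(10*m) - 2^30 :: nat"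
    \<comment> \<open>7440 = 155 * 48.\<close>
    have "2 ^ 4 * (2 ^ 2 - 1) dvd ?B" using m by (intro two_power_diff_dvd) auto
    then have "7440 dvd 155 * ?A' * ?B" using mult_dvd_mono[of "155" "155 * ?A'" 48 ?B] by simp
    moreover have "7440 < 155 * ?A' * ?B"
      using m power_diff_ge[of 2 17 3 "10*m"] power_diff_ge[of 2 30 0 "10*m"] by (intro less_155_mult) auto
    ultimately have ex: "ex_design True TYPE('a) 11 5 (155 * ?A' * ?B)"
      by (intro ex_design_nonsimple[OF ex_design_11_5[OF two]]) auto
    have *: "(2 ^ 10) ^ m - (2 ^ 10) ^ 2 = 2 ^ 6 * ?A" "(2 ^ 10) ^ m - (2 ^ 10) ^ 2 = 2 ^ 3 * ?A'"
      "(2 ^ 10) ^ m - (2 ^ 10) ^ 3 = ?B"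
      using m power_diff_factor[of 6 10 m 2 2] power_diff_factor[of 3 10 m 2 2] power_diff_factor[of 0 10 m 3 2]
      by simp_all
    then have eq: "155 * ?A' * ?B = 8 * (155 * ?A * ?B)" by simp
    then show ?thesis
      using ex_design_dim_5(2)[OF two _ _ _ eq, where 'l = 10 and m = m and ns = True] m ex * by simp
  qed
  have case_iv: "ex_design True TYPE('a) (11*m) 5 (155 * (2^(11*m-6) - 2^16) * (2^(11*m) - 2^33))"
    if two: "CARD('a) = 2" and m: "4 \<le> m" for m
  proof -
    let ?A = "2^(11*m-6) - 2^16 :: nat" and ?B = "2^(11*m) - 2^33 :: nat"
    \<comment> \<open>The factor 3 requires exponents of equal parity, found in \<open>?A\<close>
      for even m and in \<open>?B\<close> for odd m.\<close>
    have "2 ^ 4 * (2 ^ 2 - 1) dvd ?A \<or> 2 ^ 4 * (2 ^ 2 - 1) dvd ?B"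
    proof (cases "even m")
      case True
      then show ?thesis using m by (intro disjI1 two_power_diff_dvd) auto
    next
      case False
      then show ?thesis using m by (intro disjI2 two_power_diff_dvd) auto
    qed
    then have "7440 dvd 155 * ?A * ?B"
      using mult_dvd_mono[of "155" "155 * ?A" 48 ?B] mult_dvd_mono[of "155 * 48" "155 * ?A" 1 ?B] by auto
    moreover have "7440 < 155 * ?A * ?B"
      using m power_diff_ge[of 2 16 6 "11*m"] power_diff_ge[of 2 33 0 "11*m"] by (intro less_155_mult) auto
    ultimately have "ex_design True TYPE('a) 11 5 (155 * ?A * ?B)"
      by (intro ex_design_nonsimple[OF ex_design_11_5[OF two]]) auto
    moreover have "(2 ^ 11) ^ m - (2 ^ 11) ^ 2 = 2 ^ 6 * ?A" "(2 ^ 11) ^ m - (2 ^ 11) ^ 3 = ?B"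
      using m power_diff_factor[of 6 11 m 2 2] power_diff_factor[of 0 11 m 3 2] by simp_all
    ultimately show ?thesis
      using ex_design_dim_5(1)[OF two, where 'l = 11 and m = m and l = "155 * ?A * ?B" and ns = True] m by simp
  qed
  have case_v: "ex_design True TYPE('a) (11*m+1) 5 (155 * (2^(11*m-3) - 2^19) * (2^(11*m) - 2^33))"
    if two: "CARD('a) = 2" and m: "4 \<le> m" for m
  proof -
    let ?A = "2^(11*m-6) - 2^16 :: nat" and ?A' = "2^(11*m-3) - 2^19 :: nat" and ?B = "2^(11*m) - 2^33 :: nat"
    have "2 ^ 1 * (2 ^ 2 - 1) dvd ?A' \<or> 2 ^ 1 * (2 ^ 2 - 1) dvd ?B"
    proof (cases "even m")
      case True
      then show ?thesis using m by (intro disjI1 two_power_diff_dvd) auto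
    next
      case False
      then show ?thesis using m by (intro disjI2 two_power_diff_dvd) auto
    qed
    then have "930 dvd 155 * ?A' * ?B"
      using mult_dvd_mono[of "155" "155 * ?A'" 6 ?B] mult_dvd_mono[of "155 * 6" "155 * ?A'" 1 ?B] by auto
    moreover have "930 < 155 * ?A' * ?B"
      using m power_diff_ge[of 2 19 3 "11*m"] power_diff_ge[of 2 33 0 "11*m"] by (intro less_155_mult) auto
    ultimately have ex: "ex_design True TYPE('a) 12 5 (155 * ?A' * ?B)"
      by (intro ex_design_nonsimple[OF ex_design_12_5[OF two]]) auto
    have *: "(2 ^ 11) ^ m - (2 ^ 11) ^ 2 = 2 ^ 6 * ?A" "(2 ^ 11) ^ m - (2 ^ 11) ^ 2 = 2 ^ 3 * ?A'"
      "(2 ^ 11) ^ m - (2 ^ 11) ^ 3 = ?B"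
      using m power_diff_factor[of 6 11 m 2 2] power_diff_factor[of 3 11 m 2 2] power_diff_factor[of 0 11 m 3 2]
      by simp_all
    then have eq: "155 * ?A' * ?B = 8 * (155 * ?A * ?B)" by simp
    then show ?thesis
      using ex_design_dim_5(2)[OF two _ _ _ eq, where 'l = 11 and m = m and ns = True] m ex * by simp
  qed
  have case_vi: "ex_design True TYPE('a) (12*m) 5 (155 * (2^(12*m-6) - 2^18) * (2^(12*m) - 2^36) div 7)"
    if two: "CARD('a) = 2" and m: "4 \<le> m" for m
  proof -
    let ?A = "2^(12*m-6) - 2^18 :: nat" and ?B = "2^(12*m) - 2^36 :: nat"
    \<comment> \<open>D is the subfield GF(8) of GF(2^12), so c = 7. The division by 7 is carried
      out in \<open>?B\<close>, whose exponents differ by a multiple of 3.\<close>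
    have "2 ^ 0 * (2 ^ 3 - 1) dvd ?B" using m by (intro two_power_diff_dvd) auto
    then obtain b where b: "?B = 7 * b" by (auto elim: dvdE)
    have l: "155 * ?A * ?B div 7 = 155 * ?A * b" unfolding b by simp
    have "2 ^ 1 * (2 ^ 2 - 1) dvd ?A" using m by (intro two_power_diff_dvd) auto
    then have "930 dvd 155 * ?A * b" using mult_dvd_mono[of "155 * 6" "155 * ?A" 1 b] by simp
    moreover have "2 ^ 30 \<le> b" using m power_diff_ge[of 2 36 0 "12*m"] b by simp
    then have "930 < 155 * ?A * b"
      using m power_diff_ge[of 2 18 6 "12*m"] by (intro less_155_mult) auto
    ultimately have "ex_design True TYPE('a) 12 5 (155 * ?A * b)"
      by (intro ex_design_nonsimple[OF ex_design_12_5[OF two]]) auto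
    moreover have "(2 ^ 12) ^ m - (2 ^ 12) ^ 2 = 2 ^ 6 * ?A" "(2 ^ 12) ^ m - (2 ^ 12) ^ 3 = 7 * b"
      using m power_diff_factor[of 6 12 m 2 2] power_diff_factor[of 0 12 m 3 2] b by simp_all
    ultimately show ?thesis unfolding l
      using ex_design_gf_fill[where 'a = 'a and 'l = 12 and m = m and d = 3 and n = 2 and c = 7 and \<mu> = 1
          and l = "155 * ?A * b" and ns = True] m by (simp add: two prod_less_small)
  qed
  have case_vii: "ex_design True TYPE('a) (12*m) 6
      (93 * (2^(12*m-11) - 2^13) * (2^(12*m) - 2^36) * (2^(12*m) - 2^48) div 7)"
    if two: "CARD('a) = 2" and m: "5 \<le> m" for m
  proof -
    let ?A = "2^(12*m-11) - 2^13 :: nat" and ?B = "2^(12*m) - 2^36 :: nat" and ?C = "2^(12*m) - 2^48 :: nat"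
    have "2 ^ 0 * (2 ^ 3 - 1) dvd ?B" using m by (intro two_power_diff_dvd) auto
    then obtain b where b: "?B = 7 * b" by (auto elim: dvdE)
    have l: "93 * ?A * ?B * ?C div 7 = 93 * ?A * b * ?C" unfolding b by simp
    \<comment> \<open>3906 = 93 * 42. The 7 in \<open>?B\<close> is used up by the division, so 42
      is taken from \<open>?C\<close>.\<close>
    have "2 ^ 1 * (2 ^ 2 - 1) dvd ?C" using m by (intro two_power_diff_dvd) auto
    moreover have "2 ^ 0 * (2 ^ 3 - 1) dvd ?C" using m by (intro two_power_diff_dvd) auto
    moreover have "6 dvd x \<Longrightarrow> 7 dvd x \<Longrightarrow> 42 dvd x" for x :: nat by presburger
    ultimately have "42 dvd ?C" by simp
    then have "3906 dvd 93 * ?A * b * ?C" using mult_dvd_mono[of 93 "93 * ?A * b" 42 ?C] by simp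
    moreover have "3906 < 93 * ?A * b * ?C"
    proof -
      have "0 < ?A" "0 < b" "2 ^ 48 \<le> ?C"
        using m power_diff_ge[of 2 13 11 "12*m"] power_diff_ge[of 2 36 0 "12*m"] power_diff_ge[of 2 48 0 "12*m"] b
        by auto
      then have "1 * 1 * 2 ^ 48 \<le> ?A * b * ?C" by (intro mult_le_mono) auto
      then show ?thesis by (simp add: mult_ac)
    qed
    ultimately have "ex_design True TYPE('a) 12 6 (93 * ?A * b * ?C)"
      by (intro ex_design_nonsimple[OF ex_design_12_6[OF two]]) auto
    moreover have "(2 ^ 12) ^ m - (2 ^ 12) ^ 2 = 2 ^ 11 * ?A" "(2 ^ 12) ^ m - (2 ^ 12) ^ 3 = 7 * b"
      "(2 ^ 12) ^ m - (2 ^ 12) ^ 4 = ?C"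
      using m power_diff_factor[of 11 12 m 2 2] power_diff_factor[of 0 12 m 3 2] power_diff_factor[of 0 12 m 4 2] b
      by simp_all
    ultimately show ?thesis unfolding l
      using ex_design_gf_fill[where 'a = 'a and 'l = 12 and m = m and d = 3 and n = 3 and c = 7 and \<mu> = 1
          and l = "93 * ?A * b * ?C" and ns = True] m by (simp add: two prod_less_small)
  qed
  \<comment> \<open>\<open>l'\<close> is the lambda on GF(q^4)^2 with D = GF(q^4), where each group
    is filled with copies of itself. The resulting design of dimension 8 fills the groups
    GF(q^8).\<close>
  have dim_8: "ex_design True TYPE('a) (8*m) 4 l"
    if m: "3 \<le> m" and l: "l * ((CARD('a) - 1) * (CARD('a) ^ 4 - CARD('a) ^ 3)) =
      (CARD('a) ^ 4 - 1) * (CARD('a) ^ 4 - CARD('a)) * ((CARD('a) ^ 8) ^ m - (CARD('a) ^ 8) ^ 2)"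
      and l': "l' * (CARD('a) - 1) = (CARD('a) ^ 4 - 1) * (CARD('a) ^ 4 - CARD('a))" "l' dvd l" "l' < l"
    for m l l'
  proof -
    have "ex_design False TYPE('a) 4 4 1" using ex_design_complete[where 'a = 'a, of 1 2 4] by simp
    then have "ex_design False TYPE('a) 4 4 l'" by (rule ex_design_dvd) simp
    then have "ex_design False TYPE('a) 8 4 l'"
      using ex_design_gf_fill[where 'a = 'a and 'l = 4 and m = 2 and d = 4 and n = 0 and c = "CARD('a) - 1" and \<mu> = 1
          and l = l' and ns = False] l'(1) by simp
    then have "ex_design True TYPE('a) 8 4 l" by (rule ex_design_nonsimple[OF _ l'(2,3)]) simp
    then show ?thesis
      using ex_design_gf_fill[where 'a = 'a and 'l = 8 and m = m and d = 3 and n = 1 and c = "CARD('a) - 1" and \<mu> = 1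
          and l = l and ns = True] l m by (simp add: prod_less_small)
  qed
  have case_viii: "ex_design True TYPE('a) (8*m) 4 (520 * (3^(8*m-2) - 3^14))"
    if q: "CARD('a) = 3" and m: "3 \<le> m" for m
  \<comment> \<open>3120 = (3^4 - 1)(3^4 - 3) / 2 = 6 * 520.\<close>
  proof (rule dim_8[OF m, of _ 3120])
    let ?A = "3^(8*m-2) - 3^14 :: nat"
    have "6 dvd ?A" using m by (intro dvd_power_diff) auto
    then show "3120 dvd 520 * ?A" using mult_dvd_mono[of 520 520 6 ?A] by simp
    show "3120 < 520 * ?A" using m power_diff_ge[of 3 14 2 "8*m"] by simp
    have "(3 ^ 8) ^ m - (3 ^ 8) ^ 2 = 3 ^ 2 * ?A" using m power_diff_factor[of 2 8 m 2 3] by simp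
    then show "520 * ?A * ((CARD('a) - 1) * (CARD('a) ^ 4 - CARD('a) ^ 3)) =
      (CARD('a) ^ 4 - 1) * (CARD('a) ^ 4 - CARD('a)) * ((CARD('a) ^ 8) ^ m - (CARD('a) ^ 8) ^ 2)"
      unfolding q by simp
  qed (simp add: q)
  have case_ix: "ex_design True TYPE('a) (8*m) 4 (7140 * (4^(8*m-3) - 4^13))"
    if q: "CARD('a) = 4" and m: "3 \<le> m" for m
  \<comment> \<open>21420 = (4^4 - 1)(4^4 - 4) / 3 = 3 * 7140.\<close>
  proof (rule dim_8[OF m, of _ 21420])
    let ?A = "4^(8*m-3) - 4^13 :: nat"
    have "3 dvd ?A" using m by (intro dvd_power_diff) auto
    then show "21420 dvd 7140 * ?A" using mult_dvd_mono[of 7140 7140 3 ?A] by simp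
    show "21420 < 7140 * ?A" using m power_diff_ge[of 4 13 3 "8*m"] by simp
    have "(4 ^ 8) ^ m - (4 ^ 8) ^ 2 = 4 ^ 3 * ?A" using m power_diff_factor[of 3 8 m 2 4] by simp
    then show "7140 * ?A * ((CARD('a) - 1) * (CARD('a) ^ 4 - CARD('a) ^ 3)) =
      (CARD('a) ^ 4 - 1) * (CARD('a) ^ 4 - CARD('a)) * ((CARD('a) ^ 8) ^ m - (CARD('a) ^ 8) ^ 2)"
      unfolding q by simp
  qed (simp add: q)
  have case_x: "ex_design True TYPE('a) (8*m) 4 (4836 * (5^(8*m-2) - 5^14))"
    if q: "CARD('a) = 5" and m: "3 \<le> m" for m
  \<comment> \<open>96720 = (5^4 - 1)(5^4 - 5) / 4 = 20 * 4836.\<close>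
  proof (rule dim_8[OF m, of _ 96720])
    let ?A = "5^(8*m-2) - 5^14 :: nat"
    have "20 dvd ?A" using m by (intro dvd_power_diff) auto
    then show "96720 dvd 4836 * ?A" using mult_dvd_mono[of 4836 4836 20 ?A] by simp
    show "96720 < 4836 * ?A" using m power_diff_ge[of 5 14 2 "8*m"] by simp
    have "(5 ^ 8) ^ m - (5 ^ 8) ^ 2 = 5 ^ 2 * ?A" using m power_diff_factor[of 2 8 m 2 5] by simp
    then show "4836 * ?A * ((CARD('a) - 1) * (CARD('a) ^ 4 - CARD('a) ^ 3)) =
      (CARD('a) ^ 4 - 1) * (CARD('a) ^ 4 - CARD('a)) * ((CARD('a) ^ 8) ^ m - (CARD('a) ^ 8) ^ 2)"
      unfolding q by simp
  qed (simp add: q)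
  show ?thesis
    unfolding F
    using case_i case_ii case_iii case_iv case_v case_vi case_vii case_viii case_ix case_x by blast
qed

end
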